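(* Suppose the Markov chain $\Xi$ on $\mathbb X\subseteq\mathbb R$ satisfies $(\mathrm T^{\mathrm{in}}_{\alpha,\beta,c})$ and $(\mathrm D'_{\gamma,b})$, and let $q>0$. Then for all $a$ sufficiently large and all $x$ with $|x|>a$: (i) if $\gamma>\beta-1>1/2$, then $\mathbb E_x[\tau_a^q]<\infty$ for $q<\frac{2\beta-3}{\beta}$ and $=\infty$ for $q>\frac{2\beta-3}{\beta}$; (ii) if $\gamma=\beta-1$ and $b+c\pi\cot(\pi\beta)<0$, then $\mathbb E_x[\tau_a^q]<\infty$ for $q<\nu^\star/\beta$ and $=\infty$ for $q>\nu^\star/\beta$, where $\nu^\star\in(0,\beta)$ is the unique solution of $$\frac bc=\Gamma(\nu^\star)\left(\frac{(1-\beta+\nu^\star)\Gamma(1-\beta)}{\Gamma(2-\beta+\nu^\star)}-\frac{\Gamma(\beta-\nu^\star)}{\Gamma(\beta)}\right);$$ (iii) if $\gamma<\beta-1$ and $b<0$, then $\mathbb E_x[\tau_a^q]<\infty$ for $q<\frac{\beta}{\gamma+1}$ and $=\infty$ for $q\ge\frac{\beta}{\gamma+1}$.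
   Context: $\Xi=(\xi_n)_{n\ge0}$ is a time-homogeneous Markov chain on an infinite, unbounded, measurable $\mathbb X\subseteq\mathbb R$. $\mathbb P_x,\mathbb E_x$ refer to the chain started at $x$; $\theta:=\xi_1-\xi_0$; $y_+:=y\mathbf 1\{y\ge0\}$, $y_-:=-y\mathbf 1\{y<0\}$; $\mu(x):=\mathbb E_x[\theta]$; $\tau_a:=\min\{n\ge0:|\xi_n|\le a\}$; $\Gamma$ is the gamma function. $(\mathrm T^{\mathrm{in}}_{\alpha,\beta,c})$: there exist $\beta\in(1,2)$, $\alpha>\beta$, $c>0$, $x_0\in\mathbb R_+$ with $\lim_{y\to\infty}\sup_{x\ge x_0}|y^\beta\mathbb P_x[\theta_->y]-c|=\lim_{y\to\infty}\sup_{x\le-x_0}|y^\beta\mathbb P_x[\theta_+>y]-c|=0$, $\sup_{x\ge x_0}\mathbb E_x[\theta_+^\alpha]<\infty$, $\sup_{x\le-x_0}\mathbb E_x[\theta_-^\alpha]<\infty$. $(\mathrm D'_{\gamma,b})$: there exist $\gamma\ge0$, $b\in\mathbb R$ with $\lim_{x\to+\infty}x^\gamma\mu(x)=\lim_{x\to-\infty}(-|x|^\gamma\mu(x))=b$. *)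

theory Defs
  imports "HOL-Probability.Probability"
begin

definition pos_part :: "real \<Rightarrow> real" where
  "pos_part y = (if y \<ge> 0 then y else 0)"

definition neg_part :: "real \<Rightarrow> real" where
  "neg_part y = (if y < 0 then - y else 0)"

text \<open>Finite-dimensional distributions generated by a transition kernel K:
  kfdd K [A0,...,An] x = P_x(xi_0 in A0, ..., xi_n in An).\<close>
fun kfdd :: "(real \<Rightarrow> real measure) \<Rightarrow> real set list \<Rightarrow> real \<Rightarrow> ennreal" where
  "kfdd K [] x = 1"
| "kfdd K (A # As) x = indicator A x * (\<integral>\<^sup>+ y. kfdd K As y \<partial>K x)"

text \<open>Xi = (xi n) is a time-homogeneous Markov chain on X with transition kernel K;
  Omega x is the probability space underlying P_x (chain started at x).\<close>
definition is_markov_chain ::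
  "real set \<Rightarrow> (real \<Rightarrow> real measure) \<Rightarrow> (real \<Rightarrow> 'w measure) \<Rightarrow> (nat \<Rightarrow> 'w \<Rightarrow> real) \<Rightarrow> bool" where
  "is_markov_chain X K \<Omega> \<xi> \<longleftrightarrow>
     X \<in> sets borel \<and> infinite X \<and> \<not> bounded X \<and>
     K \<in> borel \<rightarrow>\<^sub>M prob_algebra borel \<and>
     (\<forall>x\<in>X. emeasure (K x) X = 1) \<and>
     (\<forall>x\<in>X. prob_space (\<Omega> x) \<and> (\<forall>n. \<xi> n \<in> borel_measurable (\<Omega> x)) \<and>
        (\<forall>As. set As \<subseteq> sets borel \<longrightarrow>
           emeasure (\<Omega> x) {\<omega> \<in> space (\<Omega> x). \<forall>i < length As. \<xi> i \<omega> \<in> As ! i}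
             = kfdd K As x))"

definition increment :: "(nat \<Rightarrow> 'w \<Rightarrow> real) \<Rightarrow> 'w \<Rightarrow> real" where
  "increment \<xi> \<omega> = \<xi> 1 \<omega> - \<xi> 0 \<omega>"

definition drift :: "(real \<Rightarrow> 'w measure) \<Rightarrow> (nat \<Rightarrow> 'w \<Rightarrow> real) \<Rightarrow> real \<Rightarrow> real" where
  "drift \<Omega> \<xi> x = integral\<^sup>L (\<Omega> x) (increment \<xi>)"

definition cond_T_in ::
  "real set \<Rightarrow> (real \<Rightarrow> 'w measure) \<Rightarrow> (nat \<Rightarrow> 'w \<Rightarrow> real) \<Rightarrow> real \<Rightarrow> real \<Rightarrow> real \<Rightarrow> real \<Rightarrow> bool" where
  "cond_T_in X \<Omega> \<xi> \<alpha> \<beta> c x0 \<longleftrightarrow>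
     1 < \<beta> \<and> \<beta> < 2 \<and> \<alpha> > \<beta> \<and> c > 0 \<and> x0 \<ge> 0 \<and>
     (\<forall>\<epsilon>>0. \<exists>Y. \<forall>y\<ge>Y. \<forall>x\<in>X. x \<ge> x0 \<longrightarrow>
        \<bar>y powr \<beta> * measure (\<Omega> x) {\<omega> \<in> space (\<Omega> x). neg_part (increment \<xi> \<omega>) > y} - c\<bar> \<le> \<epsilon>) \<and>
     (\<forall>\<epsilon>>0. \<exists>Y. \<forall>y\<ge>Y. \<forall>x\<in>X. x \<le> - x0 \<longrightarrow>
        \<bar>y powr \<beta> * measure (\<Omega> x) {\<omega> \<in> space (\<Omega> x). pos_part (increment \<xi> \<omega>) > y} - c\<bar> \<le> \<epsilon>) \<and>
     (\<exists>B::real. \<forall>x\<in>X. x \<ge> x0 \<longrightarrow>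
        (\<integral>\<^sup>+ \<omega>. ennreal (pos_part (increment \<xi> \<omega>) powr \<alpha>) \<partial>\<Omega> x) \<le> ennreal B) \<and>
     (\<exists>B::real. \<forall>x\<in>X. x \<le> - x0 \<longrightarrow>
        (\<integral>\<^sup>+ \<omega>. ennreal (neg_part (increment \<xi> \<omega>) powr \<alpha>) \<partial>\<Omega> x) \<le> ennreal B)"

definition cond_D' ::
  "real set \<Rightarrow> (real \<Rightarrow> 'w measure) \<Rightarrow> (nat \<Rightarrow> 'w \<Rightarrow> real) \<Rightarrow> real \<Rightarrow> real \<Rightarrow> bool" where
  "cond_D' X \<Omega> \<xi> \<gamma> b \<longleftrightarrow> \<gamma> \<ge> 0 \<and>
     (\<forall>\<epsilon>>0. \<exists>M. \<forall>x\<in>X. x \<ge> M \<longrightarrow> \<bar>x powr \<gamma> * drift \<Omega> \<xi> x - b\<bar> \<le> \<epsilon>) \<and>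
     (\<forall>\<epsilon>>0. \<exists>M. \<forall>x\<in>X. x \<le> - M \<longrightarrow> \<bar>- (\<bar>x\<bar> powr \<gamma> * drift \<Omega> \<xi> x) - b\<bar> \<le> \<epsilon>)"

definition hit_time :: "(nat \<Rightarrow> 'w \<Rightarrow> real) \<Rightarrow> real \<Rightarrow> 'w \<Rightarrow> enat" where
  "hit_time \<xi> a \<omega> = (if \<exists>n. \<bar>\<xi> n \<omega>\<bar> \<le> a then enat (LEAST n. \<bar>\<xi> n \<omega>\<bar> \<le> a) else \<infinity>)"

definition hit_moment ::
  "(real \<Rightarrow> 'w measure) \<Rightarrow> (nat \<Rightarrow> 'w \<Rightarrow> real) \<Rightarrow> real \<Rightarrow> real \<Rightarrow> real \<Rightarrow> ennreal" where
  "hit_moment \<Omega> \<xi> a q x = (\<integral>\<^sup>+ \<omega>. (case hit_time \<xi> a \<omega> of enat n \<Rightarrow> ennreal (real n powr q) | \<infinity> \<Rightarrow> \<infinity>) \<partial>\<Omega> x)"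

end

theory Submission
  imports Defs "HOL-Real_Asymp.Real_Asymp"
begin

text \<open>
  Everything is read off the survival probabilities \<open>surv a n x\<close> = P_x(tau_a >= n), which satisfy a
  recursion along the kernel, so that bounds follow by induction on n from functions that are
  super- or subsolutions.  The test functions are the powers of the absolute value: the increment of
  \<open>\<bar>x\<bar> powr s\<close> has mean \<open>\<bar>x\<bar> powr (s - \<kappa>)\<close> times a constant, with \<open>\<kappa> = \<gamma> + 1\<close>, and in the critical
  case \<open>\<gamma> = \<beta> - 1\<close> this constant is \<open>s * (b - c * critical_ratio \<beta> s)\<close>, which changes sign exactly
  at \<open>\<nu>\<close>.  A negative constant gives \<open>surv a n x = O(n powr (- s / \<kappa>))\<close>.  Conversely, started at
  distance R the chain needs about \<open>R powr \<kappa>\<close> steps to return; distance R is reached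
  with probability of order \<open>R powr (- s)\<close> if the constant is positive, and by a single overshooting jump with
  probability of order \<open>R powr (- \<beta>)\<close>.  The case \<open>\<gamma> > \<beta> - 1\<close> is the critical case with \<open>b = 0\<close>.
\<close>

section \<open>Survival probabilities\<close>

text \<open>The inward jumps have infinite variance and are known only through their tails, so a
  Taylor expansion of |x|^s fails for jumps comparable to |x|. Instead the change of |x|^s less its
  linear part is integrated by parts against the tail; rescaled by |x|, the tail becomes c *
  u^(-\<beta>), and the coefficient is an explicit integral that Beta functions evaluate. The linear
  part is the mean drift. Only s < \<beta> is admissible, since a jump over the origin lands at a
  distance whose tail has index \<beta>. If \<gamma> < \<beta> - 1, the decay exponent \<beta> /
  \<kappa> exceeds 1; there a uniform loss per step no longer suffices, and the upper bound needs a
  second round that uses the first one as its source term. The endpoints differ because of the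
  escape estimate. It works on the time scale R^p when moments of order p < \<beta> are bounded and
  p \<le> \<kappa>. In the critical case \<kappa> = \<beta>, so p stays strictly below \<kappa> and
  the value q = \<nu> / \<beta> is left open; for \<gamma> < \<beta> - 1 the choice p = \<kappa> is
  allowed and q = \<beta> / \<kappa> is decided.\<close>

locale markov_kernel =
  fixes X :: "real set" and K :: "real \<Rightarrow> real measure"
  assumes X_borel [measurable]: "X \<in> sets borel"
    and K_prob_algebra: "K \<in> borel \<rightarrow>\<^sub>M prob_algebra borel"
    and K_X: "x \<in> X \<Longrightarrow> emeasure (K x) X = 1"
begin

lemma K_subprob_algebra [measurable]: "K \<in> borel \<rightarrow>\<^sub>M subprob_algebra borel"
  using K_prob_algebra by (rule measurable_prob_algebraD)

lemma prob_space_K: "prob_space (K x)"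
  using measurable_space[OF K_prob_algebra, of x] by (simp add: space_prob_algebra)

lemma sets_K [simp, measurable_cong]: "sets (K x) = sets borel"
  using measurable_space[OF K_prob_algebra, of x] by (simp add: space_prob_algebra)

lemma space_K [simp]: "space (K x) = UNIV"
  using sets_eq_imp_space_eq[OF sets_K] by simp

lemma emeasure_K_UNIV [simp]: "emeasure (K x) UNIV = 1"
  using prob_space.emeasure_space_1[OF prob_space_K[of x]] by simp

lemma measure_K_UNIV [simp]: "measure (K x) UNIV = 1"
  by (simp add: measure_def)

lemma AE_K_X: assumes "x \<in> X" shows "AE y in K x. y \<in> X"
proof -
  interpret prob_space "K x" by (rule prob_space_K)
  show ?thesis
    using K_X[OF assms] X_borel by (intro AE_in_set_eq_1[THEN iffD2]) (auto simp: emeasure_eq_measure)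
qed

text \<open>\<open>surv a n x\<close> is the probability that the chain started at \<open>x\<close> avoids \<open>{-a..a}\<close> at the times \<open>0, \<dots>, n - 1\<close>.
At time 0 it is 1 even if \<open>\<bar>x\<bar> \<le> a\<close>.\<close>

primrec surv :: "real \<Rightarrow> nat \<Rightarrow> real \<Rightarrow> real" where
  "surv a 0 x = 1"
| "surv a (Suc n) x = (if \<bar>x\<bar> > a then \<integral>y. surv a n y \<partial>K x else 0)"

lemma surv_measurable [measurable]: "surv a n \<in> borel_measurable borel"
proof (induction n)
  case (Suc n)
  then have [measurable]: "surv a n \<in> borel_measurable borel" .
  show ?case by simp
qed simp

lemma surv_bounds: "0 \<le> surv a n x \<and> surv a n x \<le> 1"
proof (induction n arbitrary: x)
  case (Suc n)
  interpret prob_space "K x" by (rule prob_space_K)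
  have "integrable (K x) (surv a n)"
    by (rule integrable_const_bound[where B=1]) (use Suc in auto)
  then have "(\<integral>y. surv a n y \<partial>K x) \<le> (\<integral>y. 1 \<partial>K x)"
    by (intro integral_mono) (use Suc in auto)
  then show ?case using Suc by simp
qed simp

lemma surv_nonneg [simp]: "0 \<le> surv a n x" and surv_le_1 [simp]: "surv a n x \<le> 1"
  using surv_bounds by auto

lemma integrable_surv [simp]: "integrable (K x) (surv a n)"
proof -
  interpret prob_space "K x" by (rule prob_space_K)
  show ?thesis by (rule integrable_const_bound[where B=1]) auto
qed

lemma surv_Suc_le: "surv a (Suc n) x \<le> surv a n x"
proof (induction n arbitrary: x)
  case (Suc n)
  have "(\<integral>y. surv a (Suc n) y \<partial>K x) \<le> (\<integral>y. surv a n y \<partial>K x)"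
    by (rule integral_mono[OF integrable_surv integrable_surv]) (rule Suc)
  then show ?case by (simp del: surv.simps add: surv.simps(2)[of a _ x])
qed (use surv_le_1[of a "Suc 0" x] in simp)

lemma surv_antimono: "m \<le> n \<Longrightarrow> surv a n x \<le> surv a m x"
  using lift_Suc_antimono_le[of "\<lambda>n. surv a n x"] surv_Suc_le by blast

text \<open>Test functions obey their inequalities only at states of \<open>X\<close>, so the
  comparison must tolerate failure off \<open>X\<close>; \<open>AE_K_X\<close> makes this harmless.
  This and its mirror image are the induction steps for super- and subsolutions.\<close>

lemma surv_Suc_mono:
  assumes "x \<in> X" "\<bar>x\<bar> > a" "integrable (K x) g" "\<And>y. y \<in> X \<Longrightarrow> surv a n y \<le> g y"
  shows "surv a (Suc n) x \<le> (\<integral>y. g y \<partial>K x)"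
  using assms AE_K_X[OF assms(1)] by (auto intro!: integral_mono_AE)

lemma surv_Suc_mono':
  assumes "x \<in> X" "\<bar>x\<bar> > a" "integrable (K x) g" "\<And>y. y \<in> X \<Longrightarrow> g y \<le> surv a n y"
  shows "(\<integral>y. g y \<partial>K x) \<le> surv a (Suc n) x"
  using assms AE_K_X[OF assms(1)] by (auto intro!: integral_mono_AE)

lemma integrable_const_K [simp]: "integrable (K x) (\<lambda>_. c :: real)"
  using prob_space.finite_measure[OF prob_space_K] by (rule finite_measure.integrable_const)

text \<open>The term \<open>1 - k / N\<close> starts at 1, as the induction base needs, and is gone
  at time \<open>N\<close>, where only the power is left. The restriction
  \<open>\<nu> < \<kappa>\<close> makes the drift gain, of order |x|^(\<nu> - \<kappa>), smallest at
  the outer end \<open>R\<close> of the region where it has to pay.\<close>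

lemma surv_upper_subcritical:
  assumes a: "a \<ge> 0" and \<nu>: "0 < \<nu>" "\<nu> < \<kappa>" and e: "e > 0"
    and int: "\<And>x. x \<in> X \<Longrightarrow> \<bar>x\<bar> > a \<Longrightarrow> integrable (K x) (\<lambda>y. \<bar>y\<bar> powr \<nu>)"
    and drift: "\<And>x. x \<in> X \<Longrightarrow> \<bar>x\<bar> > a \<Longrightarrow>
        (\<integral>y. \<bar>y\<bar> powr \<nu> \<partial>K x) \<le> \<bar>x\<bar> powr \<nu> - e * \<bar>x\<bar> powr (\<nu> - \<kappa>)"
  shows "\<exists>C>0. \<forall>n\<ge>1. \<forall>x\<in>X. surv a n x \<le> C * \<bar>x\<bar> powr \<nu> * real n powr (- \<nu> / \<kappa>)"
proof (intro exI conjI allI impI ballI)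
  \<comment> \<open>\<open>A \<ge> 1\<close> lifts the supersolution to 1 beyond \<open>R\<close>;
    \<open>A * e \<ge> 1\<close> lets the drift cover the loss below \<open>R\<close>.\<close>
  define A where "A = max 1 (1 / e)"
  have A: "A \<ge> 1" "A * e \<ge> 1" using e by (auto simp: A_def field_simps max_def)
  then show "A > 0" by simp
  have \<kappa>: "\<kappa> > 0" using \<nu> by simp
  fix N :: nat and x assume N: "N \<ge> 1" and x: "x \<in> X"
  \<comment> \<open>With this scale R^(-\<kappa>) is the loss per step and R^(-\<nu>) is the claimed
    rate.\<close>
  define R where "R = real N powr (1 / \<kappa>)"
  have R: "R > 0" using N by (simp add: R_def)
  have R\<kappa>: "R powr \<kappa> = N" and R\<nu>: "R powr (-\<nu>) = real N powr (-\<nu>/\<kappa>)"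
    using N \<kappa> by (simp_all add: R_def powr_powr)
  \<comment> \<open>a supersolution up to time \<open>N\<close>: it exceeds 1 beyond \<open>R\<close>, and below \<open>R\<close> the drift pays for the loss \<open>1 / N\<close> per step\<close>
  define g where "g k x = A * R powr (-\<nu>) * \<bar>x\<bar> powr \<nu> + (1 - real k / real N)" for k :: nat and x :: real
  have "surv a k x \<le> g k x" if "k \<le> N" "x \<in> X" for k x
    using that
  proof (induction k arbitrary: x)
    case 0
    then show ?case using A by (simp add: g_def)
  next
    case (Suc k)
    have frac: "real (Suc k) / real N \<le> 1" using Suc N by simp
    have nn: "A * R powr (-\<nu>) * \<bar>x\<bar> powr \<nu> \<ge> 0" using A by simp
    show ?case
    proof (cases "\<bar>x\<bar> \<le> a")
      case True
      then show ?thesis using frac nn by (simp add: g_def)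
    next
      case False
      then have xa: "\<bar>x\<bar> > a" by simp
      then have x0: "\<bar>x\<bar> > 0" using a by simp
      show ?thesis
      proof (cases "\<bar>x\<bar> \<ge> R")
        case True
        have "1 \<le> A * R powr (-\<nu>) * R powr \<nu>"
          using A R by (simp add: mult.assoc powr_add[symmetric])
        also have "\<dots> \<le> A * R powr (-\<nu>) * \<bar>x\<bar> powr \<nu>"
          using True R \<nu> A by (intro mult_left_mono powr_mono2) auto
        finally show ?thesis
          using frac order_trans[OF surv_le_1[of a "Suc k" x]] by (simp add: g_def del: surv.simps)
      next
        case False
        have "integrable (K x) (g k)"
          unfolding g_def using int[OF Suc.prems(2) xa] by simp
        then have "surv a (Suc k) x \<le> (\<integral>y. g k y \<partial>K x)"
          using Suc xa by (intro surv_Suc_mono) auto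
        also have "\<dots> = A * R powr (-\<nu>) * (\<integral>y. \<bar>y\<bar> powr \<nu> \<partial>K x) + (1 - real k / real N)"
          unfolding g_def using int[OF Suc.prems(2) xa] by simp
        also have "\<dots> \<le> A * R powr (-\<nu>) * (\<bar>x\<bar> powr \<nu> - e * \<bar>x\<bar> powr (\<nu> - \<kappa>)) + (1 - real k / real N)"
          using drift[OF Suc.prems(2) xa] A by (intro add_right_mono mult_left_mono) auto
        also have "\<dots> = g k x - A * e * R powr (-\<nu>) * \<bar>x\<bar> powr (\<nu> - \<kappa>)"
          by (simp add: g_def algebra_simps)
        also have "1 / real N \<le> A * e * R powr (-\<nu>) * \<bar>x\<bar> powr (\<nu> - \<kappa>)"
        proof -
          have "1 / real N = R powr (-\<nu>) * R powr (\<nu>-\<kappa>)"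
            using R R\<kappa>[symmetric] powr_minus_divide[of R \<kappa>] by (simp only: powr_add[symmetric]) simp
          also have "\<dots> \<le> R powr (-\<nu>) * \<bar>x\<bar> powr (\<nu> - \<kappa>)"
            using False x0 \<nu> by (intro mult_left_mono powr_mono2') auto
          also have "\<dots> \<le> (A * e) * (R powr (-\<nu>) * \<bar>x\<bar> powr (\<nu> - \<kappa>))"
            using A mult_right_mono[of 1 "A * e" "R powr (-\<nu>) * \<bar>x\<bar> powr (\<nu> - \<kappa>)"] by simp
          finally show ?thesis by (simp add: mult_ac)
        qed
        then have "g k x - A * e * R powr (-\<nu>) * \<bar>x\<bar> powr (\<nu> - \<kappa>) \<le> g (Suc k) x"
          by (simp add: g_def add_divide_distrib)
        finally show ?thesis .
      qed
    qed
  qed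
  from this[of N x] show "surv a N x \<le> A * \<bar>x\<bar> powr \<nu> * real N powr (- \<nu> / \<kappa>)"
    using x N by (simp add: g_def R\<nu> mult_ac)
qed

text \<open>Beyond \<kappa> the drift gain grows with |x|, so it cannot pay a constant loss near the
  origin. It can pay a loss that is itself of order |x|^(\<nu> - \<kappa>), and the subcritical
  bound with exponent \<nu> - \<kappa> supplies exactly that; \<open>\<nu> < 2 * \<kappa>\<close>
  keeps this exponent below \<kappa>.\<close>

lemma surv_upper_supercritical:
  assumes a: "a \<ge> 0" and \<nu>: "\<kappa> < \<nu>" "\<nu> < 2 * \<kappa>" and e: "e > 0"
    and int: "\<And>x s. x \<in> X \<Longrightarrow> \<bar>x\<bar> > a \<Longrightarrow> s \<in> {\<nu> - \<kappa>, \<nu>} \<Longrightarrow> integrable (K x) (\<lambda>y. \<bar>y\<bar> powr s)"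
    and drift: "\<And>x s. x \<in> X \<Longrightarrow> \<bar>x\<bar> > a \<Longrightarrow> s \<in> {\<nu> - \<kappa>, \<nu>} \<Longrightarrow>
        (\<integral>y. \<bar>y\<bar> powr s \<partial>K x) \<le> \<bar>x\<bar> powr s - e * \<bar>x\<bar> powr (s - \<kappa>)"
  shows "\<exists>C>0. \<forall>n\<ge>1. \<forall>x\<in>X. surv a (2 * n) x \<le> C * \<bar>x\<bar> powr \<nu> * real n powr (- \<nu> / \<kappa>)"
proof -
  have \<kappa>: "\<kappa> > 0" using \<nu> by simp
  obtain C where C: "C > 0" "\<And>n x. n \<ge> 1 \<Longrightarrow> x \<in> X \<Longrightarrow>
      surv a n x \<le> C * \<bar>x\<bar> powr (\<nu> - \<kappa>) * real n powr (- (\<nu> - \<kappa>) / \<kappa>)"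
    using surv_upper_subcritical[of a "\<nu> - \<kappa>" \<kappa> e, OF a _ _ e int drift] \<nu> by fastforce
  show ?thesis
  proof (intro exI conjI allI impI ballI)
    show "C / e > 0" using C e by simp
    fix n :: nat and x assume n: "n \<ge> 1" and x: "x \<in> X"
    define D where "D = C / e * real n powr (- (\<nu> - \<kappa>) / \<kappa>)"
    have D: "D \<ge> 0" using C e by (simp add: D_def)
    \<comment> \<open>\<open>surv a n\<close> is of order \<open>\<bar>x\<bar> powr (\<nu> - \<kappa>)\<close>, and the drift of \<open>\<bar>x\<bar> powr \<nu>\<close> pays for \<open>k\<close> copies of it\<close>
    have "real k * surv a (n + k) x \<le> D * \<bar>x\<bar> powr \<nu>" if "x \<in> X" for k x
      using that
    proof (induction k arbitrary: x)
      case 0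
      then show ?case using D by simp
    next
      case (Suc k)
      show ?case
      proof (cases "\<bar>x\<bar> \<le> a")
        case True
        then show ?thesis using D by simp
      next
        case False
        then have xa: "\<bar>x\<bar> > a" by simp
        have i: "integrable (K x) (\<lambda>y. D * \<bar>y\<bar> powr \<nu>)"
          using int[OF Suc.prems(1) xa] by simp
        have "real k * (\<integral>y. surv a (n + k) y \<partial>K x) = (\<integral>y. real k * surv a (n + k) y \<partial>K x)"
          by simp
        also have "\<dots> \<le> (\<integral>y. D * \<bar>y\<bar> powr \<nu> \<partial>K x)"
          using AE_K_X[OF Suc.prems] Suc.IH by (intro integral_mono_AE i) auto
        also have "\<dots> = D * (\<integral>y. \<bar>y\<bar> powr \<nu> \<partial>K x)" by simp
        also have "\<dots> \<le> D * (\<bar>x\<bar> powr \<nu> - e * \<bar>x\<bar> powr (\<nu> - \<kappa>))"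
          using drift[OF Suc.prems xa, of \<nu>] D by (intro mult_left_mono) auto
        finally have 1: "real k * surv a (n + Suc k) x \<le> D * \<bar>x\<bar> powr \<nu> - D * e * \<bar>x\<bar> powr (\<nu> - \<kappa>)"
          using xa by (simp add: algebra_simps)
        have "surv a (n + Suc k) x \<le> surv a n x" by (intro surv_antimono) simp
        also have "\<dots> \<le> D * e * \<bar>x\<bar> powr (\<nu> - \<kappa>)"
          using C(2)[OF n Suc.prems] e by (simp add: D_def mult_ac)
        finally show ?thesis using 1 by (simp add: algebra_simps)
      qed
    qed
    \<comment> \<open>Taking \<open>k = n\<close> gains one further power of n at the price of
      doubling the time.\<close>
    from this[OF x, of n] have "real n * surv a (2 * n) x \<le> D * \<bar>x\<bar> powr \<nu>" by (simp add: mult_2)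
    then have "surv a (2 * n) x \<le> (D * real n powr (-1)) * \<bar>x\<bar> powr \<nu>"
      using n by (simp add: powr_minus field_simps)
    also have "D * real n powr (-1) = C / e * real n powr (- \<nu> / \<kappa>)"
    proof -
      have "- (\<nu> - \<kappa>) / \<kappa> + (-1) = - \<nu> / \<kappa>" using \<kappa> by (simp add: field_simps)
      then show ?thesis unfolding D_def mult.assoc powr_add[symmetric] by simp
    qed
    finally show "surv a (2 * n) x \<le> C / e * \<bar>x\<bar> powr \<nu> * real n powr (- \<nu> / \<kappa>)"
      by (simp add: mult_ac)
  qed
qed

end

text \<open>Increments have no second moment, so the usual quadratic remainder is useless. The bump
  is bounded with bounded derivative, hence the remainder is at most a multiple of the minimum of
  |h| and h^2, which every power between 1 and 2 dominates.\<close>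

lemma cauchy_bump_taylor:
  fixes t h p :: real
  assumes p: "1 \<le> p" "p \<le> 2"
  shows "1 / (1 + (t + h)\<^sup>2) \<le> 1 / (1 + t\<^sup>2) - 2 * t / (1 + t\<^sup>2)\<^sup>2 * h + 4 * \<bar>h\<bar> powr p"
proof -
  define d where "d = 1 + t\<^sup>2"
  define e where "e = 1 + (t + h)\<^sup>2"
  have d: "d \<ge> 1" and e: "e \<ge> 1" by (auto simp: d_def e_def)
  have t: "2 * \<bar>t\<bar> \<le> d" using sum_squares_bound[of "\<bar>t\<bar>" 1] by (simp add: d_def)
  have ed: "e = d + 2 * t * h + h\<^sup>2" by (simp add: e_def d_def power2_eq_square algebra_simps)
  \<comment> \<open>The exact remainder; the factor h^2 settles small h, while crude bounds suffice
    for |h| > 1.\<close>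
  have id: "1 / e - (1 / d - 2 * t / d\<^sup>2 * h) = h\<^sup>2 * (4 * t\<^sup>2 + 2 * t * h - d) / (e * d\<^sup>2)"
  proof -
    have "1 / e - (1 / d - 2 * t / d\<^sup>2 * h) = (d\<^sup>2 - e * d + 2 * t * h * e) / (e * d\<^sup>2)"
      using d e by (simp add: divide_simps power2_eq_square) (simp add: algebra_simps)
    also have "d\<^sup>2 - e * d + 2 * t * h * e = h\<^sup>2 * (4 * t\<^sup>2 + 2 * t * h - d)"
      unfolding ed by (simp add: power2_eq_square algebra_simps)
    finally show ?thesis .
  qed
  have key: "1 / e - (1 / d - 2 * t / d\<^sup>2 * h) \<le> 4 * min (\<bar>h\<bar>) (h\<^sup>2)"
  proof (cases "\<bar>h\<bar> \<le> 1")
    case True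
    have "4 * t\<^sup>2 + 2 * t * h - d \<le> 4 * d\<^sup>2 * e"
    proof -
      have "2 * t * h \<le> 2 * \<bar>t\<bar> * \<bar>h\<bar>" by (metis abs_ge_self abs_mult abs_numeral)
      also have "\<dots> \<le> 2 * \<bar>t\<bar>" using True by (simp add: mult_left_le)
      finally have "4 * t\<^sup>2 + 2 * t * h - d \<le> 4 * t\<^sup>2" using t by linarith
      also have "\<dots> \<le> 4 * d" by (simp add: d_def)
      also have "\<dots> \<le> 4 * d\<^sup>2 * e"
      proof -
        have "d * 1 \<le> d * (d * e)" using d e by (intro mult_left_mono) (auto intro: mult_ge1_I)
        then show ?thesis by (simp add: power2_eq_square mult.assoc)
      qed
      finally show ?thesis .
    qed
    then have "h\<^sup>2 * (4 * t\<^sup>2 + 2 * t * h - d) \<le> h\<^sup>2 * (4 * d\<^sup>2 * e)" by (rule mult_left_mono) simp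
    then have "h\<^sup>2 * (4 * t\<^sup>2 + 2 * t * h - d) / (e * d\<^sup>2) \<le> 4 * h\<^sup>2"
      using d e by (simp add: divide_le_eq mult_ac)
    moreover have "h\<^sup>2 \<le> \<bar>h\<bar>"
      using True mult_left_le[of "\<bar>h\<bar>" "\<bar>h\<bar>"] by (simp add: power2_eq_square)
    ultimately show ?thesis using id by (simp add: min_def)
  next
    case False
    have "1 / e \<le> 1" using e by simp
    moreover have "1 / d \<ge> 0" using d by simp
    moreover have "2 * t / d\<^sup>2 * h \<le> \<bar>h\<bar>"
    proof -
      have "\<bar>2 * t / d\<^sup>2\<bar> \<le> 1"
      proof -
        have "\<bar>2 * t\<bar> \<le> d * 1" using t by simp
        also have "\<dots> \<le> d * d" using d by (intro mult_left_mono) auto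
        finally show ?thesis using d by (simp add: abs_divide divide_le_eq power2_eq_square)
      qed
      then have "\<bar>2 * t / d\<^sup>2\<bar> * \<bar>h\<bar> \<le> 1 * \<bar>h\<bar>" by (rule mult_right_mono) simp
      then show ?thesis by (metis abs_ge_self abs_mult mult_1 order_trans)
    qed
    ultimately have "1 / e - (1 / d - 2 * t / d\<^sup>2 * h) \<le> 2 * \<bar>h\<bar>" using False by linarith
    moreover have "\<bar>h\<bar> \<le> h\<^sup>2"
      using False mult_left_mono[of 1 "\<bar>h\<bar>" "\<bar>h\<bar>"] by (simp add: power2_eq_square)
    ultimately show ?thesis by (simp add: min_def)
  qed
  have "min (\<bar>h\<bar>) (h\<^sup>2) \<le> \<bar>h\<bar> powr p"
  proof (cases "\<bar>h\<bar> \<le> 1")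
    case True
    show ?thesis
    proof (cases "h = 0")
      case False
      have "h\<^sup>2 = \<bar>h\<bar> powr 2" using False by (simp add: powr_numeral)
      also have "\<dots> \<le> \<bar>h\<bar> powr p" using True p False by (intro powr_mono') auto
      finally show ?thesis by simp
    qed simp
  next
    case False
    have "\<bar>h\<bar> powr 1 \<le> \<bar>h\<bar> powr p" using False p by (intro powr_mono) auto
    then show ?thesis using False by simp
  qed
  with key show ?thesis by (simp add: d_def e_def)
qed

section \<open>Lower bounds on survival\<close>

context markov_kernel
begin

text \<open>A bump of width \<open>R\<close> around the origin acts as potential: it is at least 1/2
  on the target set, small at distance 3R, and its mean rises by at most a multiple of R^(-p) per
  step. Hence it cannot become large within a small multiple of R^p steps.\<close>

lemma surv_lower_escape:
  assumes a: "a \<ge> 0" and p: "1 \<le> p" "p \<le> 2" and M: "M \<ge> 0"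
    and int: "\<And>x. x \<in> X \<Longrightarrow> \<bar>x\<bar> > a \<Longrightarrow> integrable (K x) (\<lambda>y. \<bar>y - x\<bar> powr p)"
    and int1: "\<And>x. x \<in> X \<Longrightarrow> \<bar>x\<bar> > a \<Longrightarrow> integrable (K x) (\<lambda>y. y - x)"
    and mom: "\<And>x. x \<in> X \<Longrightarrow> \<bar>x\<bar> > a \<Longrightarrow> (\<integral>y. \<bar>y - x\<bar> powr p \<partial>K x) \<le> M"
    and drift: "\<And>x. x \<in> X \<Longrightarrow> \<bar>x\<bar> > a \<Longrightarrow> \<bar>x\<bar> powr (p - 1) * \<bar>\<integral>y. y - x \<partial>K x\<bar> \<le> M"
  shows "\<exists>\<delta>>0. \<forall>R>0. R \<ge> a \<longrightarrow> (\<forall>n. real n \<le> \<delta> * R powr p \<longrightarrow> (\<forall>x\<in>X. \<bar>x\<bar> \<ge> 3 * R \<longrightarrow> surv a n x \<ge> 1 / 2))"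
proof (intro exI conjI allI impI ballI)
  \<comment> \<open>Remainder and drift contribute 4 * M and 2 * M, so 6 * M in all, which stays
    below \<open>D / 2\<close>; the added 1 keeps \<open>D\<close> positive.\<close>
  define D where "D = 12 * (M + 1)"
  have D: "D > 0" using M by (simp add: D_def)
  show "3 / 10 / D > 0" using D by simp
  fix R :: real and n :: nat and x :: real
  assume R: "R > 0" "R \<ge> a" and n: "real n \<le> 3 / 10 / D * R powr p" and x: "x \<in> X" "\<bar>x\<bar> \<ge> 3 * R"
  define u where "u x = 1 / (1 + (x / R)\<^sup>2)" for x :: real
  have u01: "0 \<le> u x" "u x \<le> 1" for x by (auto simp: u_def divide_le_eq add_pos_nonneg)
  have [measurable]: "u \<in> borel_measurable borel" unfolding u_def by measurable
  have intu: "integrable (K x) u" for x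
    using prob_space.finite_measure[OF prob_space_K] u01
    by (intro finite_measure.integrable_const_bound[where B=1]) auto
  have step: "(\<integral>y. u y \<partial>K x) \<le> u x + D / 2 * R powr (-p)" if x: "x \<in> X" "\<bar>x\<bar> > a" for x
  proof -
    define t where "t = x / R"
    define d where "d = 1 + t\<^sup>2"
    have d: "d \<ge> 1" by (simp add: d_def)
    have x0: "\<bar>x\<bar> > 0" using a x by simp
    have t0: "\<bar>t\<bar> > 0" using x0 R by (simp add: t_def)
    have "u y \<le> u x - 2 * t / d\<^sup>2 / R * (y - x) + 4 * R powr (-p) * \<bar>y - x\<bar> powr p" for y
    proof -
      have 1: "y / R = t + (y - x) / R" using R by (simp add: t_def diff_divide_distrib)
      have 2: "\<bar>(y - x) / R\<bar> powr p = R powr (-p) * \<bar>y - x\<bar> powr p"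
        using R by (simp add: abs_divide powr_divide powr_minus_divide)
      show ?thesis
        using cauchy_bump_taylor[OF p, of t "(y - x) / R"]
        unfolding u_def d_def 1 2 by (simp add: t_def)
    qed
    then have "(\<integral>y. u y \<partial>K x) \<le> (\<integral>y. u x - 2 * t / d\<^sup>2 / R * (y - x) + 4 * R powr (-p) * \<bar>y - x\<bar> powr p \<partial>K x)"
      by (intro integral_mono intu) (use int[OF x] int1[OF x] in auto)
    also have "\<dots> = u x - 2 * t / d\<^sup>2 / R * (\<integral>y. y - x \<partial>K x) + 4 * R powr (-p) * (\<integral>y. \<bar>y - x\<bar> powr p \<partial>K x)"
      using int[OF x] int1[OF x] by (subst Bochner_Integration.integral_add Bochner_Integration.integral_diff; simp)+
    finally have 1: "(\<integral>y. u y \<partial>K x)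
        \<le> u x - 2 * t / d\<^sup>2 / R * (\<integral>y. y - x \<partial>K x) + 4 * R powr (-p) * (\<integral>y. \<bar>y - x\<bar> powr p \<partial>K x)" .
    have 2: "4 * R powr (-p) * (\<integral>y. \<bar>y - x\<bar> powr p \<partial>K x) \<le> 4 * R powr (-p) * M"
      using mom[OF x] by (intro mult_left_mono) auto
    have 3: "- (2 * t / d\<^sup>2 / R * (\<integral>y. y - x \<partial>K x)) \<le> 2 * R powr (-p) * M"
    proof -
      have "- (2 * t / d\<^sup>2 / R * (\<integral>y. y - x \<partial>K x)) \<le> \<bar>2 * t / d\<^sup>2 / R * (\<integral>y. y - x \<partial>K x)\<bar>"
        by (rule abs_ge_minus_self)
      also have "\<dots> = 2 * \<bar>t\<bar> / d\<^sup>2 / R * \<bar>\<integral>y. y - x \<partial>K x\<bar>"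
        using R by (simp add: abs_mult abs_divide)
      also have "\<dots> \<le> 2 * \<bar>t\<bar> / d\<^sup>2 / R * (M * \<bar>x\<bar> powr (1 - p))"
      proof (rule mult_left_mono)
        have "\<bar>x\<bar> powr (1 - p) * (\<bar>x\<bar> powr (p - 1) * \<bar>\<integral>y. y - x \<partial>K x\<bar>) \<le> \<bar>x\<bar> powr (1 - p) * M"
          using drift[OF x] by (rule mult_left_mono) simp
        then show "\<bar>\<integral>y. y - x \<partial>K x\<bar> \<le> M * \<bar>x\<bar> powr (1 - p)"
          using x0 by (simp add: powr_add[symmetric] mult.assoc[symmetric] mult.commute)
      qed (use R in simp)
      also have "\<bar>x\<bar> powr (1 - p) = \<bar>t\<bar> powr (1 - p) * R powr (1 - p)"
        using R by (simp add: t_def abs_divide powr_divide)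
      also have "2 * \<bar>t\<bar> / d\<^sup>2 / R * (M * (\<bar>t\<bar> powr (1 - p) * R powr (1 - p)))
          = 2 * M * (\<bar>t\<bar> powr (2 - p) / d\<^sup>2) * R powr (-p)"
      proof -
        have "\<bar>t\<bar> powr (2 - p) = \<bar>t\<bar> * \<bar>t\<bar> powr (1 - p)"
          using t0 powr_add[of "\<bar>t\<bar>" 1 "1 - p"] by simp
        moreover have "R powr (1 - p) = R * R powr (-p)"
          using R powr_add[of R 1 "-p"] by simp
        ultimately show ?thesis using R by (simp add: field_simps)
      qed
      \<comment> \<open>The drift bound M * |x|^(1 - p) may be large near the origin relative to the
        scale \<open>R\<close>, but the derivative of the bump vanishes linearly there, and 2 - p
        \<ge> 0 leaves a bounded product.\<close>
      also have "\<dots> \<le> 2 * M * 1 * R powr (-p)"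
      proof (intro mult_right_mono mult_left_mono)
        have "\<bar>t\<bar> powr (2 - p) \<le> d"
        proof (cases "\<bar>t\<bar> \<le> 1")
          case True
          then have "\<bar>t\<bar> powr (2 - p) \<le> 1" using p by (intro powr_le1) auto
          then show ?thesis using d by simp
        next
          case False
          then have "\<bar>t\<bar> powr (2 - p) \<le> \<bar>t\<bar> powr 2" using p by (intro powr_mono) auto
          also have "\<dots> = t\<^sup>2" using t0 by (simp add: powr_numeral)
          finally show ?thesis by (simp add: d_def)
        qed
        also have "d \<le> d\<^sup>2" using d by (simp add: power2_eq_square)
        finally show "\<bar>t\<bar> powr (2 - p) / d\<^sup>2 \<le> 1" using d by (simp add: divide_le_eq)
      qed (use M in auto)
      finally show ?thesis by (simp add: mult_ac)
    qed
    have "2 * R powr (-p) * M + 4 * R powr (-p) * M \<le> D / 2 * R powr (-p)"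
      by (simp add: D_def algebra_simps)
    with 1 2 3 show ?thesis by linarith
  qed
  \<comment> \<open>The factor 2 makes the right-hand side nonpositive on {-a..a}, where the bump is
    at least 1/2 because \<open>a \<le> R\<close>.\<close>
  have main: "surv a n x \<ge> 1 - 2 * u x - D * R powr (-p) * real n" if "x \<in> X" for n x
    using that
  proof (induction n arbitrary: x)
    case 0
    then show ?case using u01 by simp
  next
    case (Suc n)
    show ?case
    proof (cases "\<bar>x\<bar> \<le> a")
      case True
      then have "\<bar>x / R\<bar> \<le> 1" using R by (simp add: abs_divide)
      then have "(x / R)\<^sup>2 \<le> 1" by (simp add: abs_square_le_1)
      then have "2 * u x \<ge> 1" unfolding u_def by (simp add: field_simps add_pos_nonneg)
      moreover have "D * R powr (-p) * real (Suc n) \<ge> 0" using D by simp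
      ultimately show ?thesis using surv_nonneg[of a "Suc n" x] by linarith
    next
      case False
      then have xa: "\<bar>x\<bar> > a" by simp
      have "1 - 2 * u x - D * R powr (-p) * real (Suc n) \<le> 1 - 2 * (\<integral>y. u y \<partial>K x) - D * R powr (-p) * real n"
        using step[OF Suc.prems xa] by (simp add: algebra_simps)
      also have "\<dots> = (\<integral>y. 1 - 2 * u y - D * R powr (-p) * real n \<partial>K x)"
        using intu by simp
      also have "\<dots> \<le> surv a (Suc n) x"
        using Suc xa intu by (intro surv_Suc_mono') auto
      finally show ?thesis .
    qed
  qed
  \<comment> \<open>The budget is 1 - 2 / 10 - 3 / 10 = 1 / 2.\<close>
  have "u x \<le> 1 / 10"
  proof -
    have "3 \<le> \<bar>x / R\<bar>" using x R by (simp add: abs_divide le_divide_eq)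
    then have "3\<^sup>2 \<le> \<bar>x / R\<bar>\<^sup>2" by (rule power_mono) simp
    then have "3\<^sup>2 \<le> (x / R)\<^sup>2" by (simp only: power2_abs)
    then have "9 \<le> (x / R)\<^sup>2" by simp
    then show ?thesis unfolding u_def by (simp add: field_simps add_pos_nonneg)
  qed
  moreover have "D * R powr (-p) * real n \<le> 3 / 10"
  proof -
    have "D * R powr (-p) * real n \<le> D * R powr (-p) * (3 / 10 / D * R powr p)"
      using n D by (intro mult_left_mono) auto
    also have "\<dots> = 3 / 10" using D R by (simp add: powr_minus)
    finally show ?thesis .
  qed
  ultimately show "surv a n x \<ge> 1 / 2" using main[OF x(1), of n] by linarith
qed

text \<open>The subsolution is normalised to be nonpositive on the target set and at most 1/2
  everywhere. Below the distance 3R its drift carries the induction; from 3R on, the value 1/2 is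
  provided by \<open>escape\<close>. Reaching 3R thus costs a factor R^(-\<nu>), and R^p is
  proportional to n.\<close>

lemma surv_lower_submartingale:
  assumes a: "a \<ge> 0" and \<nu>: "0 < \<nu>" "\<nu> < s" and e: "e > 0" and C: "C \<ge> e" and p: "p > 0" and \<delta>: "\<delta> > 0"
    and int: "\<And>x r. x \<in> X \<Longrightarrow> \<bar>x\<bar> > a \<Longrightarrow> r \<in> {\<nu>, s} \<Longrightarrow> integrable (K x) (\<lambda>y. \<bar>y\<bar> powr r)"
    and sub: "\<And>x. x \<in> X \<Longrightarrow> \<bar>x\<bar> > a \<Longrightarrow> (\<integral>y. \<bar>y\<bar> powr \<nu> \<partial>K x) \<ge> \<bar>x\<bar> powr \<nu> + e * \<bar>x\<bar> powr (\<nu> - \<kappa>)"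
    and super: "\<And>x. x \<in> X \<Longrightarrow> \<bar>x\<bar> > a \<Longrightarrow> (\<integral>y. \<bar>y\<bar> powr s \<partial>K x) \<le> \<bar>x\<bar> powr s + C * \<bar>x\<bar> powr (s - \<kappa>)"
    and escape: "\<And>R n x. R > 0 \<Longrightarrow> R \<ge> a \<Longrightarrow> real n \<le> \<delta> * R powr p \<Longrightarrow> x \<in> X \<Longrightarrow> \<bar>x\<bar> \<ge> 3 * R \<Longrightarrow> surv a n x \<ge> 1 / 2"
    and x: "x \<in> X" "\<bar>x\<bar> > a"
  shows "\<exists>d>0. \<forall>\<^sub>F n in sequentially. surv a n x \<ge> d * real n powr (- \<nu> / p)"
proof -
  \<comment> \<open>Then \<open>r * C = e\<close>: up to distance \<open>T\<close> the possible
    growth of the subtracted s-th power is paid by the gain of the \<nu>-th power.\<close>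
  define r where "r = e / C"
  have r: "0 < r" "r \<le> 1" using e C by (auto simp: r_def)
  \<comment> \<open>The difference of the two powers becomes nonpositive beyond |x| = T * (1 / r)^(1
    / (s - \<nu>)), and |x|^\<nu> at that point is \<open>E * T powr \<nu>\<close>.\<close>
  define E where "E = (1 / r) powr (\<nu> / (s - \<nu>))"
  have E: "E \<ge> 1" unfolding E_def using r \<nu> by (intro ge_one_powr_ge_zero) auto
  \<comment> \<open>subtracting a higher power bounds the test function from above and keeps it a subsolution below \<open>T\<close>\<close>
  define g where "g T x = \<bar>x\<bar> powr \<nu> - r * T powr (\<nu> - s) * \<bar>x\<bar> powr s" for T x :: real
  have g_le: "g T x \<le> E * T powr \<nu>" if T: "T > 0" for T x
  proof (cases "r * \<bar>x\<bar> powr (s - \<nu>) \<le> T powr (s - \<nu>)")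
    case True
    have "\<bar>x\<bar> powr \<nu> = (\<bar>x\<bar> powr (s - \<nu>)) powr (\<nu> / (s - \<nu>))"
      using \<nu> by (simp add: powr_powr)
    also have "\<dots> \<le> (1 / r * T powr (s - \<nu>)) powr (\<nu> / (s - \<nu>))"
      using True r \<nu> by (intro powr_mono2) (auto simp: field_simps)
    also have "\<dots> = E * T powr \<nu>"
      using \<nu> r T by (simp add: powr_mult powr_powr E_def powr_divide)
    finally have "\<bar>x\<bar> powr \<nu> \<le> E * T powr \<nu>" .
    moreover have "r * T powr (\<nu> - s) * \<bar>x\<bar> powr s \<ge> 0" using r by simp
    ultimately show ?thesis by (simp add: g_def)
  next
    case False
    then have x0: "\<bar>x\<bar> > 0" using T by (cases "x = 0") auto
    have "g T x = \<bar>x\<bar> powr \<nu> * (1 - r * T powr (\<nu> - s) * \<bar>x\<bar> powr (s - \<nu>))"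
    proof -
      have "\<bar>x\<bar> powr s = \<bar>x\<bar> powr \<nu> * \<bar>x\<bar> powr (s - \<nu>)"
        by (simp add: powr_add[symmetric])
      then show ?thesis by (simp only: g_def) (simp add: algebra_simps)
    qed
    also have "1 - r * T powr (\<nu> - s) * \<bar>x\<bar> powr (s - \<nu>) \<le> 0"
    proof -
      have "1 = T powr (\<nu> - s) * T powr (s - \<nu>)" using T by (simp add: powr_add[symmetric])
      also have "\<dots> \<le> T powr (\<nu> - s) * (r * \<bar>x\<bar> powr (s - \<nu>))"
        using False by (intro mult_left_mono) auto
      finally show ?thesis by (simp add: mult_ac)
    qed
    then have "\<bar>x\<bar> powr \<nu> * (1 - r * T powr (\<nu> - s) * \<bar>x\<bar> powr (s - \<nu>)) \<le> 0"
      by (simp add: mult_nonneg_nonpos)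
    also have "0 \<le> E * T powr \<nu>" using E by simp
    finally show ?thesis .
  qed
  \<comment> \<open>Subtracting \<open>a powr \<nu>\<close> disposes of the target set; the 2 in the
    denominator matches the escape probability 1/2.\<close>
  have main: "surv a n x \<ge> (g (3 * R) x - a powr \<nu>) / (2 * E * (3 * R) powr \<nu>)"
    if R: "R > 0" "R \<ge> a" and n: "real n \<le> \<delta> * R powr p" and x: "x \<in> X" for R n x
    using n x
  proof (induction n arbitrary: x)
    case 0
    have "g (3 * R) x - a powr \<nu> \<le> 2 * E * (3 * R) powr \<nu>"
    proof -
      have "0 \<le> E * (3 * R) powr \<nu>" using E by simp
      then show ?thesis using g_le[of "3 * R" x] R powr_ge_zero[of a \<nu>] unfolding mult.assoc by linarith
    qed
    then show ?case using E R by (simp add: divide_le_eq)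
  next
    case (Suc n)
    let ?T = "3 * R" and ?Q = "2 * E * (3 * R) powr \<nu>"
    have Q: "?Q > 0" using E R by simp
    have T: "?T > 0" using R by simp
    consider "\<bar>x\<bar> \<le> a" | "\<bar>x\<bar> \<ge> ?T" | "\<bar>x\<bar> > a" "\<bar>x\<bar> < ?T" by linarith
    then show ?case
    proof cases
      case 1
      have "g ?T x \<le> \<bar>x\<bar> powr \<nu>" using r by (simp add: g_def)
      also have "\<dots> \<le> a powr \<nu>" using 1 \<nu> by (intro powr_mono2) auto
      finally have "(g ?T x - a powr \<nu>) / ?Q \<le> 0" using Q by (simp add: divide_le_eq)
      then show ?thesis using surv_nonneg[of a "Suc n" x] by linarith
    next
      case 2
      have "g ?T x - a powr \<nu> \<le> E * ?T powr \<nu>" using g_le[OF T, of x] powr_ge_zero[of a \<nu>] by linarith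
      then have "(g ?T x - a powr \<nu>) / ?Q \<le> 1 / 2" using E R by (simp add: divide_le_eq)
      then show ?thesis using escape[OF R Suc.prems 2] by linarith
    next
      case 3
      have i: "integrable (K x) (\<lambda>y. \<bar>y\<bar> powr \<nu>)" "integrable (K x) (\<lambda>y. \<bar>y\<bar> powr s)"
        using int[OF Suc.prems(2) 3(1)] by auto
      have x0: "\<bar>x\<bar> > 0" using 3 a by simp
      have "g ?T x \<le> (\<integral>y. g ?T y \<partial>K x)"
      proof -
        have "r * ?T powr (\<nu> - s) * (C * \<bar>x\<bar> powr (s - \<kappa>)) = e * (?T powr (\<nu> - s) * \<bar>x\<bar> powr (s - \<kappa>))"
          using e C by (simp add: r_def)
        also have "\<dots> \<le> e * (\<bar>x\<bar> powr (\<nu> - s) * \<bar>x\<bar> powr (s - \<kappa>))"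
          using e 3 x0 \<nu> by (intro mult_left_mono mult_right_mono powr_mono2') auto
        also have "\<dots> = e * \<bar>x\<bar> powr (\<nu> - \<kappa>)" by (simp add: powr_add[symmetric])
        finally have 4: "r * ?T powr (\<nu> - s) * (C * \<bar>x\<bar> powr (s - \<kappa>)) \<le> e * \<bar>x\<bar> powr (\<nu> - \<kappa>)" .
        have "r * ?T powr (\<nu> - s) * (\<integral>y. \<bar>y\<bar> powr s \<partial>K x)
            \<le> r * ?T powr (\<nu> - s) * (\<bar>x\<bar> powr s + C * \<bar>x\<bar> powr (s - \<kappa>))"
          using super[OF Suc.prems(2) 3(1)] r by (intro mult_left_mono) auto
        also have "\<dots> \<le> r * ?T powr (\<nu> - s) * \<bar>x\<bar> powr s + e * \<bar>x\<bar> powr (\<nu> - \<kappa>)"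
          using 4 by (simp add: distrib_left)
        finally show ?thesis
          using i sub[OF Suc.prems(2) 3(1)] by (simp add: g_def)
      qed
      then have "(g ?T x - a powr \<nu>) / ?Q \<le> ((\<integral>y. g ?T y \<partial>K x) - a powr \<nu>) / ?Q"
        using Q by (intro divide_right_mono) auto
      also have "\<dots> = (\<integral>y. (g ?T y - a powr \<nu>) / ?Q \<partial>K x)"
        using i by (simp add: g_def)
      also have "\<dots> \<le> surv a (Suc n) x"
      proof (rule surv_Suc_mono'[OF Suc.prems(2) 3(1)])
        show "integrable (K x) (\<lambda>y. (g ?T y - a powr \<nu>) / ?Q)"
          unfolding g_def using i by simp
        show "(g ?T y - a powr \<nu>) / ?Q \<le> surv a n y" if "y \<in> X" for y
          using Suc.IH[OF _ that] Suc.prems(1) by simp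
      qed
      finally show ?thesis .
    qed
  qed
  \<comment> \<open>For fixed x the subtracted term vanishes as R grows, so half of the gap between
    |x|^\<nu> and a^\<nu> eventually survives.\<close>
  define k where "k = (\<bar>x\<bar> powr \<nu> - a powr \<nu>) / 2"
  have k: "k > 0" unfolding k_def using x a \<nu> by (simp add: powr_less_mono2)
  define R where "R n = (real n / \<delta>) powr (1 / p)" for n :: nat
  have R_lim: "filterlim R at_top sequentially"
    unfolding R_def using \<delta> p by real_asymp
  have "((\<lambda>T. g (3 * T) x) \<longlongrightarrow> \<bar>x\<bar> powr \<nu> - r * 0 * \<bar>x\<bar> powr s) at_top"
    unfolding g_def using \<nu> by (intro tendsto_intros) real_asymp
  then have "\<forall>\<^sub>F T in at_top. g (3 * T) x > \<bar>x\<bar> powr \<nu> - k"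
    by (rule order_tendstoD(1)) (use k in simp)
  then have ev: "\<forall>\<^sub>F n in sequentially. g (3 * R n) x > \<bar>x\<bar> powr \<nu> - k"
    using R_lim by (rule eventually_compose_filterlim)
  show ?thesis
  proof (intro exI conjI)
    let ?d = "k / (2 * E * (3 powr \<nu> * \<delta> powr (- \<nu> / p)))"
    show "?d > 0" using k E \<delta> by simp
    have "\<forall>\<^sub>F n in sequentially. R n > max 0 a"
      using R_lim unfolding filterlim_at_top_dense by blast
    with ev eventually_gt_at_top[of 0] show "\<forall>\<^sub>F n in sequentially. surv a n x \<ge> ?d * real n powr (- \<nu> / p)"
    proof eventually_elim
      case (elim n)
      have Rp: "\<delta> * R n powr p = real n" using elim p \<delta> by (simp add: R_def powr_powr)
      have R\<nu>: "(3 * R n) powr \<nu> = 3 powr \<nu> * (real n powr (\<nu> / p) * \<delta> powr (- \<nu> / p))"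
      proof -
        have "R n powr \<nu> = (real n / \<delta>) powr (\<nu> / p)" by (simp add: R_def powr_powr)
        also have "\<dots> = real n powr (\<nu> / p) * \<delta> powr (- \<nu> / p)"
          using \<delta> by (simp add: powr_divide powr_minus_divide)
        finally show ?thesis using elim by (simp add: powr_mult)
      qed
      have "?d * real n powr (- \<nu> / p) = k / (2 * E * (3 * R n) powr \<nu>)"
        unfolding R\<nu> using elim E \<delta> by (simp add: powr_minus field_simps)
      also have "\<dots> \<le> (g (3 * R n) x - a powr \<nu>) / (2 * E * (3 * R n) powr \<nu>)"
      proof (rule divide_right_mono)
        have "2 * k = \<bar>x\<bar> powr \<nu> - a powr \<nu>" by (simp add: k_def)
        then show "k \<le> g (3 * R n) x - a powr \<nu>" using elim(1) by linarith
      qed (use E in simp)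
      also have "\<dots> \<le> surv a n x"
        using elim x Rp by (intro main) auto
      finally show ?case .
    qed
  qed
qed

end

section \<open>Hitting time moments\<close>

lemma hit_time_ge_iff: "enat n \<le> hit_time \<xi> a \<omega> \<longleftrightarrow> (\<forall>i<n. \<bar>\<xi> i \<omega>\<bar> > a)"
proof (cases "\<exists>m. \<bar>\<xi> m \<omega>\<bar> \<le> a")
  case True
  define L where "L = (LEAST m. \<bar>\<xi> m \<omega>\<bar> \<le> a)"
  have L: "\<bar>\<xi> L \<omega>\<bar> \<le> a" unfolding L_def using True by (rule LeastI_ex)
  have "\<bar>\<xi> i \<omega>\<bar> > a" if "i < L" for i
    using not_less_Least[of i "\<lambda>m. \<bar>\<xi> m \<omega>\<bar> \<le> a"] that by (auto simp: L_def)
  moreover have "\<not> L < n" if "\<forall>i<n. \<bar>\<xi> i \<omega>\<bar> > a" using L that by (auto simp: not_less)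
  ultimately show ?thesis
    using True by (auto simp: hit_time_def L_def[symmetric] not_less)
next
  case False
  then have "hit_time \<xi> a \<omega> = \<infinity>" "\<bar>\<xi> i \<omega>\<bar> > a" for i
    by (auto simp: hit_time_def not_le)
  then show ?thesis by simp
qed

lemma two_power_powr: "real (2 ^ k) powr x = 2 powr (real k * x)"
proof -
  have "real (2 ^ k) = 2 powr real k" by (simp add: powr_realpow)
  then show ?thesis by (simp only: powr_powr)
qed

text \<open>If n lies in [2^(k+1), 2^(k+2)), the k-th summand alone dominates n^q; the constant
  covers n < 2, and for t = \<infinity> all summands are present and diverge. The thresholds are
  even so that they match survival bounds at times 2 * n with n = 2^k.\<close>

lemma dyadic_powr_upper:
  assumes "q > 0"
  shows "(case t of enat n \<Rightarrow> ennreal (real n powr q) | \<infinity> \<Rightarrow> \<infinity>)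
    \<le> ennreal (2 powr q) + (\<Sum>k. ennreal (2 powr ((real k + 2) * q)) * indicator {t. enat (2 ^ (k + 1)) \<le> t} t)"
    (is "?l \<le> _ + suminf ?f")
proof -
  define f where "f = ?f"
  have f_le: "f k \<le> suminf f" for k
    using sum_le_suminf[of f "{k}"] by (simp add: summableI)
  have "?l \<le> ennreal (2 powr q) + suminf f"
  proof (cases t)
    case (enat n)
    show ?thesis
    proof (cases "n < 2")
      case True
      have "real n powr q \<le> 2 powr q" using True assms by (intro powr_mono2) auto
      then show ?thesis using enat by (auto intro: add_increasing2)
    next
      case False
      obtain j where j: "2 ^ j \<le> n" "n < 2 ^ (j + 1)"
        using ex_power_ivl1[of 2 n] False by auto
      have "j \<noteq> 0" using j False by (cases j) auto
      then obtain k where k: "j = k + 1" using not0_implies_Suc by auto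
      have "real n \<le> 2 powr (real k + 2)"
      proof -
        have "real n \<le> real (2 ^ (k + 2))" using j k by (intro of_nat_mono) simp
        then show ?thesis using powr_realpow[of 2 "k + 2"] by (simp add: add.commute)
      qed
      then have "real n powr q \<le> (2 powr (real k + 2)) powr q"
        using assms by (intro powr_mono2) auto
      then have "?l \<le> ennreal (2 powr ((real k + 2) * q)) * indicator {t. enat (2 ^ (k + 1)) \<le> t} t"
        using enat j k by (auto simp: powr_powr intro: ennreal_leI)
      also have "\<dots> \<le> suminf f" using f_le[of k] by (simp add: f_def)
      finally show ?thesis by (auto intro: add_increasing)
    qed
  next
    case infinity
    have "suminf f = \<infinity>"
    proof (cases "suminf f")
      case (real s)
      have *: "ennreal (2 powr ((real k + 2) * q)) \<le> suminf f" for k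
        using f_le[of k] infinity by (simp add: f_def)
      have "filterlim (\<lambda>k. 2 powr ((real k + 2) * q)) at_top sequentially"
        using assms by real_asymp
      then obtain k where "2 powr ((real k + 2) * q) > s"
        by (auto simp: filterlim_at_top_dense eventually_sequentially)
      with *[of k] real show ?thesis by (simp add: ennreal_le_iff)
    qed simp
    then show ?thesis by simp
  qed
  then show ?thesis by (simp add: f_def)
qed

text \<open>The active terms form a geometric sum up to the largest power of two below n, which is
  comparable to its last term; the prefactor is the reciprocal of the full ratio sum.\<close>

lemma dyadic_powr_lower:
  assumes "q > 0"
  shows "ennreal (1 - 2 powr (-q)) * (\<Sum>k. ennreal (2 powr (real k * q)) * indicator {t. enat (2 ^ k) \<le> t} t)
    \<le> (case t of enat n \<Rightarrow> ennreal (real n powr q) | \<infinity> \<Rightarrow> \<infinity>)"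
proof (cases t)
  case (enat n)
  define r where "r = (2::real) powr q"
  have r: "r > 1" using assms by (simp add: r_def)
  have rk: "2 powr (real k * q) = r ^ k" for k
    by (simp add: r_def powr_powr[symmetric] powr_realpow[symmetric] mult.commute powr_power)
  show ?thesis
  proof (cases "n = 0")
    case False
    obtain j where j: "2 ^ j \<le> n" "n < 2 ^ (j + 1)"
      using ex_power_ivl1[of 2 n] False by auto
    have le_iff: "2 ^ k \<le> n \<longleftrightarrow> k \<le> j" for k
    proof
      assume "2 ^ k \<le> n"
      then have "(2::nat) ^ k < 2 ^ (j + 1)" using j by linarith
      then have "k < j + 1" by (rule power_less_imp_less_exp[rotated]) simp
      then show "k \<le> j" by simp
    next
      assume "k \<le> j"
      then have "(2::nat) ^ k \<le> 2 ^ j" by simp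
      then show "2 ^ k \<le> n" using j by linarith
    qed
    have "(\<Sum>k. ennreal (2 powr (real k * q)) * indicator {t. enat (2 ^ k) \<le> t} t)
        = (\<Sum>k\<le>j. ennreal (2 powr (real k * q)) * indicator {t. enat (2 ^ k) \<le> t} t)"
      by (rule suminf_finite) (auto simp: enat le_iff)
    also have "\<dots> = (\<Sum>k\<le>j. ennreal (r ^ k))"
      by (intro sum.cong) (auto simp: enat le_iff rk)
    also have "\<dots> = ennreal (\<Sum>k\<le>j. r ^ k)" using r by (intro sum_ennreal) auto
    finally have "ennreal (1 - 2 powr (-q)) * (\<Sum>k. ennreal (2 powr (real k * q)) * indicator {t. enat (2 ^ k) \<le> t} t)
        = ennreal ((1 - 1 / r) * (\<Sum>k\<le>j. r ^ k))"
      using r by (simp add: ennreal_mult'' r_def powr_minus_divide sum_nonneg)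
    also have "\<dots> \<le> ennreal (real n powr q)"
    proof (rule ennreal_leI)
      have "(\<Sum>k\<le>j. r ^ k) = (r ^ Suc j - 1) / (r - 1)"
        using r geometric_sum[of r "Suc j"] by (simp add: lessThan_Suc_atMost)
      then have "(1 - 1 / r) * (\<Sum>k\<le>j. r ^ k) = (r ^ Suc j - 1) / r"
        using r by (simp add: field_simps)
      also have "\<dots> \<le> r ^ j" using r by (simp add: field_simps)
      also have "\<dots> = (2 ^ j) powr q"
        by (simp add: rk[symmetric] powr_powr[symmetric] powr_realpow)
      also have "\<dots> \<le> real n powr q"
      proof (rule powr_mono2)
        have "real (2 ^ j) \<le> real n" using j(1) by (rule of_nat_mono)
        then show "2 ^ j \<le> real n" by simp
      qed (use assms in auto)
      finally show "(1 - 1 / r) * (\<Sum>k\<le>j. r ^ k) \<le> real n powr q" .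
    qed
    finally show ?thesis using enat by simp
  next
    case True
    then have "indicator {t. enat (2 ^ k) \<le> t} t = (0::ennreal)" for k
      using enat by simp
    then show ?thesis by simp
  qed
qed simp

lemma is_markov_chain_imp_markov_kernel: "is_markov_chain X K \<Omega> \<xi> \<Longrightarrow> markov_kernel X K"
  by (simp add: is_markov_chain_def markov_kernel_def)

section \<open>From the transition kernel to the chain\<close>

locale markov_chain_on =
  fixes X :: "real set" and K :: "real \<Rightarrow> real measure" and \<Omega> :: "real \<Rightarrow> 'w measure"
    and \<xi> :: "nat \<Rightarrow> 'w \<Rightarrow> real"
  assumes MC: "is_markov_chain X K \<Omega> \<xi>"
begin

sublocale markov_kernel X K
  using MC by (rule is_markov_chain_imp_markov_kernel)

lemma prob_space_\<Omega>: "x \<in> X \<Longrightarrow> prob_space (\<Omega> x)"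
  and \<xi>_measurable: "x \<in> X \<Longrightarrow> \<xi> n \<in> borel_measurable (\<Omega> x)"
  and emeasure_cylinder: "x \<in> X \<Longrightarrow> set As \<subseteq> sets borel \<Longrightarrow>
    emeasure (\<Omega> x) {\<omega> \<in> space (\<Omega> x). \<forall>i < length As. \<xi> i \<omega> \<in> As ! i} = kfdd K As x"
  using MC by (auto simp: is_markov_chain_def)

lemma kfdd_Nil: "kfdd K [] = (\<lambda>_. 1)" and kfdd_singleton: "kfdd K [A] = indicator A"
  by (auto simp: fun_eq_iff nn_integral_cong[of _ "kfdd K []" "\<lambda>_. 1"])

lemma kfdd_replicate: "kfdd K (replicate n {y. \<bar>y\<bar> > a}) = (\<lambda>x. ennreal (surv a n x))"
proof (induction n)
  case (Suc n)
  have "(\<integral>\<^sup>+ y. ennreal (surv a n y) \<partial>K x) = ennreal (\<integral>y. surv a n y \<partial>K x)"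
    for x by (intro nn_integral_eq_integral) auto
  then show ?case by (auto simp: Suc fun_eq_iff)
qed (simp add: fun_eq_iff)

text \<open>Avoiding {-a..a} at the first n times is a cylinder event with n equal factors, whose
  finite-dimensional distribution obeys the recursion of \<open>surv\<close>.\<close>

lemma emeasure_surv:
  assumes "x \<in> X"
  shows "emeasure (\<Omega> x) {\<omega> \<in> space (\<Omega> x). enat n \<le> hit_time \<xi> a \<omega>} = ennreal (surv a n x)"
  using emeasure_cylinder[OF assms, of "replicate n {y. \<bar>y\<bar> > a}"]
  by (simp add: kfdd_replicate hit_time_ge_iff set_replicate_conv_if split: if_splits cong: conj_cong)

lemma hit_time_sets [measurable]:
  assumes "x \<in> X"
  shows "{\<omega> \<in> space (\<Omega> x). enat n \<le> hit_time \<xi> a \<omega>} \<in> sets (\<Omega> x)"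
proof -
  note [measurable] = \<xi>_measurable[OF assms]
  show ?thesis unfolding hit_time_ge_iff by measurable
qed

text \<open>The moment of the hitting time is compared with these sums by monotonicity, so
  measurability is required only of the sums.\<close>

lemma nn_integral_dyadic:
  assumes "x \<in> X"
  shows "(\<integral>\<^sup>+\<omega>. (\<Sum>k. ennreal (c k) * indicator {t. enat (m k) \<le> t} (hit_time \<xi> a \<omega>)) \<partial>\<Omega> x)
    = (\<Sum>k. ennreal (c k) * ennreal (surv a (m k) x))"
    and "(\<lambda>\<omega>. \<Sum>k. ennreal (c k) * indicator {t. enat (m k) \<le> t} (hit_time \<xi> a \<omega>)) \<in> borel_measurable (\<Omega> x)"
proof -
  note [measurable] = hit_time_sets[OF assms]
  have eq: "indicator {t. enat (m k) \<le> t} (hit_time \<xi> a \<omega>)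
      = (indicator {\<omega> \<in> space (\<Omega> x). enat (m k) \<le> hit_time \<xi> a \<omega>} \<omega> :: ennreal)"
    if "\<omega> \<in> space (\<Omega> x)" for \<omega> k
    using that by (auto simp: indicator_def)
  have "(\<integral>\<^sup>+\<omega>. (\<Sum>k. ennreal (c k) * indicator {t. enat (m k) \<le> t} (hit_time \<xi> a \<omega>)) \<partial>\<Omega> x)
     = (\<integral>\<^sup>+\<omega>. (\<Sum>k. ennreal (c k) * indicator {\<omega> \<in> space (\<Omega> x). enat (m k) \<le> hit_time \<xi> a \<omega>} \<omega>) \<partial>\<Omega> x)"
    by (intro nn_integral_cong) (simp add: eq)
  also have "\<dots> = (\<Sum>k. ennreal (c k) * ennreal (surv a (m k) x))"
    using emeasure_surv[OF assms] by (subst nn_integral_suminf) (simp_all add: nn_integral_cmult_indicator)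
  finally show "(\<integral>\<^sup>+\<omega>. (\<Sum>k. ennreal (c k) * indicator {t. enat (m k) \<le> t} (hit_time \<xi> a \<omega>)) \<partial>\<Omega> x)
    = (\<Sum>k. ennreal (c k) * ennreal (surv a (m k) x))" .
  have "(\<lambda>\<omega>. \<Sum>k. ennreal (c k) * indicator {\<omega> \<in> space (\<Omega> x). enat (m k) \<le> hit_time \<xi> a \<omega>} \<omega>) \<in> borel_measurable (\<Omega> x)"
    by measurable
  then show "(\<lambda>\<omega>. \<Sum>k. ennreal (c k) * indicator {t. enat (m k) \<le> t} (hit_time \<xi> a \<omega>)) \<in> borel_measurable (\<Omega> x)"
    by (rule measurable_cong[THEN iffD1, rotated]) (simp add: eq)
qed

text \<open>The dyadic series is dominated by a geometric one with ratio 2^(q - p) < 1.\<close>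

lemma hit_moment_finite:
  assumes x: "x \<in> X" and q: "0 < q" "q < p"
    and bound: "\<And>n. n \<ge> 1 \<Longrightarrow> surv a (2 * n) x \<le> C * real n powr (-p)"
  shows "hit_moment \<Omega> \<xi> a q x < \<infinity>"
proof -
  interpret prob_space "\<Omega> x" using x by (rule prob_space_\<Omega>)
  have C: "C \<ge> 0" using bound[of 1] order_trans[OF surv_nonneg[of a 2 x]] by simp
  let ?c = "\<lambda>k::nat. 2 powr ((real k + 2) * q)" and ?m = "\<lambda>k::nat. 2 ^ (k + 1) :: nat"
  let ?S = "\<lambda>\<omega>. \<Sum>k. ennreal (?c k) * indicator {t. enat (?m k) \<le> t} (hit_time \<xi> a \<omega>)"
  have "hit_moment \<Omega> \<xi> a q x \<le> (\<integral>\<^sup>+\<omega>. ennreal (2 powr q) + ?S \<omega> \<partial>\<Omega> x)"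
    unfolding hit_moment_def by (intro nn_integral_mono dyadic_powr_upper q)
  also have "\<dots> = ennreal (2 powr q) + (\<Sum>k. ennreal (?c k) * ennreal (surv a (?m k) x))"
    by (subst nn_integral_add[OF borel_measurable_const nn_integral_dyadic(2)[OF x]])
      (simp only: nn_integral_dyadic(1)[OF x] nn_integral_const emeasure_space_1 mult_1_right)
  also have "(\<Sum>k. ennreal (?c k) * ennreal (surv a (?m k) x)) < \<infinity>"
  proof -
    let ?r = "2 powr (q - p)"
    have "summable (\<lambda>k. 2 powr (2 * q) * C * ?r ^ k)"
      using q powr_less_mono[of "q - p" 0 2] by (intro summable_mult summable_geometric) simp
    have le: "ennreal (?c k) * ennreal (surv a (?m k) x) \<le> ennreal (2 powr (2 * q) * C * ?r ^ k)" for k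
    proof -
      have "surv a (?m k) x \<le> C * 2 powr (- real k * p)"
        using bound[of "2 ^ k"] unfolding two_power_powr by simp
      then have "?c k * surv a (?m k) x \<le> ?c k * (C * 2 powr (- real k * p))"
        by (intro mult_left_mono) auto
      also have "\<dots> = C * 2 powr ((real k + 2) * q + - real k * p)"
        by (simp only: powr_add) simp
      also have "(real k + 2) * q + - real k * p = 2 * q + (q - p) * real k" by (simp add: algebra_simps)
      also have "C * 2 powr (2 * q + (q - p) * real k) = 2 powr (2 * q) * C * ?r ^ k"
      proof -
        have "2 powr ((q - p) * real k) = ?r ^ k"
          by (simp add: powr_powr[symmetric] powr_realpow)
        then show ?thesis by (simp add: powr_add)
      qed
      finally show ?thesis by (simp add: ennreal_mult''[symmetric] ennreal_leI)
    qed
    have "(\<Sum>k. ennreal (?c k) * ennreal (surv a (?m k) x)) \<le> (\<Sum>k. ennreal (2 powr (2 * q) * C * ?r ^ k))"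
      by (intro suminf_le le summableI)
    also have "\<dots> = ennreal (\<Sum>k. 2 powr (2 * q) * C * ?r ^ k)"
      using C by (intro suminf_ennreal2 \<open>summable _\<close>) auto
    finally show ?thesis by (simp add: le_less_trans)
  qed
  finally show ?thesis by simp
qed

text \<open>With survival of order n^(-q), for the same q, every late dyadic block contributes at
  least \<open>d\<close>, so the series diverges without any loss in the exponent. This settles the
  endpoint in the strong drift regime.\<close>

lemma hit_moment_infinite:
  assumes x: "x \<in> X" and q: "0 < q" and d: "d > 0"
    and bound: "\<forall>\<^sub>F n in sequentially. surv a n x \<ge> d * real n powr (-q)"
  shows "hit_moment \<Omega> \<xi> a q x = \<infinity>"
proof -
  let ?c = "\<lambda>k::nat. 2 powr (real k * q)" and ?m = "\<lambda>k::nat. 2 ^ k :: nat"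
  let ?S = "\<lambda>\<omega>. \<Sum>k. ennreal (?c k) * indicator {t. enat (?m k) \<le> t} (hit_time \<xi> a \<omega>)"
  have "filterlim ?m at_top sequentially" by real_asymp
  with bound have "\<forall>\<^sub>F k in sequentially. surv a (?m k) x \<ge> d * real (?m k) powr (-q)"
    by (rule eventually_compose_filterlim)
  then obtain k0 where k0: "\<And>k. k \<ge> k0 \<Longrightarrow> surv a (?m k) x \<ge> d * real (?m k) powr (-q)"
    by (auto simp: eventually_sequentially)
  have ge: "ennreal d \<le> ennreal (?c k) * ennreal (surv a (?m k) x)" if "k \<ge> k0" for k
  proof -
    have "d = ?c k * (d * real (?m k) powr (-q))"
      unfolding two_power_powr by (simp add: powr_minus)
    also have "\<dots> \<le> ?c k * surv a (?m k) x" using k0[OF that] by (intro mult_left_mono) auto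
    finally show ?thesis by (simp add: ennreal_mult''[symmetric] ennreal_leI)
  qed
  have inf: "(\<Sum>k. ennreal (?c k) * ennreal (surv a (?m k) x)) = \<infinity>"
  proof -
    have "(\<infinity>::ennreal) = (\<Sum>k::nat. ennreal d)"
      unfolding infinity_ennreal_def
      by (rule summable_iff_suminf_neq_top[symmetric]) (use d in \<open>auto simp: summable_const_iff\<close>)
    also have "\<dots> \<le> (\<Sum>k. ennreal (?c (k + k0)) * ennreal (surv a (?m (k + k0)) x))"
      by (intro suminf_le ge summableI) auto
    also have "\<dots> \<le> (\<Sum>k. ennreal (?c k) * ennreal (surv a (?m k) x))"
      using suminf_offset[of "\<lambda>k. ennreal (?c k) * ennreal (surv a (?m k) x)" k0] by (simp only: summableI) simp
    finally show ?thesis by (simp only: infinity_ennreal_def top_unique)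
  qed
  have "(\<infinity>::ennreal) = ennreal (1 - 2 powr (-q)) * (\<integral>\<^sup>+\<omega>. ?S \<omega> \<partial>\<Omega> x)"
    using q powr_less_mono[of "-q" 0 2]
    by (simp add: nn_integral_dyadic(1)[OF x] inf ennreal_mult_eq_top_iff ennreal_eq_0_iff)
  also have "\<dots> = (\<integral>\<^sup>+\<omega>. ennreal (1 - 2 powr (-q)) * ?S \<omega> \<partial>\<Omega> x)"
    by (rule nn_integral_cmult[symmetric]) (rule nn_integral_dyadic(2)[OF x])
  also have "\<dots> \<le> hit_moment \<Omega> \<xi> a q x"
    unfolding hit_moment_def by (intro nn_integral_mono dyadic_powr_lower q)
  finally show ?thesis by (simp add: top_unique)
qed

lemma AE_\<xi>_0:
  assumes x: "x \<in> X" shows "AE \<omega> in \<Omega> x. \<xi> 0 \<omega> = x"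
proof -
  interpret prob_space "\<Omega> x" using x by (rule prob_space_\<Omega>)
  note [measurable] = \<xi>_measurable[OF x]
  have "emeasure (\<Omega> x) {\<omega> \<in> space (\<Omega> x). \<xi> 0 \<omega> = x} = 1"
    using emeasure_cylinder[OF x, of "[{x}]"] by (simp add: kfdd_Nil)
  then have "AE \<omega> in \<Omega> x. \<omega> \<in> {\<omega> \<in> space (\<Omega> x). \<xi> 0 \<omega> = x}"
    by (intro AE_in_set_eq_1[THEN iffD2]) (auto simp: emeasure_eq_measure)
  then show ?thesis by simp
qed

text \<open>Cylinders with a free first coordinate identify the one-step law, which transfers the
  hypotheses on increments from \<open>\<Omega> x\<close> to \<open>K x\<close>.\<close>

lemma distr_\<xi>_1:
  assumes x: "x \<in> X" shows "distr (\<Omega> x) borel (\<xi> 1) = K x"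
proof (rule measure_eqI)
  fix A assume "A \<in> sets (distr (\<Omega> x) borel (\<xi> 1))"
  then have A: "A \<in> sets borel" by simp
  have "emeasure (distr (\<Omega> x) borel (\<xi> 1)) A = emeasure (\<Omega> x) {\<omega> \<in> space (\<Omega> x). \<forall>i < length [UNIV, A]. \<xi> i \<omega> \<in> [UNIV, A] ! i}"
    using \<xi>_measurable[OF x, of 1] A
    by (subst emeasure_distr) (auto intro!: arg_cong[where f="emeasure (\<Omega> x)"] simp: less_Suc_eq numeral_2_eq_2)
  also have "\<dots> = kfdd K [UNIV, A] x" using A by (intro emeasure_cylinder x) auto
  also have "\<dots> = emeasure (K x) A" using A by (simp add: kfdd_Nil kfdd_singleton)
  finally show "emeasure (distr (\<Omega> x) borel (\<xi> 1)) A = emeasure (K x) A" .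
qed simp

lemma AE_increment:
  assumes x: "x \<in> X" shows "AE \<omega> in \<Omega> x. increment \<xi> \<omega> = \<xi> 1 \<omega> - x"
  using AE_\<xi>_0[OF x] by eventually_elim (simp add: increment_def)

lemma measure_increment:
  assumes x: "x \<in> X" and [measurable]: "Measurable.pred borel P"
  shows "measure (\<Omega> x) {\<omega> \<in> space (\<Omega> x). P (increment \<xi> \<omega>)} = measure (K x) {y. P (y - x)}"
proof -
  note [measurable] = \<xi>_measurable[OF x]
  have "measure (\<Omega> x) {\<omega> \<in> space (\<Omega> x). P (increment \<xi> \<omega>)} = measure (\<Omega> x) {\<omega> \<in> space (\<Omega> x). P (\<xi> 1 \<omega> - x)}"
    using AE_increment[OF x] unfolding increment_def
    by (intro measure_eq_AE) (auto elim!: AE_mp)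
  also have "\<dots> = measure (distr (\<Omega> x) borel (\<xi> 1)) {y. P (y - x)}"
    by (subst measure_distr) (auto intro!: arg_cong[where f="measure (\<Omega> x)"])
  finally show ?thesis by (simp only: distr_\<xi>_1[OF x])
qed

lemma nn_integral_increment:
  assumes x: "x \<in> X" and [measurable]: "f \<in> borel_measurable borel"
  shows "(\<integral>\<^sup>+\<omega>. f (increment \<xi> \<omega>) \<partial>\<Omega> x) = (\<integral>\<^sup>+y. f (y - x) \<partial>K x)"
proof -
  note [measurable] = \<xi>_measurable[OF x]
  have "(\<integral>\<^sup>+\<omega>. f (increment \<xi> \<omega>) \<partial>\<Omega> x) = (\<integral>\<^sup>+\<omega>. f (\<xi> 1 \<omega> - x) \<partial>\<Omega> x)"
    using AE_increment[OF x] by (intro nn_integral_cong_AE) (auto elim!: AE_mp)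
  also have "\<dots> = (\<integral>\<^sup>+y. f (y - x) \<partial>distr (\<Omega> x) borel (\<xi> 1))"
    by (subst nn_integral_distr) auto
  finally show ?thesis by (simp only: distr_\<xi>_1[OF x])
qed

lemma drift_eq:
  assumes x: "x \<in> X" shows "drift \<Omega> \<xi> x = (\<integral>y. y - x \<partial>K x)"
proof -
  note [measurable] = \<xi>_measurable[OF x]
  have "drift \<Omega> \<xi> x = (\<integral>\<omega>. \<xi> 1 \<omega> - x \<partial>\<Omega> x)"
    unfolding drift_def using AE_increment[OF x]
    by (intro integral_cong_AE) (auto simp: increment_def[abs_def])
  also have "\<dots> = (\<integral>y. y - x \<partial>distr (\<Omega> x) borel (\<xi> 1))"
    by (subst integral_distr) auto
  finally show ?thesis by (simp only: distr_\<xi>_1[OF x])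
qed

end

section \<open>Beta integrals and the layer cake formula\<close>

text \<open>The explicit integrals arise as gauge integrals, from antiderivatives or from the Beta
  function; a constant sign turns them into Lebesgue integrals.\<close>

lemma has_bochner_integral_of_has_integral:
  fixes f :: "real \<Rightarrow> real"
  assumes [measurable]: "f \<in> borel_measurable borel" "S \<in> sets borel"
    and nonneg: "\<And>x. x \<in> S \<Longrightarrow> 0 \<le> f x" and I: "(f has_integral I) S"
  shows "has_bochner_integral lborel (\<lambda>x. indicator S x * f x) I"
proof (rule has_bochner_integral_nn_integral)
  have nn: "0 \<le> indicator S x * f x" for x using nonneg by (auto simp: indicator_def)
  then show "AE x in lborel. 0 \<le> indicator S x * f x" by simp
  have I': "((\<lambda>x. indicator S x * f x) has_integral I) UNIV"
  proof -
    have "(\<lambda>x. indicator S x * f x) = (\<lambda>x. if x \<in> S then f x else 0)" by (auto simp: indicator_def)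
    then show ?thesis using I by (simp add: has_integral_restrict_UNIV)
  qed
  show "0 \<le> I" using has_integral_nonneg[OF I'] nn by auto
  show "(\<integral>\<^sup>+x. ennreal (indicator S x * f x) \<partial>lborel) = ennreal I"
    by (rule nn_integral_has_integral_lborel[OF _ nn I']) measurable
qed measurable

lemma has_integral_insert_endpoint:
  fixes f :: "real \<Rightarrow> real"
  shows "(f has_integral I) {a..} \<longleftrightarrow> (f has_integral I) {a<..}"
proof (rule has_integral_spike_set_eq)
  show "negligible {x \<in> {a..} - {a<..}. f x \<noteq> 0}"
    by (rule negligible_subset[of "{a}"]) auto
  show "negligible {x \<in> {a<..} - {a..}. f x \<noteq> 0}"
    by (rule negligible_subset[of "{}"]) auto
qed

lemma has_bochner_integral_powr_tail:
  fixes a \<beta> :: real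
  assumes "1 < \<beta>" "a > 0"
  shows "has_bochner_integral lborel (\<lambda>u. indicator {a<..} u * u powr (-\<beta>)) (a powr (1 - \<beta>) / (\<beta> - 1))"
proof -
  have "((\<lambda>u. u powr (-\<beta>)) has_integral a powr (1 - \<beta>) / (\<beta> - 1)) {a<..}"
    unfolding has_integral_insert_endpoint[symmetric]
    using has_integral_powr_to_inf[of "-\<beta>" a] assms minus_divide_right[of "a powr (1 - \<beta>)" "1 - \<beta>"] by simp
  then show ?thesis by (intro has_bochner_integral_of_has_integral) auto
qed

lemma has_bochner_integral_Beta_unit:
  assumes "a > 0" "b > (0::real)"
  shows "has_bochner_integral lborel (\<lambda>t. indicator {0<..<1} t * (t powr (a - 1) * (1 - t) powr (b - 1))) (Beta a b)"
  using has_integral_Beta_real[OF assms] unfolding has_integral_Icc_iff_Ioo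
  by (intro has_bochner_integral_of_has_integral) auto

text \<open>The substitution u = 1 / (1 - t) carries (0,1) to (1,\<infinity>) and turns u - 1 into t
  / (1 - t), which gives the standard Beta integrand.\<close>

lemma has_bochner_integral_Beta_tail:
  fixes s \<beta> :: real
  assumes "0 < s" "s < \<beta>"
  shows "has_bochner_integral lborel (\<lambda>u. indicator {1<..} u * ((u - 1) powr (s - 1) * u powr (-\<beta>))) (Beta s (\<beta> - s))"
proof -
  let ?f = "\<lambda>u::real. (u - 1) powr (s - 1) * u powr (-\<beta>)"
  let ?g = "\<lambda>t::real. 1 / (1 - t)" and ?g' = "\<lambda>t::real. 1 / (1 - t)\<^sup>2"
  have eq: "?f (?g t) * ?g' t = t powr (s - 1) * (1 - t) powr ((\<beta> - s) - 1)" if "0 < t" "t < 1" for t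
  proof -
    have "?g t - 1 = t / (1 - t)" using that by (simp add: field_simps)
    then have "?f (?g t) * ?g' t = t powr (s - 1) * ((1 - t) powr (1 - s) * (1 - t) powr \<beta> * (1 - t) powr (-2))"
      using that by (simp add: powr_divide powr_minus_divide powr_diff powr_numeral mult_ac)
    also have "(1 - t) powr (1 - s) * (1 - t) powr \<beta> * (1 - t) powr (-2) = (1 - t) powr ((\<beta> - s) - 1)"
      by (simp add: powr_add[symmetric] algebra_simps)
    finally show ?thesis .
  qed
  have hbi: "has_bochner_integral lborel (\<lambda>t. indicator {0<..<1} t * (?f (?g t) * ?g' t)) (Beta s (\<beta> - s))"
  proof -
    have "indicator {0<..<1} t * (?f (?g t) * ?g' t)
        = indicator {0<..<1} t * (t powr (s - 1) * (1 - t) powr ((\<beta> - s) - 1))" for t :: real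
    proof (cases "0 < t \<and> t < 1")
      case True
      then show ?thesis by (subst eq) auto
    qed auto
    then show ?thesis
      using has_bochner_integral_Beta_unit[of s "\<beta> - s"] assms by (simp only:)
  qed
  have ei: "einterval 0 1 = {0<..<1::real}" "einterval 1 \<infinity> = ({1<..} :: real set)"
    by (auto simp: einterval_def zero_ereal_def one_ereal_def)
  have d: "DERIV ?g x :> ?g' x" if "0 < ereal x" "ereal x < 1" for x
    using that by (auto intro!: derivative_eq_intros simp: power2_eq_square one_ereal_def)
  have cf: "isCont ?f (?g x)" if "0 < ereal x" "ereal x < 1" for x
    using that by (intro continuous_intros) (auto simp: zero_ereal_def one_ereal_def)
  have cg: "isCont ?g' x" if "0 < ereal x" "ereal x < 1" for x
    using that by (intro continuous_intros) (auto simp: one_ereal_def)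
  have lim0: "((ereal \<circ> ?g \<circ> real_of_ereal) \<longlongrightarrow> 1) (at_right 0)"
    unfolding zero_ereal_def one_ereal_def ereal_tendsto_simps
    by (auto intro!: tendsto_eq_intros)
  have lim1: "((ereal \<circ> ?g \<circ> real_of_ereal) \<longlongrightarrow> \<infinity>) (at_left 1)"
    unfolding one_ereal_def ereal_tendsto_simps by real_asymp
  have int: "set_integrable lborel (einterval 0 1) (\<lambda>x. ?f (?g x) * ?g' x)"
    using hbi unfolding set_integrable_def ei by (simp add: has_bochner_integral_iff)
  note * = interval_integral_substitution_nonneg[OF _ d cf cg _ _ lim0 lim1 int]
  show ?thesis
    using * hbi unfolding has_bochner_integral_iff set_integrable_def interval_lebesgue_integral_def set_lebesgue_integral_def ei
    by (auto simp: real_scaleR_def)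
qed

lemma has_bochner_integral_signed:
  fixes f :: "real \<Rightarrow> real"
  assumes [measurable]: "f \<in> borel_measurable borel" "S \<in> sets borel"
    and sgn: "(\<forall>x\<in>S. 0 \<le> f x) \<or> (\<forall>x\<in>S. f x \<le> 0)" and I: "(f has_integral I) S"
  shows "has_bochner_integral lborel (\<lambda>x. indicator S x * f x) I"
  using sgn
proof
  assume "\<forall>x\<in>S. f x \<le> 0"
  then have "has_bochner_integral lborel (\<lambda>x. indicator S x * - f x) (- I)"
    using has_integral_neg[OF I] by (intro has_bochner_integral_of_has_integral) auto
  from has_bochner_integral_minus[OF this] show ?thesis by simp
qed (intro has_bochner_integral_of_has_integral; auto intro: I)

text \<open>The sign depends on whether s is above or below 1 but not on u, which is what
  \<open>has_bochner_integral_signed\<close> asks for.\<close>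

lemma one_minus_powr_sgn:
  fixes s :: real
  shows "(\<forall>u\<in>{0<..<1}. 0 \<le> (1 - (1 - u) powr (s - 1))) \<or> (\<forall>u\<in>{0<..<1}. (1 - (1 - u) powr (s - 1)) \<le> 0)"
proof (cases "s \<ge> 1")
  case True
  then show ?thesis by (auto intro!: powr_le1)
next
  case False
  have "1 \<le> (1 - u) powr (s - 1)" if "0 < u" "u < 1" for u :: real
    using False that powr_mono'[of "s - 1" 0 "1 - u"] by simp
  then show ?thesis by auto
qed

text \<open>Since \<beta> > 1, u^(-\<beta>) alone is not integrable at 0; the prefactor vanishes
  linearly there, which suffices because \<beta> < 2. Integration by parts reduces the integral to a
  convergent Beta integral.\<close>

lemma has_bochner_integral_regularized_Beta:
  fixes s \<beta> :: real
  assumes s: "0 < s" and \<beta>: "1 < \<beta>" "\<beta> < 2"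
  shows "has_bochner_integral lborel (\<lambda>u. indicator {0<..<1} u * ((1 - (1 - u) powr (s - 1)) * u powr (-\<beta>)))
    (1 / (1 - \<beta>) - (s + 1 - \<beta>) / (1 - \<beta>) * Beta (2 - \<beta>) s)"
proof (rule has_bochner_integral_signed)
  \<comment> \<open>The exponent s, rather than s - 1, is chosen because 1 - (1 - u)^s equals 1 - P
    + u * P with P = (1 - u)^(s - 1). Thus the derivative is the wanted integrand plus a multiple of
    the Beta integrand, and the boundary values are 0 and 1 / (1 - \<beta>).\<close>
  let ?H = "\<lambda>u. (1 - (1 - u) powr s) * u powr (1 - \<beta>) / (1 - \<beta>)"
  let ?H' = "\<lambda>u. s * (1 - u) powr (s - 1) * u powr (1 - \<beta>) / (1 - \<beta>) + (1 - (1 - u) powr s) * u powr (-\<beta>)"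
  show "(\<forall>x\<in>{0<..<1}. 0 \<le> (1 - (1 - x) powr (s - 1)) * x powr (-\<beta>)) \<or>
        (\<forall>x\<in>{0<..<1}. (1 - (1 - x) powr (s - 1)) * x powr (-\<beta>) \<le> 0)"
    using one_minus_powr_sgn[of s] by (auto intro: mult_nonpos_nonneg)
  have H0: "(?H \<longlongrightarrow> 0) (at_right 0)"
    using \<beta> s by real_asymp
  have cont: "continuous_on {0..1} ?H"
  proof -
    have "continuous (at u within {0..1}) ?H" if "u \<in> {0..1}" for u
    proof (cases "u = 0")
      case True
      have "(?H \<longlongrightarrow> ?H 0) (at 0 within {0..1})"
        using H0 by (simp add: at_within_Icc_at_right)
      then show ?thesis using True by (simp add: continuous_within)
    next
      case False
      have "continuous_on {0..1} (\<lambda>u::real. (1 - u) powr s)"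
        using s by (intro continuous_on_powr' continuous_intros) auto
      then have "continuous (at u within {0..1}) (\<lambda>u. (1 - u) powr s)"
        using that by (simp add: continuous_on_eq_continuous_within)
      moreover have "continuous (at u within {0..1}) (\<lambda>u. u powr (1 - \<beta>))"
        using that False by (intro continuous_intros) auto
      ultimately show ?thesis
        using \<beta> by (intro continuous_divide continuous_mult continuous_diff continuous_const) auto
    qed
    then show ?thesis by (simp add: continuous_on_eq_continuous_within)
  qed
  have "(?H' has_integral (?H 1 - ?H 0)) {0..1}"
  proof (rule fundamental_theorem_of_calculus_interior[OF _ cont])
    fix u :: real assume u: "u \<in> {0<..<1}"
    have 1: "((\<lambda>u. 1 - (1 - u) powr s) has_real_derivative s * (1 - u) powr (s - 1)) (at u)"
      using u DERIV_fun_powr[of "\<lambda>u. 1 - u" "-1" u s] by (auto intro!: derivative_eq_intros)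
    have 2: "((\<lambda>u. u powr (1 - \<beta>) / (1 - \<beta>)) has_real_derivative u powr (-\<beta>)) (at u)"
      using u \<beta> DERIV_cdivide[OF has_real_derivative_powr[of u "1 - \<beta>"], of "1 - \<beta>"] by simp
    have "(?H has_real_derivative ?H' u) (at u)"
      using DERIV_mult[OF 1 2] by (simp add: mult_ac add_ac)
    then show "(?H has_vector_derivative ?H' u) (at u)"
      by (simp add: has_real_derivative_iff_has_vector_derivative)
  qed simp
  then have 1: "(?H' has_integral 1 / (1 - \<beta>)) {0<..<1}"
    by (simp add: has_integral_Icc_iff_Ioo)
  have "((\<lambda>u. u powr (2 - \<beta> - 1) * (1 - u) powr (s - 1)) has_integral Beta (2 - \<beta>) s) {0<..<1}"
    using has_integral_Beta_real[of "2 - \<beta>" s] s \<beta> by (simp add: has_integral_Icc_iff_Ioo)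
  from has_integral_diff[OF 1 has_integral_mult_right[OF this, of "(s + 1 - \<beta>) / (1 - \<beta>)"]]
  show "((\<lambda>u. (1 - (1 - u) powr (s - 1)) * u powr (-\<beta>)) has_integral
        1 / (1 - \<beta>) - (s + 1 - \<beta>) / (1 - \<beta>) * Beta (2 - \<beta>) s) {0<..<1}"
  proof (rule has_integral_eq[rotated])
    fix u :: real assume "u \<in> {0<..<1}"
    then have u: "0 < u" "u < 1" by auto
    define P where "P = (1 - u) powr (s - 1)"
    define Q where "Q = u powr (-\<beta>)"
    have P: "(1 - u) powr s = (1 - u) * P" using u powr_add[of "1 - u" 1 "s - 1"] by (simp add: P_def)
    have Q: "u powr (1 - \<beta>) = u * Q" using u powr_add[of u 1 "-\<beta>"] by (simp add: Q_def)
    have Q': "u powr (2 - \<beta> - 1) = u * Q" using Q by simp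
    show "?H' u - (s + 1 - \<beta>) / (1 - \<beta>) * (u powr (2 - \<beta> - 1) * (1 - u) powr (s - 1))
        = (1 - (1 - u) powr (s - 1)) * u powr (-\<beta>)"
    proof -
      have "(s + 1 - \<beta>) / (1 - \<beta>) = s / (1 - \<beta>) + 1" using \<beta> by (simp add: field_simps)
      then show ?thesis
        unfolding Q' P Q P_def[symmetric] Q_def[symmetric] by (simp add: algebra_simps)
    qed
  qed
qed measurable

text \<open>Fubini expresses the mean of v \<mapsto> integral of g over (0,v) through tails alone;
  arguments v \<le> 0 contribute nothing. The measure is only sigma-finite with finite tails, since
  besides probability laws the Pareto measure, infinite near 0, is needed.\<close>

lemma layer_cake:
  fixes g :: "real \<Rightarrow> real"
  assumes M: "sigma_finite_measure M" and sets_M [measurable_cong]: "sets M = sets borel"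
    and [measurable]: "g \<in> borel_measurable borel"
    and fin: "\<And>u. u > 0 \<Longrightarrow> emeasure M {u<..} < \<infinity>"
    and int: "integrable lborel (\<lambda>u. indicator {0<..} u * (g u * measure M {u<..}))"
  shows "integrable M (\<lambda>v. \<integral>u. indicator {0<..<v} u * g u \<partial>lborel)"
    and "(\<integral>v. (\<integral>u. indicator {0<..<v} u * g u \<partial>lborel) \<partial>M)
      = (\<integral>u. indicator {0<..} u * (g u * measure M {u<..}) \<partial>lborel)"
proof -
  interpret M: sigma_finite_measure M by (rule M)
  interpret pair_sigma_finite lborel M ..
  let ?f = "\<lambda>u v. indicator {0<..<v} u * g u"
  have f_eq: "?f u v = indicator {0<..} u * g u * indicator {u<..} v" for u v
    by (auto simp: indicator_def)
  have "(\<lambda>(u, v). if 0 < u \<and> u < v then g u else 0) \<in> borel_measurable (borel \<Otimes>\<^sub>M borel)"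
    by measurable
  also have "(\<lambda>(u, v). if 0 < u \<and> u < v then g u else 0) = case_prod ?f"
    by (auto simp: fun_eq_iff)
  finally have [measurable]: "case_prod ?f \<in> borel_measurable (lborel \<Otimes>\<^sub>M M)"
    by (simp cong: measurable_cong_sets)
  have space_M: "space M = UNIV" using sets_eq_imp_space_eq[OF sets_M] by simp
  have int_v: "integrable M (?f u)" and int_norm: "(\<integral>v. norm (?f u v) \<partial>M) = norm (indicator {0<..} u * (g u * measure M {u<..}))"
    and int_eq: "(\<integral>v. ?f u v \<partial>M) = indicator {0<..} u * (g u * measure M {u<..})" for u
  proof -
    have "integrable M (?f u) \<and> (\<integral>v. norm (?f u v) \<partial>M) = norm (indicator {0<..} u * (g u * measure M {u<..}))
      \<and> (\<integral>v. ?f u v \<partial>M) = indicator {0<..} u * (g u * measure M {u<..})"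
    proof (cases "u > 0")
      case True
      then have "integrable M (indicator {u<..} :: real \<Rightarrow> real)" using fin by simp
      then show ?thesis
        unfolding f_eq by (simp add: abs_mult space_M)
    qed (simp add: f_eq)
    then show "integrable M (?f u)" "(\<integral>v. norm (?f u v) \<partial>M) = norm (indicator {0<..} u * (g u * measure M {u<..}))"
      "(\<integral>v. ?f u v \<partial>M) = indicator {0<..} u * (g u * measure M {u<..})" by auto
  qed
  have I: "integrable (lborel \<Otimes>\<^sub>M M) (case_prod ?f)"
  proof (rule Fubini_integrable)
    show "integrable lborel (\<lambda>u. \<integral>v. norm (case_prod ?f (u, v)) \<partial>M)"
      unfolding prod.case int_norm using int by (rule integrable_norm)
  qed (use int_v in auto)
  show "integrable M (\<lambda>v. \<integral>u. ?f u v \<partial>lborel)"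
    using integrable_snd[OF I] .
  show "(\<integral>v. (\<integral>u. ?f u v \<partial>lborel) \<partial>M) = (\<integral>u. indicator {0<..} u * (g u * measure M {u<..}) \<partial>lborel)"
    using Fubini_integral[OF I] unfolding int_eq .
qed

text \<open>\<open>jump_kernel s\<close> is the derivative of \<open>jump_gain s\<close>, away from the singularity at 1 that it has for \<open>s < 1\<close>.\<close>

definition jump_kernel :: "real \<Rightarrow> real \<Rightarrow> real" where
  "jump_kernel s u = s * (1 - (if u < 1 then (1 - u) powr (s - 1) else 0) + (if u > 1 then (u - 1) powr (s - 1) else 0))"

text \<open>A jump of relative size v towards the origin multiplies |x|^s by |1 - v|^s; this is what
  remains of the relative change after the linear part - s * v is removed. Values v > 1 are
  overshoots and v < 0 outward jumps.\<close>

definition jump_gain :: "real \<Rightarrow> real \<Rightarrow> real" where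
  "jump_gain s v = \<bar>1 - v\<bar> powr s - 1 + s * v"

lemma jump_kernel_measurable [measurable]: "jump_kernel s \<in> borel_measurable borel"
  and jump_gain_measurable [measurable]: "jump_gain s \<in> borel_measurable borel"
  unfolding jump_kernel_def[abs_def] jump_gain_def[abs_def] by measurable

lemma has_bochner_integral_FTC:
  fixes f F :: "real \<Rightarrow> real"
  assumes ab: "a \<le> b" and [measurable]: "f \<in> borel_measurable borel"
    and nonneg: "\<And>x. a < x \<Longrightarrow> x < b \<Longrightarrow> 0 \<le> f x"
    and cont: "continuous_on {a..b} F"
    and der: "\<And>x. a < x \<Longrightarrow> x < b \<Longrightarrow> (F has_real_derivative f x) (at x)"
  shows "has_bochner_integral lborel (\<lambda>x. indicator {a<..<b} x * f x) (F b - F a)"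
proof (rule has_bochner_integral_of_has_integral)
  have "(f has_integral F b - F a) {a..b}"
    using der by (intro fundamental_theorem_of_calculus_interior ab cont)
      (auto simp: has_real_derivative_iff_has_vector_derivative)
  then show "(f has_integral F b - F a) {a<..<b}"
    by (simp add: has_integral_Icc_iff_Ioo)
qed (use nonneg in auto)

lemma jump_gain_eq_integral:
  assumes s: "s > 0" and v: "v \<ge> 0"
  shows "(\<integral>u. indicator {0<..<v} u * jump_kernel s u \<partial>lborel) = jump_gain s v"
proof -
  have cont: "continuous_on {a..b} (\<lambda>u::real. (1 - u) powr s)" if "b \<le> 1" for a b
    using s that by (intro continuous_on_powr' continuous_intros) auto
  have cont': "continuous_on {a..b} (\<lambda>u::real. (u - 1) powr s)" if "a \<ge> 1" for a b
    using s that by (intro continuous_on_powr' continuous_intros) auto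
  \<comment> \<open>The kernel may be singular at 1, so the two sides are integrated separately; for
    v \<le> 1 the right piece is empty.\<close>
  let ?m = "min v 1" and ?M = "max v 1"
  have 1: "has_bochner_integral lborel (\<lambda>u. indicator {0<..<v} u * 1) (v - 0)"
    using v by (intro has_bochner_integral_FTC) (auto intro!: derivative_eq_intros continuous_intros)
  have 2: "has_bochner_integral lborel (\<lambda>u. indicator {0<..<?m} u * (1 - u) powr (s - 1)) (- ((1 - ?m) powr s) / s - - ((1 - 0) powr s) / s)"
  proof (rule has_bochner_integral_FTC)
    show "continuous_on {0..?m} (\<lambda>u. - ((1 - u) powr s) / s)"
      using cont[of ?m 0] s by (intro continuous_on_divide continuous_on_minus continuous_on_const) auto
    show "((\<lambda>u. - ((1 - u) powr s) / s) has_real_derivative (1 - x) powr (s - 1)) (at x)" if "0 < x" "x < ?m" for x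
      using that s DERIV_cdivide[OF DERIV_minus[OF DERIV_fun_powr[of "\<lambda>u. 1 - u" "-1" x s]], of s]
      by (auto intro!: derivative_eq_intros)
  qed (use v in auto)
  have 3: "has_bochner_integral lborel (\<lambda>u. indicator {1<..<?M} u * (u - 1) powr (s - 1)) ((?M - 1) powr s / s - (1 - 1) powr s / s)"
  proof (rule has_bochner_integral_FTC)
    show "continuous_on {1..?M} (\<lambda>u. (u - 1) powr s / s)"
      using cont'[of 1 ?M] s by (intro continuous_on_divide continuous_on_const) auto
    show "((\<lambda>u. (u - 1) powr s / s) has_real_derivative (x - 1) powr (s - 1)) (at x)" if "1 < x" "x < ?M" for x
      using that s DERIV_cdivide[OF DERIV_fun_powr[of "\<lambda>u. u - 1" "1" x s], of s]
      by (auto intro!: derivative_eq_intros)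
  qed (use v in auto)
  have eq: "indicator {0<..<v} u * jump_kernel s u
      = s * (indicator {0<..<v} u * 1 - indicator {0<..<?m} u * (1 - u) powr (s - 1) + indicator {1<..<?M} u * (u - 1) powr (s - 1))" for u
    by (auto simp: indicator_def jump_kernel_def)
  have "has_bochner_integral lborel (\<lambda>u. indicator {0<..<v} u * jump_kernel s u)
     (s * ((v - 0) - (- ((1 - ?m) powr s) / s - - ((1 - 0) powr s) / s) + ((?M - 1) powr s / s - (1 - 1) powr s / s)))"
    unfolding eq
    by (intro has_bochner_integral_mult_right has_bochner_integral_add has_bochner_integral_diff 1 2 3)
  then have "(\<integral>u. indicator {0<..<v} u * jump_kernel s u \<partial>lborel) = (s * ((v - 0) - (- ((1 - ?m) powr s) / s - - ((1 - 0) powr s) / s) + ((?M - 1) powr s / s - (1 - 1) powr s / s)))"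
    by (rule has_bochner_integral_integral_eq)
  also have "\<dots> = jump_gain s v"
    using s v by (cases "v \<le> 1") (auto simp: jump_gain_def field_simps)
  finally show ?thesis .
qed

text \<open>The compensated inward jumps with tail \<open>y powr (-\<beta>)\<close> contribute \<open>- s * critical_ratio \<beta> s\<close> to the drift
coefficient of \<open>\<bar>x\<bar> powr s\<close>.\<close>

definition critical_ratio :: "real \<Rightarrow> real \<Rightarrow> real" where
  "critical_ratio \<beta> \<nu> = Gamma \<nu> * ((1 - \<beta> + \<nu>) * Gamma (1 - \<beta>) / Gamma (2 - \<beta> + \<nu>) - Gamma (\<beta> - \<nu>) / Gamma \<beta>)"

lemma not_nonpos_Int_between:
  fixes x :: real
  assumes "-1 < x" "x \<noteq> 0" shows "x \<notin> \<int>\<^sub>\<le>\<^sub>0"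
proof
  assume "x \<in> \<int>\<^sub>\<le>\<^sub>0"
  then obtain n :: int where n: "x = of_int n" "n \<le> 0" by (auto simp: nonpos_Ints_def)
  then have "-1 < n" using assms by linarith
  then show False using n assms by simp
qed

text \<open>The integral splits at 1 into the regularized Beta integral, a pure power tail and a
  Beta tail, the last one requiring s < \<beta>. The terms 1 / (1 - \<beta>) and 1 / (\<beta> - 1)
  cancel, and the two Beta values form the Gamma expression.\<close>

lemma has_bochner_integral_jump_kernel:
  assumes \<beta>: "1 < \<beta>" "\<beta> < 2" and s: "0 < s" "s < \<beta>"
  shows "has_bochner_integral lborel (\<lambda>u. indicator {0<..} u * (jump_kernel s u * u powr (-\<beta>))) (- s * critical_ratio \<beta> s)"
proof -
  have "has_bochner_integral lborel (\<lambda>u. s * (indicator {0<..<1} u * ((1 - (1 - u) powr (s - 1)) * u powr (-\<beta>))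
        + indicator {1<..} u * u powr (-\<beta>) + indicator {1<..} u * ((u - 1) powr (s - 1) * u powr (-\<beta>))))
      (s * ((1 / (1 - \<beta>) - (s + 1 - \<beta>) / (1 - \<beta>) * Beta (2 - \<beta>) s) + 1 powr (1 - \<beta>) / (\<beta> - 1) + Beta s (\<beta> - s)))"
    by (intro has_bochner_integral_mult_right has_bochner_integral_add has_bochner_integral_regularized_Beta
        has_bochner_integral_powr_tail has_bochner_integral_Beta_tail \<beta> s) simp
  moreover have "AE u in lborel. s * (indicator {0<..<1} u * ((1 - (1 - u) powr (s - 1)) * u powr (-\<beta>))
        + indicator {1<..} u * u powr (-\<beta>) + indicator {1<..} u * ((u - 1) powr (s - 1) * u powr (-\<beta>)))
       = indicator {0<..} u * (jump_kernel s u * u powr (-\<beta>))"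
    using AE_lborel_singleton[of "1::real"]
    by eventually_elim (auto simp: indicator_def jump_kernel_def algebra_simps)
  moreover have "(1 / (1 - \<beta>) - (s + 1 - \<beta>) / (1 - \<beta>) * Beta (2 - \<beta>) s) + 1 powr (1 - \<beta>) / (\<beta> - 1) + Beta s (\<beta> - s) = - critical_ratio \<beta> s"
  proof -
    have "1 / (1 - \<beta>) + 1 / (\<beta> - 1) = 0" using \<beta> by (simp add: divide_simps)
    moreover have "(s + 1 - \<beta>) / (1 - \<beta>) * Beta (2 - \<beta>) s = Gamma s * ((1 - \<beta> + s) * Gamma (1 - \<beta>) / Gamma (2 - \<beta> + s))"
    proof -
      have "1 - \<beta> \<notin> \<int>\<^sub>\<le>\<^sub>0"
        by (rule not_nonpos_Int_between) (use \<beta> in auto)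
      then have "Gamma (2 - \<beta>) = (1 - \<beta>) * Gamma (1 - \<beta>)"
        using Gamma_plus1[of "1 - \<beta>"] by (simp add: algebra_simps)
      then have "Beta (2 - \<beta>) s = (1 - \<beta>) * (Gamma (1 - \<beta>) * Gamma s / Gamma (2 - \<beta> + s))"
        by (simp add: Beta_def)
      then show ?thesis using \<beta> by (simp add: mult_ac add_ac)
    qed
    moreover have "Beta s (\<beta> - s) = Gamma s * (Gamma (\<beta> - s) / Gamma \<beta>)"
      by (simp add: Beta_def)
    ultimately show ?thesis by (simp add: critical_ratio_def algebra_simps)
  qed
  ultimately show ?thesis
    by (subst has_bochner_integral_cong_AE[symmetric]) (simp_all add: ac_simps)
qed

section \<open>Scaling limits of means under heavy tails\<close>

lemma tail_bound_of_limit: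
  fixes P :: "'i \<Rightarrow> real \<Rightarrow> real"
  assumes \<beta>: "\<beta> > 0" and P: "\<And>i y. i \<in> I \<Longrightarrow> 0 \<le> P i y \<and> P i y \<le> 1"
    and tail: "\<And>e. e > 0 \<Longrightarrow> \<exists>Y. \<forall>y\<ge>Y. \<forall>i\<in>I. \<bar>y powr \<beta> * P i y - c\<bar> \<le> e"
  shows "\<exists>C\<ge>0. \<forall>i\<in>I. \<forall>y>0. P i y \<le> C * y powr (-\<beta>)"
proof -
  obtain Y where Y: "\<And>y i. y \<ge> Y \<Longrightarrow> i \<in> I \<Longrightarrow> \<bar>y powr \<beta> * P i y - c\<bar> \<le> 1"
    using tail[of 1] by auto
  \<comment> \<open>The limit gives c + 1 beyond \<open>Y\<close>; below \<open>Y\<close> the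
    trivial bound 1 on the probability costs at most |Y|^\<beta>.\<close>
  define C where "C = max (max 0 (c + 1)) (\<bar>Y\<bar> powr \<beta>)"
  have "P i y \<le> C * y powr (-\<beta>)" if "i \<in> I" "y > 0" for i y
  proof -
    have "y powr \<beta> * P i y \<le> C"
    proof (cases "y \<ge> Y")
      case True
      then show ?thesis using Y[OF True that(1)] by (simp add: C_def)
    next
      case False
      have "y powr \<beta> * P i y \<le> y powr \<beta> * 1" using P[OF that(1)] by (intro mult_left_mono) auto
      also have "\<dots> \<le> \<bar>Y\<bar> powr \<beta>" using False that \<beta> by (simp add: powr_mono2)
      finally show ?thesis by (simp add: C_def)
    qed
    then show ?thesis using that by (simp add: powr_minus_divide field_simps)
  qed
  moreover have "C \<ge> 0" by (simp add: C_def)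
  ultimately show ?thesis by blast
qed

text \<open>After the layer cake formula only the scaled tail depends on n, and it converges
  pointwise to c * u^(-\<beta>) under a uniform multiple of the same power, so dominated convergence
  in u applies. The laws may vary with n; uniformity over starting points later rests on this
  freedom.\<close>

lemma scaled_tail_limit:
  fixes D :: "nat \<Rightarrow> real measure" and r :: "nat \<Rightarrow> real" and g :: "real \<Rightarrow> real"
  assumes prob: "\<And>n. prob_space (D n)" and sets_D [measurable_cong]: "\<And>n. sets (D n) = sets borel"
    and r_pos: "\<And>n. r n > 0" and r_lim: "filterlim r at_top sequentially"
    and \<beta>: "\<beta> > 0"
    and tail: "\<And>e. e > 0 \<Longrightarrow> \<exists>Y. \<forall>y\<ge>Y. \<forall>n. \<bar>y powr \<beta> * measure (D n) {y<..} - c\<bar> \<le> e"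
    and [measurable]: "g \<in> borel_measurable borel"
    and g_int: "integrable lborel (\<lambda>u. indicator {0<..} u * (g u * u powr (-\<beta>)))"
  defines "\<Phi> \<equiv> \<lambda>v. \<integral>u. indicator {0<..<v} u * g u \<partial>lborel"
  shows "\<And>n. integrable (D n) (\<lambda>\<eta>. \<Phi> (\<eta> / r n))"
    and "(\<lambda>n. r n powr \<beta> * (\<integral>\<eta>. \<Phi> (\<eta> / r n) \<partial>D n)) \<longlonglongrightarrow> c * (\<integral>u. indicator {0<..} u * (g u * u powr (-\<beta>)) \<partial>lborel)"
proof -
  define M where "M n = distr (D n) borel (\<lambda>\<eta>. \<eta> / r n)" for n
  have space_D: "space (D n) = UNIV" for n using sets_eq_imp_space_eq[OF sets_D] by simp
  have prob_M: "prob_space (M n)" for n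
    unfolding M_def using prob by (rule prob_space.prob_space_distr) measurable
  have M_tail: "measure (M n) {u<..} = measure (D n) {u * r n<..}" for n u
    unfolding M_def using r_pos[of n]
    by (subst measure_distr) (auto simp: space_D field_simps intro!: arg_cong[where f="measure (D n)"])
  have P1: "measure (D n) A \<le> 1" for n A
    using prob_space.prob_le_1[OF prob[of n]] .
  have "\<exists>C\<ge>0. \<forall>n\<in>UNIV. \<forall>y>0. measure (D n) {y<..} \<le> C * y powr (-\<beta>)"
    using tail P1 by (intro tail_bound_of_limit[OF \<beta>, of _ _ c]) auto
  then obtain C where C: "C \<ge> 0" "\<And>n y. y > 0 \<Longrightarrow> measure (D n) {y<..} \<le> C * y powr (-\<beta>)" by auto
  have scaled: "r n powr \<beta> * measure (M n) {u<..} = u powr (-\<beta>) * ((u * r n) powr \<beta> * measure (D n) {u * r n<..})"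
    if "u > 0" for u n
    using that r_pos[of n] by (simp add: M_tail powr_mult powr_minus)
  have bound: "norm (indicator {0<..} u * (g u * (r n powr \<beta> * measure (M n) {u<..})))
      \<le> C * norm (indicator {0<..} u * (g u * u powr (-\<beta>)))" for u n
  proof (cases "u > 0")
    case True
    have "(u * r n) powr \<beta> * measure (D n) {u * r n<..} \<le> (u * r n) powr \<beta> * (C * (u * r n) powr (-\<beta>))"
      using True r_pos[of n] by (intro mult_left_mono C) auto
    also have "\<dots> = C" using True r_pos[of n] by (simp add: powr_minus)
    finally have "r n powr \<beta> * measure (M n) {u<..} \<le> u powr (-\<beta>) * C"
      unfolding scaled[OF True] by (intro mult_left_mono) auto
    then have "\<bar>g u\<bar> * (r n powr \<beta> * measure (M n) {u<..}) \<le> \<bar>g u\<bar> * (u powr (-\<beta>) * C)"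
      by (intro mult_left_mono) auto
    then show ?thesis using True C by (simp add: abs_mult mult_ac)
  qed simp
  have g_int': "integrable lborel (\<lambda>u. C * norm (indicator {0<..} u * (g u * u powr (-\<beta>))))"
    using g_int by simp
  have meas [measurable]: "(\<lambda>u. measure (M n) {u<..}) \<in> borel_measurable borel" for n
  proof -
    interpret prob_space "M n" by (rule prob_M)
    have "mono (\<lambda>u. - measure (M n) {u<..})"
    proof (rule monoI, rule le_imp_neg_le)
      fix x y :: real assume "x \<le> y"
      then show "measure (M n) {y<..} \<le> measure (M n) {x<..}"
        by (intro finite_measure_mono) (auto simp: M_def)
    qed
    then have "(\<lambda>u. - measure (M n) {u<..}) \<in> borel_measurable borel" by (rule borel_measurable_mono)
    then show ?thesis by (subst (asm) borel_measurable_uminus_eq) 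
  qed
  have int_scaled: "integrable lborel (\<lambda>u. indicator {0<..} u * (g u * (r n powr \<beta> * measure (M n) {u<..})))" for n
    by (rule Bochner_Integration.integrable_bound[OF g_int']) (use bound in \<open>auto intro!: AE_I2 order_trans[OF _ abs_ge_self]\<close>)
  have int_n: "integrable lborel (\<lambda>u. indicator {0<..} u * (g u * measure (M n) {u<..}))" for n
  proof -
    have "r n powr (-\<beta>) * (indicator {0<..} u * (g u * (r n powr \<beta> * measure (M n) {u<..})))
        = indicator {0<..} u * (g u * measure (M n) {u<..})" for u
      using r_pos[of n] by (simp add: powr_minus)
    then show ?thesis using integrable_mult_right[OF int_scaled[of n], of "r n powr (-\<beta>)"] by (simp only:)
  qed
  have lc: "integrable (M n) \<Phi>"
    "(\<integral>v. \<Phi> v \<partial>M n) = (\<integral>u. indicator {0<..} u * (g u * measure (M n) {u<..}) \<partial>lborel)" for n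
  proof -
    interpret prob_space "M n" by (rule prob_M)
    have s: "sets (M n) = sets borel" by (simp add: M_def)
    show "integrable (M n) \<Phi>"
      "(\<integral>v. \<Phi> v \<partial>M n) = (\<integral>u. indicator {0<..} u * (g u * measure (M n) {u<..}) \<partial>lborel)"
      unfolding \<Phi>_def using layer_cake[OF sigma_finite_measure_axioms s _ _ int_n]
      by (auto simp: emeasure_eq_measure)
  qed
  have [measurable]: "\<Phi> \<in> borel_measurable borel"
    using borel_measurable_integrable[OF lc(1)[of 0]] by (simp add: M_def)
  show "integrable (D n) (\<lambda>\<eta>. \<Phi> (\<eta> / r n))" for n
    using lc(1)[of n] unfolding M_def by (subst (asm) integrable_distr_eq) auto
  have D_eq: "(\<integral>\<eta>. \<Phi> (\<eta> / r n) \<partial>D n) = (\<integral>v. \<Phi> v \<partial>M n)" for n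
    unfolding M_def by (subst integral_distr) auto
  have "(\<lambda>n. \<integral>u. indicator {0<..} u * (g u * (r n powr \<beta> * measure (M n) {u<..})) \<partial>lborel)
      \<longlonglongrightarrow> (\<integral>u. c * (indicator {0<..} u * (g u * u powr (-\<beta>))) \<partial>lborel)"
  proof (rule integral_dominated_convergence[OF _ _ g_int'])
    show "AE u in lborel. (\<lambda>n. indicator {0<..} u * (g u * (r n powr \<beta> * measure (M n) {u<..})))
        \<longlonglongrightarrow> c * (indicator {0<..} u * (g u * u powr (-\<beta>)))"
    proof (rule AE_I2)
      fix u :: real
      show "(\<lambda>n. indicator {0<..} u * (g u * (r n powr \<beta> * measure (M n) {u<..})))
        \<longlonglongrightarrow> c * (indicator {0<..} u * (g u * u powr (-\<beta>)))"
      proof (cases "u > 0")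
        case True
        have "(\<lambda>n. (u * r n) powr \<beta> * measure (D n) {u * r n<..}) \<longlonglongrightarrow> c"
        proof (rule tendstoI)
          fix e :: real assume "e > 0"
          then obtain Y where Y: "\<And>y n. y \<ge> Y \<Longrightarrow> \<bar>y powr \<beta> * measure (D n) {y<..} - c\<bar> \<le> e / 2"
            using tail[of "e / 2"] by auto
          have "filterlim (\<lambda>n. u * r n) at_top sequentially"
            by (rule filterlim_tendsto_pos_mult_at_top[OF tendsto_const True r_lim])
          then have "\<forall>\<^sub>F n in sequentially. u * r n \<ge> Y" unfolding filterlim_at_top by blast
          then show "\<forall>\<^sub>F n in sequentially. dist ((u * r n) powr \<beta> * measure (D n) {u * r n<..}) c < e"
          proof eventually_elim
            case (elim n)
            show ?case using Y[OF elim, of n] \<open>e > 0\<close> unfolding dist_real_def by linarith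
          qed
        qed
        then have "(\<lambda>n. g u * (u powr (-\<beta>) * ((u * r n) powr \<beta> * measure (D n) {u * r n<..}))) \<longlonglongrightarrow> g u * (u powr (-\<beta>) * c)"
          by (intro tendsto_intros)
        then show ?thesis using True by (simp add: scaled mult_ac)
      qed simp
    qed
    show "AE u in lborel. norm (indicator {0<..} u * (g u * (r n powr \<beta> * measure (M n) {u<..})))
      \<le> C * norm (indicator {0<..} u * (g u * u powr (-\<beta>)))" for n
      using bound by simp
  qed measurable
  moreover have "(\<integral>u. indicator {0<..} u * (g u * (r n powr \<beta> * measure (M n) {u<..})) \<partial>lborel)
      = r n powr \<beta> * (\<integral>\<eta>. \<Phi> (\<eta> / r n) \<partial>D n)" for n
    unfolding D_eq lc(2) Bochner_Integration.integral_mult_right_zero[symmetric]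
    by (intro Bochner_Integration.integral_cong) auto
  ultimately show "(\<lambda>n. r n powr \<beta> * (\<integral>\<eta>. \<Phi> (\<eta> / r n) \<partial>D n)) \<longlonglongrightarrow> c * (\<integral>u. indicator {0<..} u * (g u * u powr (-\<beta>)) \<partial>lborel)"
    by simp
qed

text \<open>A linear bound serves small w and a power bound large w. It is applied with e = s - 1
  and t = p - 1, hence the allowance for negative e.\<close>

lemma one_plus_powr_minus_one_bound:
  fixes w e t :: real
  assumes w: "w > 0" and e: "-1 \<le> e" "e \<le> 1" "e \<le> t" and t: "0 < t" "t \<le> 1"
  shows "\<bar>(1 + w) powr e - 1\<bar> \<le> 2 * w powr t"
proof -
  have small: "w \<le> w powr t" if "w \<le> 1"
    using powr_mono'[of t 1 w] that w t by simp
  have large: "1 \<le> w powr t" if "w \<ge> 1"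
    using that t by (intro ge_one_powr_ge_zero) auto
  have wt: "w powr t \<ge> 0" by simp
  show ?thesis
  proof (cases "e \<ge> 0")
    case True
    have ge: "1 \<le> (1 + w) powr e" using True w by (intro ge_one_powr_ge_zero) auto
    have "(1 + w) powr e - 1 \<le> 2 * w powr t"
    proof (cases "w \<le> 1")
      case le: True
      have "(1 + w) powr e \<le> (1 + w) powr 1" using e w by (intro powr_mono) auto
      then show ?thesis using small[OF le] wt w by simp
    next
      case False
      have "(1 + w) powr e \<le> (2 * w) powr e" using False True by (intro powr_mono2) auto
      also have "\<dots> = 2 powr e * w powr e" using w by (simp add: powr_mult)
      also have "\<dots> \<le> 2 powr 1 * w powr t" using False e by (intro mult_mono powr_mono) auto
      finally show ?thesis by simp
    qed
    then show ?thesis using ge by simp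
  next
    case False
    have le: "(1 + w) powr e \<le> 1" using False w powr_mono[of e 0 "1 + w"] by simp
    have "1 - (1 + w) powr e \<le> 2 * w powr t"
    proof (cases "w \<le> 1")
      case True
      have "1 - w \<le> 1 / (1 + w)" using w by (simp add: field_simps)
      also have "\<dots> = (1 + w) powr (-1)" using w by (simp add: powr_minus_divide)
      also have "\<dots> \<le> (1 + w) powr e" using e w by (intro powr_mono) auto
      finally show ?thesis using small[OF True] wt w by linarith
    next
      case False
      have "0 \<le> (1 + w) powr e" by simp
      then show ?thesis using large False by linarith
    qed
    then show ?thesis using le by simp
  qed
qed

text \<open>By the mean value theorem the gain is v times a derivative of order w^(p - 1) with 0 < w
  < v. Outward jumps are controlled by moments rather than tails, so a power p above \<beta> is
  wanted here.\<close>

lemma jump_gain_neg_bound: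
  assumes s: "0 < s" "s \<le> 2" "s \<le> p" and p: "1 < p" "p \<le> 2" and v: "v \<ge> 0"
  shows "\<bar>jump_gain s (- v)\<bar> \<le> 2 * s * v powr p"
proof (cases "v = 0")
  case True
  then show ?thesis by (simp add: jump_gain_def)
next
  case False
  then have v: "v > 0" using v by simp
  let ?h = "\<lambda>w. (1 + w) powr s - 1 - s * w" and ?h' = "\<lambda>w. s * (1 + w) powr (s - 1) - s"
  have "\<exists>w>0. w < v \<and> ?h v - ?h 0 = (v - 0) * ?h' w"
  proof (rule MVT2[OF v])
    fix w :: real assume "0 \<le> w" "w \<le> v"
    then show "(?h has_real_derivative ?h' w) (at w)"
      using DERIV_fun_powr[of "\<lambda>u. 1 + u" 1 w s] by (auto intro!: derivative_eq_intros)
  qed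
  then obtain w where w: "0 < w" "w < v" "?h v = v * ?h' w" by auto
  have "\<bar>?h' w\<bar> = s * \<bar>(1 + w) powr (s - 1) - 1\<bar>"
  proof -
    have "?h' w = s * ((1 + w) powr (s - 1) - 1)" by (simp add: algebra_simps)
    then show ?thesis using s by (simp only: abs_mult abs_of_pos)
  qed
  also have "\<dots> \<le> s * (2 * w powr (p - 1))"
    using s p w by (intro mult_left_mono one_plus_powr_minus_one_bound) auto
  also have "\<dots> \<le> s * (2 * v powr (p - 1))"
    using s p w by (intro mult_left_mono powr_mono2) auto
  finally have "\<bar>?h v\<bar> \<le> v * (s * (2 * v powr (p - 1)))"
    using v unfolding w(3) by (simp add: abs_mult)
  also have "\<dots> = 2 * s * v powr p"
    using v powr_add[of v 1 "p - 1"] by simp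
  finally show ?thesis using v by (simp add: jump_gain_def)
qed

text \<open>Inward jumps fall under the scaled tail limit. Outward jumps have a bounded moment of an
  order p > \<beta>, so their contribution is of order r^(-p) and disappears after multiplication by
  r^\<beta>.\<close>

lemma jump_gain_limit:
  fixes D :: "nat \<Rightarrow> real measure" and r :: "nat \<Rightarrow> real"
  assumes prob: "\<And>n. prob_space (D n)" and sets_D [measurable_cong]: "\<And>n. sets (D n) = sets borel"
    and r_pos: "\<And>n. r n > 0" and r_lim: "filterlim r at_top sequentially"
    and \<beta>: "1 < \<beta>" "\<beta> < 2" and s: "0 < s" "s < \<beta>" and \<alpha>: "\<alpha> > \<beta>"
    and tail: "\<And>e. e > 0 \<Longrightarrow> \<exists>Y. \<forall>y\<ge>Y. \<forall>n. \<bar>y powr \<beta> * measure (D n) {y<..} - c\<bar> \<le> e"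
    and neg: "\<And>n. (\<integral>\<^sup>+\<eta>. ennreal (neg_part \<eta> powr \<alpha>) \<partial>D n) \<le> ennreal B"
  shows "\<And>n. integrable (D n) (\<lambda>\<eta>. jump_gain s (\<eta> / r n))"
    and "(\<lambda>n. r n powr \<beta> * (\<integral>\<eta>. jump_gain s (\<eta> / r n) \<partial>D n)) \<longlonglongrightarrow> - (c * s * critical_ratio \<beta> s)"
proof -
  note J = has_bochner_integral_jump_kernel[OF \<beta> s, unfolded has_bochner_integral_iff]
  define \<Phi> where "\<Phi> v = (\<integral>u. indicator {0<..<v} u * jump_kernel s u \<partial>lborel)" for v
  have \<Phi>: "integrable (D n) (\<lambda>\<eta>. \<Phi> (\<eta> / r n))"
    "(\<lambda>n. r n powr \<beta> * (\<integral>\<eta>. \<Phi> (\<eta> / r n) \<partial>D n)) \<longlonglongrightarrow> c * (- s * critical_ratio \<beta> s)" for n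
    using scaled_tail_limit[OF prob sets_D r_pos r_lim _ tail _ J[THEN conjunct1]] \<beta> J unfolding \<Phi>_def by auto
  \<comment> \<open>Still above \<beta>, and capped at 2 because the compensated gain is only
    quadratic near 0.\<close>
  define p where "p = min \<alpha> 2"
  have p: "1 < p" "p \<le> 2" "\<beta> < p" "p \<le> \<alpha>" using \<alpha> \<beta> by (auto simp: p_def)
  have [measurable]: "neg_part \<in> borel_measurable borel" unfolding neg_part_def[abs_def] by measurable
  have np: "neg_part \<eta> \<ge> 0" for \<eta> by (simp add: neg_part_def)
  define N where "N = (\<lambda>v. jump_gain s (min v 0))"
  have N_meas [measurable]: "N \<in> borel_measurable borel" unfolding N_def by measurable
  have split: "jump_gain s v = \<Phi> v + N v" for v
  proof (cases "v \<ge> 0")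
    case True
    then show ?thesis using jump_gain_eq_integral[OF s(1) True] by (simp add: \<Phi>_def N_def jump_gain_def)
  next
    case False
    then have "{0<..<v} = {}" by auto
    then show ?thesis using False by (simp add: \<Phi>_def N_def)
  qed
  have p_moment: "(\<integral>\<^sup>+\<eta>. ennreal (neg_part \<eta> powr p) \<partial>D n) \<le> ennreal (1 + max 0 B)" for n
  proof -
    interpret prob_space "D n" by (rule prob)
    have "(\<integral>\<^sup>+\<eta>. ennreal (neg_part \<eta> powr p) \<partial>D n) \<le> (\<integral>\<^sup>+\<eta>. 1 + ennreal (neg_part \<eta> powr \<alpha>) \<partial>D n)"
    proof (rule nn_integral_mono)
      fix \<eta> :: real
      have "neg_part \<eta> powr p \<le> 1 + neg_part \<eta> powr \<alpha>"
      proof (cases "neg_part \<eta> \<le> 1")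
        case True
        then have "neg_part \<eta> powr p \<le> 1" using p np by (intro powr_le1) auto
        then show ?thesis by (simp add: add_increasing2)
      next
        case False
        then have "neg_part \<eta> powr p \<le> neg_part \<eta> powr \<alpha>" using p by (intro powr_mono) auto
        then show ?thesis by simp
      qed
      then show "ennreal (neg_part \<eta> powr p) \<le> 1 + ennreal (neg_part \<eta> powr \<alpha>)"
        by (metis ennreal_1 ennreal_leI ennreal_plus powr_ge_zero zero_le_one)
    qed
    also have "\<dots> = 1 + (\<integral>\<^sup>+\<eta>. ennreal (neg_part \<eta> powr \<alpha>) \<partial>D n)"
      by (subst nn_integral_add) (auto simp: emeasure_space_1)
    also have "\<dots> \<le> 1 + ennreal (max 0 B)"
      by (intro add_left_mono order_trans[OF neg] ennreal_leI) simp
    finally show ?thesis by simp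
  qed
  have p_int: "integrable (D n) (\<lambda>\<eta>. neg_part \<eta> powr p)" and p_le: "(\<integral>\<eta>. neg_part \<eta> powr p \<partial>D n) \<le> 1 + max 0 B" for n
  proof -
    show i: "integrable (D n) (\<lambda>\<eta>. neg_part \<eta> powr p)"
      by (rule integrableI_nonneg) (use p_moment[of n] in \<open>auto intro: le_less_trans\<close>)
    have "ennreal (\<integral>\<eta>. neg_part \<eta> powr p \<partial>D n) \<le> ennreal (1 + max 0 B)"
      using nn_integral_eq_integral[OF i] p_moment[of n] by simp
    then show "(\<integral>\<eta>. neg_part \<eta> powr p \<partial>D n) \<le> 1 + max 0 B"
      by (subst (asm) ennreal_le_iff) auto
  qed
  have N_bound: "\<bar>N (\<eta> / r n)\<bar> \<le> 2 * s * r n powr (-p) * neg_part \<eta> powr p" for \<eta> n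
  proof -
    have "N (\<eta> / r n) = jump_gain s (- (neg_part \<eta> / r n))"
    proof (cases "\<eta> < 0")
      case True
      then have "\<eta> / r n < 0" using r_pos[of n] by (simp add: divide_less_0_iff)
      then show ?thesis using True by (simp add: N_def neg_part_def)
    next
      case False
      then have "\<eta> / r n \<ge> 0" using r_pos[of n] by simp
      then show ?thesis using False by (simp add: N_def neg_part_def min_absorb2)
    qed
    also have "\<bar>\<dots>\<bar> \<le> 2 * s * (neg_part \<eta> / r n) powr p"
      using s p \<beta> np r_pos[of n] by (intro jump_gain_neg_bound) (auto simp: less_imp_le)
    also have "\<dots> = 2 * s * r n powr (-p) * neg_part \<eta> powr p"
      using np r_pos[of n] by (simp add: powr_divide powr_minus_divide)
    finally show ?thesis .
  qed
  have N_int: "integrable (D n) (\<lambda>\<eta>. N (\<eta> / r n))" for n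
    by (rule Bochner_Integration.integrable_bound[OF integrable_mult_right[OF p_int[of n], where c="2 * s * r n powr (-p)"]])
      (use N_bound[of _ n] in \<open>auto intro!: AE_I2 order_trans[OF _ abs_ge_self]\<close>)
  show "integrable (D n) (\<lambda>\<eta>. jump_gain s (\<eta> / r n))" for n
    unfolding split using \<Phi>(1) N_int by simp
  have N_lim: "(\<lambda>n. r n powr \<beta> * (\<integral>\<eta>. N (\<eta> / r n) \<partial>D n)) \<longlonglongrightarrow> 0"
  proof (rule tendsto_rabs_zero_cancel, rule tendsto_sandwich[OF _ _ tendsto_const])
    show "\<forall>\<^sub>F n in sequentially. \<bar>r n powr \<beta> * (\<integral>\<eta>. N (\<eta> / r n) \<partial>D n)\<bar> \<le> 2 * s * (1 + max 0 B) * r n powr (\<beta> - p)"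
    proof (rule always_eventually, rule allI)
      fix n
      have "\<bar>\<integral>\<eta>. N (\<eta> / r n) \<partial>D n\<bar> \<le> (\<integral>\<eta>. \<bar>N (\<eta> / r n)\<bar> \<partial>D n)" by (rule integral_abs_bound)
      also have "\<dots> \<le> (\<integral>\<eta>. 2 * s * r n powr (-p) * neg_part \<eta> powr p \<partial>D n)"
        using N_bound by (intro integral_mono integrable_abs N_int) (simp_all add: p_int)
      also have "\<dots> \<le> 2 * s * r n powr (-p) * (1 + max 0 B)"
        using p_le[of n] s by (simp add: mult_left_mono)
      finally have "r n powr \<beta> * \<bar>\<integral>\<eta>. N (\<eta> / r n) \<partial>D n\<bar> \<le> r n powr \<beta> * (2 * s * r n powr (-p) * (1 + max 0 B))"
        by (intro mult_left_mono) auto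
      then show "\<bar>r n powr \<beta> * (\<integral>\<eta>. N (\<eta> / r n) \<partial>D n)\<bar> \<le> 2 * s * (1 + max 0 B) * r n powr (\<beta> - p)"
        by (simp add: abs_mult powr_diff powr_minus_divide mult_ac)
    qed
    have "((\<lambda>x. 2 * s * (1 + max 0 B) * x powr (\<beta> - p)) \<longlongrightarrow> 2 * s * (1 + max 0 B) * 0) at_top"
      using p by (intro tendsto_intros) real_asymp
    from filterlim_compose[OF this r_lim]
    show "(\<lambda>n. 2 * s * (1 + max 0 B) * r n powr (\<beta> - p)) \<longlonglongrightarrow> 0" by simp
  qed auto
  have "(\<lambda>n. r n powr \<beta> * (\<integral>\<eta>. \<Phi> (\<eta> / r n) \<partial>D n) + r n powr \<beta> * (\<integral>\<eta>. N (\<eta> / r n) \<partial>D n))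
      \<longlonglongrightarrow> c * (- s * critical_ratio \<beta> s) + 0"
    by (intro tendsto_add \<Phi>(2) N_lim)
  then show "(\<lambda>n. r n powr \<beta> * (\<integral>\<eta>. jump_gain s (\<eta> / r n) \<partial>D n)) \<longlonglongrightarrow> - (c * s * critical_ratio \<beta> s)"
    unfolding split using \<Phi>(1) N_int by (simp add: distrib_left mult_ac)
qed

section \<open>The critical exponent\<close>

text \<open>With z = y^s and p = t / s this is the strict Bernoulli inequality p * (z - 1) < z^p -
  1, a consequence of strict convexity.\<close>

lemma powr_minus_one_div_strict_mono:
  fixes y s t :: real
  assumes y: "y > 0" "y \<noteq> 1" and st: "0 < s" "s < t"
  shows "(y powr s - 1) / s < (y powr t - 1) / t"
proof -
  define z where "z = y powr s"
  define p where "p = t / s"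
  have p: "p > 1" using st by (simp add: p_def)
  have z0: "z > 0" using y by (simp add: z_def)
  have z1: "z \<noteq> 1" using y st by (simp add: z_def powr_eq_one_iff_gen)
  have zp: "z powr p = y powr t" using st by (simp add: z_def p_def powr_powr)
  have der: "((\<lambda>u. u powr p) has_real_derivative p * w powr (p - 1)) (at w)" if "w > 0" for w
    using that by (rule has_real_derivative_powr)
  have "p * (z - 1) < z powr p - 1"
  proof (cases "z > 1")
    case True
    obtain w where w: "1 < w" "w < z" "z powr p - 1 powr p = (z - 1) * (p * w powr (p - 1))"
      using MVT2[OF True, of "\<lambda>u. u powr p" "\<lambda>w. p * w powr (p - 1)"] der by auto
    have "1 powr (p - 1) < w powr (p - 1)" using w p by (intro powr_less_mono2) auto
    then have "(z - 1) * (p * 1) < (z - 1) * (p * w powr (p - 1))" using True p by simp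
    then show ?thesis using w by (simp add: mult_ac)
  next
    case False
    then have lt: "z < 1" using z1 by simp
    obtain w where w: "z < w" "w < 1" "1 powr p - z powr p = (1 - z) * (p * w powr (p - 1))"
      using MVT2[OF lt, of "\<lambda>u. u powr p" "\<lambda>w. p * w powr (p - 1)"] der z0 by auto
    have "w powr (p - 1) < 1 powr (p - 1)" using w p z0 by (intro powr_less_mono2) auto
    then have "(1 - z) * (p * w powr (p - 1)) < (1 - z) * (p * 1)" using lt p by simp
    then show ?thesis using w by (simp add: algebra_simps)
  qed
  then have "p * (z - 1) / t < (z powr p - 1) / t" using st by (intro divide_strict_right_mono) auto
  moreover have "p * (z - 1) / t = (y powr s - 1) / s" using st by (simp add: p_def z_def)
  ultimately show ?thesis by (simp add: zp)
qed

text \<open>Undoing the integration by parts, \<open>- critical_ratio \<beta> s\<close> becomes the Pareto integral of \<open>jump_gain s v / s\<close>,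
whose integrand is increasing in \<open>s\<close>.\<close>

lemma critical_ratio_strict_antimono:
  assumes \<beta>: "1 < \<beta>" "\<beta> < 2" and st: "0 < s" "s < t" "t < \<beta>"
  shows "critical_ratio \<beta> t < critical_ratio \<beta> s"
proof -
  \<comment> \<open>The Pareto density whose tail is exactly u^(-\<beta>); its total mass is
    infinite.\<close>
  define w where "w v = indicator {0<..} v * (\<beta> * v powr (- (1 + \<beta>)))" for v :: real
  have [measurable]: "w \<in> borel_measurable borel" unfolding w_def by measurable
  have w0: "0 \<le> w v" for v using \<beta> by (simp add: w_def)
  define M where "M = density lborel (\<lambda>v. ennreal (w v))"
  have M: "sigma_finite_measure M"
    unfolding M_def by (subst sigma_finite_measure.sigma_finite_iff_density_finite[OF sigma_finite_lborel]) auto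
  have sets_M: "sets M = sets borel" by (simp add: M_def)
  have tail: "emeasure M {u<..} = ennreal (u powr (-\<beta>))" if "u > 0" for u
  proof -
    have h: "has_bochner_integral lborel (\<lambda>v. \<beta> * (indicator {u<..} v * v powr (- (1 + \<beta>)))) (\<beta> * (u powr (1 - (1 + \<beta>)) / ((1 + \<beta>) - 1)))"
      using \<beta> that by (intro has_bochner_integral_mult_right has_bochner_integral_powr_tail) auto
    have "emeasure M {u<..} = (\<integral>\<^sup>+v. ennreal (w v) * indicator {u<..} v \<partial>lborel)"
      unfolding M_def by (intro emeasure_density) auto
    also have "\<dots> = (\<integral>\<^sup>+v. ennreal (\<beta> * (indicator {u<..} v * v powr (- (1 + \<beta>)))) \<partial>lborel)"
      using that by (intro nn_integral_cong) (auto simp: w_def indicator_def)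
    also have "\<dots> = ennreal (\<integral>v. \<beta> * (indicator {u<..} v * v powr (- (1 + \<beta>))) \<partial>lborel)"
      using h \<beta> by (intro nn_integral_eq_integral) (auto simp: has_bochner_integral_iff)
    also have "\<dots> = ennreal (u powr (-\<beta>))"
      using h \<beta> by (simp add: has_bochner_integral_iff)
    finally show ?thesis .
  qed
  have rep: "integrable M (\<lambda>v. (\<integral>u. indicator {0<..<v} u * jump_kernel r u \<partial>lborel) / r) \<and>
      (\<integral>v. (\<integral>u. indicator {0<..<v} u * jump_kernel r u \<partial>lborel) / r \<partial>M) = - critical_ratio \<beta> r"
    if r: "0 < r" "r < \<beta>" for r
  proof -
    note J = has_bochner_integral_jump_kernel[OF \<beta> r, unfolded has_bochner_integral_iff]
    have eq: "indicator {0<..} u * (jump_kernel r u * measure M {u<..})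
        = indicator {0<..} u * (jump_kernel r u * u powr (-\<beta>))" for u
      by (auto simp: indicator_def measure_def tail)
    note L = layer_cake[OF M sets_M jump_kernel_measurable, of r, unfolded eq, OF _ J[THEN conjunct1]]
    show ?thesis using L tail J r by simp
  qed
  \<comment> \<open>The excluded points are those where |1 - v| is 0 or 1 and strictness can
    fail.\<close>
  have AE: "AE v in M. v > 0 \<and> v \<noteq> 1 \<and> v \<noteq> 2"
    unfolding M_def AE_density[OF measurable_compose[OF \<open>w \<in> borel_measurable borel\<close> measurable_ennreal], unfolded measurable_lborel1]
    using AE_lborel_singleton[of "1::real"] AE_lborel_singleton[of "2::real"]
    by (subst AE_density) (auto simp: w_def indicator_def elim!: eventually_elim2)
  \<comment> \<open>Divided by its exponent, each gain has the linear term v, so these terms cancel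
    and only (|1 - v|^t - 1) / t and (|1 - v|^s - 1) / s are compared.\<close>
  let ?h = "\<lambda>v. (\<integral>u. indicator {0<..<v} u * jump_kernel t u \<partial>lborel) / t - (\<integral>u. indicator {0<..<v} u * jump_kernel s u \<partial>lborel) / s"
  have h_pos: "AE v in M. 0 < ?h v"
    using AE
  proof eventually_elim
    case (elim v)
    have "(\<bar>1 - v\<bar> powr s - 1) / s < (\<bar>1 - v\<bar> powr t - 1) / t"
      using elim st by (intro powr_minus_one_div_strict_mono) auto
    then show ?case
      using st elim by (simp add: jump_gain_eq_integral jump_gain_def add_divide_distrib)
  qed
  have h_int: "integrable M ?h" and h_eq: "(\<integral>v. ?h v \<partial>M) = critical_ratio \<beta> s - critical_ratio \<beta> t"
    using rep[of s] rep[of t] st by auto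
  have "(\<integral>v. ?h v \<partial>M) \<noteq> 0"
  proof
    assume "(\<integral>v. ?h v \<partial>M) = 0"
    then have "AE v in M. ?h v = 0"
      using h_pos by (subst (asm) integral_nonneg_eq_0_iff_AE[OF h_int]) (auto elim!: eventually_mono)
    with h_pos have "AE v in M. False" by eventually_elim simp
    then have "emeasure M {v \<in> space M. 1 < v} = 0"
      by (intro emeasure_eq_0_AE) (auto elim!: eventually_mono)
    then have "emeasure M {1<..} = 0" by (simp add: M_def greaterThan_def)
    then show False using tail[of 1] by simp
  qed
  moreover have "(\<integral>v. ?h v \<partial>M) \<ge> 0"
    using h_pos by (intro integral_nonneg_AE) (auto elim!: eventually_mono)
  ultimately show ?thesis using h_eq by linarith
qed

lemma sin_pi_neg: "1 < \<beta> \<Longrightarrow> \<beta> < 2 \<Longrightarrow> sin (pi * \<beta>) < 0"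
  using sin_gt_zero[of "pi * (\<beta> - 1)"] sin_periodic_pi[of "pi * (\<beta> - 1)"]
  by (simp add: algebra_simps)

lemma Gamma_reflection_real:
  fixes x :: real
  shows "Gamma x * Gamma (1 - x) = pi / sin (pi * x)"
proof -
  have "complex_of_real (Gamma x * Gamma (1 - x)) = complex_of_real (pi / sin (pi * x))"
    using Gamma_reflection_complex[of "complex_of_real x"]
    by (simp add: Gamma_complex_of_real[symmetric] sin_of_real[symmetric])
  then show ?thesis using of_real_eq_iff by blast
qed

lemma continuous_critical_ratio:
  assumes \<beta>: "1 < \<beta>" "\<beta> < 2" and \<nu>: "0 < \<nu>" "\<nu> < \<beta>"
  shows "isCont (critical_ratio \<beta>) \<nu>"
proof -
  have "\<nu> \<notin> \<int>\<^sub>\<le>\<^sub>0" "2 - \<beta> + \<nu> \<notin> \<int>\<^sub>\<le>\<^sub>0" "\<beta> - \<nu> \<notin> \<int>\<^sub>\<le>\<^sub>0" "Gamma (2 - \<beta> + \<nu>) \<noteq> 0" "Gamma \<beta> \<noteq> 0"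
    using \<beta> \<nu> by (auto intro!: not_nonpos_Int_between simp: Gamma_eq_zero_iff)
  then show ?thesis
    unfolding critical_ratio_def[abs_def] by (intro continuous_intros) auto
qed

text \<open>A product of a pole of Gamma at 0 and a bracket vanishing there. The reflection formula
  rewrites it as a regular factor times the difference quotient of x \<mapsto> pi / sin (pi * x) at
  \<beta>; the derivative of this function produces the cotangent.\<close>

lemma critical_ratio_at_0:
  assumes \<beta>: "1 < \<beta>" "\<beta> < 2"
  shows "(critical_ratio \<beta> \<longlongrightarrow> - pi * cot (pi * \<beta>)) (at_right 0)"
proof -
  let ?F = "\<lambda>x. pi / sin (pi * x)"
  have s: "sin (pi * \<beta>) \<noteq> 0" using sin_pi_neg[OF \<beta>] by simp
  have G: "Gamma (1 - \<beta>) \<noteq> 0" "Gamma \<beta> \<noteq> 0" "1 - \<beta> \<notin> \<int>\<^sub>\<le>\<^sub>0"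
    using \<beta> not_nonpos_Int_between[of "1 - \<beta>"] not_nonpos_Int_between[of \<beta>] by (auto simp: Gamma_eq_zero_iff)
  have D: "((\<lambda>\<nu>. - ?F (\<beta> - \<nu>)) has_real_derivative - (pi^2 * cos (pi * \<beta>) / (sin (pi * \<beta>))^2)) (at 0)"
    using s by (auto intro!: derivative_eq_intros simp: power2_eq_square)
  have "((\<lambda>\<nu>. (- ?F (\<beta> - \<nu>) - - ?F (\<beta> - 0)) / (\<nu> - 0)) \<longlongrightarrow> - (pi^2 * cos (pi * \<beta>) / (sin (pi * \<beta>))^2)) (at 0)"
    using D unfolding has_field_derivative_iff .
  also have "(\<lambda>\<nu>. (- ?F (\<beta> - \<nu>) - - ?F (\<beta> - 0)) / (\<nu> - 0)) = (\<lambda>\<nu>. (?F \<beta> - ?F (\<beta> - \<nu>)) / \<nu>)"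
    by (simp add: fun_eq_iff)
  finally have 1: "((\<lambda>\<nu>. (?F \<beta> - ?F (\<beta> - \<nu>)) / \<nu>) \<longlongrightarrow> - (pi^2 * cos (pi * \<beta>) / (sin (pi * \<beta>))^2)) (at_right 0)"
    by (rule tendsto_mono[OF at_le, rotated]) simp
  have "((\<lambda>\<nu>. Gamma (\<nu> + 1) / (Gamma \<beta> * Gamma (1 - \<beta> + \<nu>)) * ((?F \<beta> - ?F (\<beta> - \<nu>)) / \<nu>))
      \<longlongrightarrow> Gamma (0 + 1) / (Gamma \<beta> * Gamma (1 - \<beta> + 0)) * - (pi^2 * cos (pi * \<beta>) / (sin (pi * \<beta>))^2)) (at_right 0)"
    using G by (intro tendsto_mult 1 tendsto_divide tendsto_Gamma tendsto_intros) auto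
  also have "Gamma (0 + 1) / (Gamma \<beta> * Gamma (1 - \<beta> + 0)) * - (pi^2 * cos (pi * \<beta>) / (sin (pi * \<beta>))^2) = - pi * cot (pi * \<beta>)"
    using s by (simp add: Gamma_reflection_real cot_def power2_eq_square)
  finally have 2: "((\<lambda>\<nu>. Gamma (\<nu> + 1) / (Gamma \<beta> * Gamma (1 - \<beta> + \<nu>)) * ((?F \<beta> - ?F (\<beta> - \<nu>)) / \<nu>)) \<longlongrightarrow> - pi * cot (pi * \<beta>)) (at_right 0)" .
  \<comment> \<open>This range keeps 1 - \<beta> + \<nu> inside (-1,0), between two poles of
    Gamma.\<close>
  have "\<forall>\<^sub>F \<nu> in at_right 0. \<nu> \<in> {0<..<\<beta> - 1}"
    using \<beta> by (intro eventually_at_right_real) simp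
  then have "\<forall>\<^sub>F \<nu> in at_right 0. Gamma (\<nu> + 1) / (Gamma \<beta> * Gamma (1 - \<beta> + \<nu>)) * ((?F \<beta> - ?F (\<beta> - \<nu>)) / \<nu>) = critical_ratio \<beta> \<nu>"
  proof eventually_elim
    case (elim \<nu>)
    have \<nu>: "0 < \<nu>" "\<nu> < \<beta> - 1" using elim by auto
    have ne: "\<nu> \<notin> \<int>\<^sub>\<le>\<^sub>0" "1 - \<beta> + \<nu> \<notin> \<int>\<^sub>\<le>\<^sub>0"
      by (rule not_nonpos_Int_between; use \<nu> \<beta> in simp)+
    have g: "Gamma (1 - \<beta> + \<nu>) \<noteq> 0" using ne by (simp add: Gamma_eq_zero_iff)
    have r1: "Gamma (1 - \<beta>) = ?F \<beta> / Gamma \<beta>"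
      by (metis G(2) Gamma_reflection_real nonzero_mult_div_cancel_left)
    have r2: "Gamma (\<beta> - \<nu>) = ?F (\<beta> - \<nu>) / Gamma (1 - \<beta> + \<nu>)"
    proof -
      have "Gamma (\<beta> - \<nu>) * Gamma (1 - \<beta> + \<nu>) = ?F (\<beta> - \<nu>)"
        using Gamma_reflection_real[of "\<beta> - \<nu>"] by (simp add: algebra_simps)
      then show ?thesis using g by (metis nonzero_mult_div_cancel_right)
    qed
    have p1: "Gamma (\<nu> + 1) / \<nu> = Gamma \<nu>"
      using Gamma_plus1[OF ne(1)] \<nu> by (simp add: field_simps)
    have p2: "(1 - \<beta> + \<nu>) / Gamma (2 - \<beta> + \<nu>) = 1 / Gamma (1 - \<beta> + \<nu>)"
    proof -
      have "1 - \<beta> + \<nu> + 1 = 2 - \<beta> + \<nu>" by simp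
      then have "Gamma (2 - \<beta> + \<nu>) = (1 - \<beta> + \<nu>) * Gamma (1 - \<beta> + \<nu>)"
        using Gamma_plus1[OF ne(2)] by (simp only:)
      then show ?thesis using \<nu> by simp
    qed
    have "critical_ratio \<beta> \<nu> = Gamma \<nu> * (((1 - \<beta> + \<nu>) / Gamma (2 - \<beta> + \<nu>)) * Gamma (1 - \<beta>) - Gamma (\<beta> - \<nu>) / Gamma \<beta>)"
      by (simp add: critical_ratio_def)
    also have "\<dots> = Gamma \<nu> * (1 / Gamma (1 - \<beta> + \<nu>) * (?F \<beta> / Gamma \<beta>) - ?F (\<beta> - \<nu>) / Gamma (1 - \<beta> + \<nu>) / Gamma \<beta>)"
      unfolding p2 r1 r2 ..
    also have "\<dots> = Gamma \<nu> / (Gamma \<beta> * Gamma (1 - \<beta> + \<nu>)) * (?F \<beta> - ?F (\<beta> - \<nu>))"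
      by (simp add: diff_divide_distrib right_diff_distrib mult_ac)
    also have "\<dots> = Gamma (\<nu> + 1) / (Gamma \<beta> * Gamma (1 - \<beta> + \<nu>)) * ((?F \<beta> - ?F (\<beta> - \<nu>)) / \<nu>)"
      unfolding p1[symmetric] by simp
    finally show ?case ..
  qed
  with 2 show ?thesis by (rule Lim_transform_eventually)
qed

text \<open>The pole of Gamma (\<beta> - \<nu>) is isolated as Gamma (\<beta> - \<nu> + 1) /
  (\<beta> - \<nu>); it enters with a negative sign, while the other term stays bounded.\<close>

lemma critical_ratio_at_top:
  assumes \<beta>: "1 < \<beta>" "\<beta> < 2"
  shows "filterlim (critical_ratio \<beta>) at_bot (at_left \<beta>)"
proof -
  have "((\<lambda>\<nu>. Gamma \<nu> * ((1 - \<beta> + \<nu>) * Gamma (1 - \<beta>) / Gamma (2 - \<beta> + \<nu>))) \<longlongrightarrow>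
      Gamma \<beta> * ((1 - \<beta> + \<beta>) * Gamma (1 - \<beta>) / Gamma (2 - \<beta> + \<beta>))) (at_left \<beta>)"
    using \<beta> Gamma_real_pos[of \<beta>] Gamma_real_pos[of 2, THEN less_imp_neq] not_nonpos_Int_between[of \<beta>] not_nonpos_Int_between[of 2]
    by (intro tendsto_intros) auto
  moreover have "filterlim (\<lambda>\<nu>. - (Gamma \<nu> / Gamma \<beta> * Gamma (\<beta> - \<nu> + 1)) * (1 / (\<beta> - \<nu>))) at_bot (at_left \<beta>)"
  proof (rule filterlim_tendsto_neg_mult_at_bot)
    show "((\<lambda>\<nu>. - (Gamma \<nu> / Gamma \<beta> * Gamma (\<beta> - \<nu> + 1))) \<longlongrightarrow> - (Gamma \<beta> / Gamma \<beta> * Gamma (\<beta> - \<beta> + 1))) (at_left \<beta>)"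
      using \<beta> Gamma_real_pos[of \<beta>, THEN less_imp_neq] not_nonpos_Int_between[of \<beta>]
      by (intro tendsto_intros) auto
    show "- (Gamma \<beta> / Gamma \<beta> * Gamma (\<beta> - \<beta> + 1)) < 0"
      using Gamma_real_pos[of \<beta>, THEN less_imp_neq] \<beta> by simp
    show "filterlim (\<lambda>\<nu>. 1 / (\<beta> - \<nu>)) at_top (at_left \<beta>)" by real_asymp
  qed
  ultimately have "filterlim (\<lambda>\<nu>. Gamma \<nu> * ((1 - \<beta> + \<nu>) * Gamma (1 - \<beta>) / Gamma (2 - \<beta> + \<nu>))
      + - (Gamma \<nu> / Gamma \<beta> * Gamma (\<beta> - \<nu> + 1)) * (1 / (\<beta> - \<nu>))) at_bot (at_left \<beta>)"
    by (rule filterlim_tendsto_add_at_bot_iff[THEN iffD2])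
  moreover have "\<forall>\<^sub>F \<nu> in at_left \<beta>. Gamma \<nu> * ((1 - \<beta> + \<nu>) * Gamma (1 - \<beta>) / Gamma (2 - \<beta> + \<nu>))
      + - (Gamma \<nu> / Gamma \<beta> * Gamma (\<beta> - \<nu> + 1)) * (1 / (\<beta> - \<nu>)) = critical_ratio \<beta> \<nu>"
  proof -
    have "\<forall>\<^sub>F \<nu> in at_left \<beta>. \<nu> \<in> {0<..<\<beta>}" using \<beta> by (intro eventually_at_left_real) simp
    then show ?thesis
    proof eventually_elim
      case (elim \<nu>)
      have "\<beta> - \<nu> \<notin> \<int>\<^sub>\<le>\<^sub>0" using elim by (intro not_nonpos_Int_between) auto
      then have "Gamma (\<beta> - \<nu> + 1) = (\<beta> - \<nu>) * Gamma (\<beta> - \<nu>)" by (rule Gamma_plus1)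
      then have "- (Gamma \<nu> / Gamma \<beta> * Gamma (\<beta> - \<nu> + 1)) * (1 / (\<beta> - \<nu>)) = - (Gamma \<nu> * (Gamma (\<beta> - \<nu>) / Gamma \<beta>))"
        using elim by simp
      then show ?case by (simp only: critical_ratio_def right_diff_distrib)
    qed
  qed
  ultimately show ?thesis by (subst (asm) filterlim_cong[OF refl refl]) auto
qed

text \<open>On (0,\<beta>) the ratio decreases strictly and continuously from the cotangent value to
  minus infinity, so each level below that value is attained exactly once.\<close>

lemma critical_ratio_eq_iff:
  assumes \<beta>: "1 < \<beta>" "\<beta> < 2" and y: "y < - pi * cot (pi * \<beta>)"
  shows "\<exists>!\<nu>. 0 < \<nu> \<and> \<nu> < \<beta> \<and> y = critical_ratio \<beta> \<nu>"
proof -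
  have "\<forall>\<^sub>F \<nu> in at_right 0. y < critical_ratio \<beta> \<nu> \<and> \<nu> \<in> {0<..<\<beta>}"
    using order_tendstoD(1)[OF critical_ratio_at_0[OF \<beta>] y] \<beta>
    by (intro eventually_conj eventually_at_right_real) auto
  then obtain u where u: "y < critical_ratio \<beta> u" "0 < u" "u < \<beta>"
    using eventually_happens'[of "at_right (0::real)"] trivial_limit_at_right_real by fastforce
  have "\<forall>\<^sub>F \<nu> in at_left \<beta>. critical_ratio \<beta> \<nu> \<le> y \<and> \<nu> \<in> {u<..<\<beta>}"
    using critical_ratio_at_top[OF \<beta>] u
    by (intro eventually_conj eventually_at_left_real) (auto simp: filterlim_at_bot)
  then obtain v where v: "critical_ratio \<beta> v \<le> y" "u < v" "v < \<beta>"
    using eventually_happens'[of "at_left \<beta>"] trivial_limit_at_left_real by fastforce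
  have "\<exists>\<nu>\<ge>u. \<nu> \<le> v \<and> critical_ratio \<beta> \<nu> = y"
    using u v by (intro IVT2) (auto intro!: continuous_critical_ratio[OF \<beta>])
  then obtain \<nu> where "u \<le> \<nu>" "\<nu> \<le> v" "critical_ratio \<beta> \<nu> = y" by blast
  then have \<nu>: "0 < \<nu>" "\<nu> < \<beta>" "y = critical_ratio \<beta> \<nu>" using u v by auto
  show ?thesis
  proof (rule ex1I)
    fix \<nu>' assume "0 < \<nu>' \<and> \<nu>' < \<beta> \<and> y = critical_ratio \<beta> \<nu>'"
    then show "\<nu>' = \<nu>"
      using \<nu> critical_ratio_strict_antimono[OF \<beta>, of \<nu> \<nu>'] critical_ratio_strict_antimono[OF \<beta>, of \<nu>' \<nu>]
      by (cases \<nu> \<nu>' rule: linorder_cases) auto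
  qed (use \<nu> in auto)
qed

text \<open>At this argument the shifts become 1 - \<beta> + \<nu> = \<beta> - 2, 2 - \<beta> +
  \<nu> = \<beta> - 1 and \<beta> - \<nu> = 3 - \<beta>, and the functional equation of Gamma makes
  both terms of the bracket equal.\<close>

lemma critical_ratio_driftless:
  assumes \<beta>: "3 / 2 < \<beta>" "\<beta> < 2"
  shows "critical_ratio \<beta> (2 * \<beta> - 3) = 0"
proof -
  have ne: "\<beta> - 2 \<notin> \<int>\<^sub>\<le>\<^sub>0" "\<beta> - 1 \<notin> \<int>\<^sub>\<le>\<^sub>0" "1 - \<beta> \<notin> \<int>\<^sub>\<le>\<^sub>0" "2 - \<beta> \<notin> \<int>\<^sub>\<le>\<^sub>0"
    by (rule not_nonpos_Int_between; use \<beta> in simp)+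
  have g1: "Gamma (\<beta> - 1) = (\<beta> - 2) * Gamma (\<beta> - 2)" using Gamma_plus1[OF ne(1)] by simp
  have g2: "Gamma \<beta> = (\<beta> - 1) * Gamma (\<beta> - 1)" using Gamma_plus1[OF ne(2)] by simp
  have g3: "Gamma (2 - \<beta>) = (1 - \<beta>) * Gamma (1 - \<beta>)" using Gamma_plus1[OF ne(3)] by (simp add: algebra_simps)
  have g4: "Gamma (3 - \<beta>) = (2 - \<beta>) * Gamma (2 - \<beta>)" using Gamma_plus1[OF ne(4)] by (simp add: algebra_simps)
  have nz: "Gamma (\<beta> - 1) \<noteq> 0" using ne by (simp add: Gamma_eq_zero_iff)
  have "(\<beta> - 2) * Gamma (1 - \<beta>) / Gamma (\<beta> - 1) = Gamma (3 - \<beta>) / Gamma \<beta>"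
    unfolding g4 g3 g2 using nz \<beta> by (simp add: field_simps)
  then show ?thesis by (simp add: critical_ratio_def)
qed

section \<open>Increments of powers of the chain\<close>

text \<open>The cut at 1 is needed because the tail bound y^(-\<beta>), multiplied by u^(p - 1) with
  p < \<beta>, is integrable at infinity but not at 0.\<close>

lemma truncated_power_integral:
  fixes p :: real
  assumes p: "p \<ge> 1"
  shows "(\<integral>u. indicator {0<..<v} u * (indicator {1<..} u * (p * u powr (p - 1))) \<partial>lborel) = max 0 (max 0 v powr p - 1)"
proof -
  let ?M = "max 1 v"
  have "has_bochner_integral lborel (\<lambda>u. indicator {1<..<?M} u * (p * u powr (p - 1))) (?M powr p - 1 powr p)"
  proof (rule has_bochner_integral_FTC)
    show "continuous_on {1..?M} (\<lambda>u. u powr p)" by (intro continuous_intros) auto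
    show "((\<lambda>u. u powr p) has_real_derivative p * x powr (p - 1)) (at x)" if "1 < x" "x < ?M" for x
      using that by (intro has_real_derivative_powr) auto
  qed (use p in auto)
  moreover have "indicator {0<..<v} u * (indicator {1<..} u * (p * u powr (p - 1))) = indicator {1<..<?M} u * (p * u powr (p - 1))" for u
    by (auto simp: indicator_def)
  ultimately have "(\<integral>u. indicator {0<..<v} u * (indicator {1<..} u * (p * u powr (p - 1))) \<partial>lborel) = ?M powr p - 1"
    by (simp only: has_bochner_integral_integral_eq) simp
  also have "\<dots> = max 0 (max 0 v powr p - 1)"
  proof (cases "v \<ge> 1")
    case True
    then have "1 \<le> v powr p" using p by (intro ge_one_powr_ge_zero) auto
    then show ?thesis using True by (simp add: max_def)
  next
    case False
    then have "max 0 v powr p \<le> 1" using p by (intro powr_le1) auto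
    then show ?thesis using False by (simp add: max_def)
  qed
  finally show ?thesis .
qed

text \<open>The inward part is integrated from its tail, which requires p < \<beta>, and the outward
  part is dominated by the moment of order \<alpha>. The bound depends on the law only through
  \<open>C\<close> and \<open>B\<close>, hence it is uniform in the starting point.\<close>

lemma tail_moment_bound:
  assumes D: "prob_space D" and sets_D [measurable_cong]: "sets D = sets borel"
    and p: "1 \<le> p" "p < \<beta>" and \<alpha>: "\<beta> < \<alpha>" and C: "C \<ge> 0"
    and tail: "\<And>y. y > 0 \<Longrightarrow> measure D {y<..} \<le> C * y powr (-\<beta>)"
    and neg: "(\<integral>\<^sup>+\<eta>. ennreal (neg_part \<eta> powr \<alpha>) \<partial>D) \<le> ennreal B"
  shows "integrable D (\<lambda>\<eta>. \<bar>\<eta>\<bar> powr p) \<and> (\<integral>\<eta>. \<bar>\<eta>\<bar> powr p \<partial>D) \<le> 2 + C * p / (\<beta> - p) + max 0 B"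
proof -
  interpret prob_space D by (rule D)
  have space_D: "space D = UNIV" using sets_eq_imp_space_eq[OF sets_D] by simp
  have [measurable]: "neg_part \<in> borel_measurable borel" unfolding neg_part_def[abs_def] by measurable
  let ?g = "\<lambda>u. indicator {1<..} u * (p * u powr (p - 1)) :: real"
  let ?\<Phi> = "\<lambda>v::real. max 0 (max 0 v powr p - 1)"
  have [measurable]: "(\<lambda>u. measure D {u<..}) \<in> borel_measurable borel"
  proof -
    have "mono (\<lambda>u. - measure D {u<..})"
    proof (rule monoI, rule le_imp_neg_le)
      fix x y :: real assume "x \<le> y"
      then show "measure D {y<..} \<le> measure D {x<..}"
        by (intro finite_measure_mono) (auto simp: sets_D)
    qed
    then have "(\<lambda>u. - measure D {u<..}) \<in> borel_measurable borel" by (rule borel_measurable_mono)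
    then show ?thesis by (subst (asm) borel_measurable_uminus_eq)
  qed
  have H: "has_bochner_integral lborel (\<lambda>u. (C * p) * (indicator {1<..} u * u powr (-(\<beta> - p + 1)))) ((C * p) * (1 powr (1 - (\<beta> - p + 1)) / ((\<beta> - p + 1) - 1)))"
    using p by (intro has_bochner_integral_mult_right has_bochner_integral_powr_tail) auto
  have le: "indicator {0<..} u * (?g u * measure D {u<..}) \<le> (C * p) * (indicator {1<..} u * u powr (-(\<beta> - p + 1)))"
    and nn: "0 \<le> indicator {0<..} u * (?g u * measure D {u<..})" for u
  proof -
    show "0 \<le> indicator {0<..} u * (?g u * measure D {u<..})" using p by simp
    show "indicator {0<..} u * (?g u * measure D {u<..}) \<le> (C * p) * (indicator {1<..} u * u powr (-(\<beta> - p + 1)))"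
    proof (cases "u > 1")
      case True
      have "p * u powr (p - 1) * measure D {u<..} \<le> p * u powr (p - 1) * (C * u powr (-\<beta>))"
        using p True by (intro mult_left_mono tail) auto
      also have "\<dots> = C * p * (u powr (p - 1) * u powr (-\<beta>))" by simp
      also have "u powr (p - 1) * u powr (-\<beta>) = u powr (-(\<beta> - p + 1))"
        by (subst powr_add[symmetric]) (rule arg_cong[where f="\<lambda>t. u powr t"], simp)
      finally show ?thesis using True by simp
    qed simp
  qed
  have int: "integrable lborel (\<lambda>u. indicator {0<..} u * (?g u * measure D {u<..}))"
    by (rule Bochner_Integration.integrable_bound[OF H[unfolded has_bochner_integral_iff, THEN conjunct1]])
      (use le nn in \<open>auto intro!: AE_I2 order_trans[OF _ abs_ge_self] simp del: mult_nonneg_nonneg\<close>)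
  have L: "integrable D ?\<Phi>" "(\<integral>v. ?\<Phi> v \<partial>D) = (\<integral>u. indicator {0<..} u * (?g u * measure D {u<..}) \<partial>lborel)"
    using layer_cake[OF sigma_finite_measure_axioms sets_D _ _ int, unfolded truncated_power_integral[OF p(1)]]
    by (auto simp: emeasure_eq_measure)
  have \<Phi>_le: "(\<integral>v. ?\<Phi> v \<partial>D) \<le> C * p / (\<beta> - p)"
  proof -
    have "(\<integral>v. ?\<Phi> v \<partial>D) \<le> (\<integral>u. (C * p) * (indicator {1<..} u * u powr (-(\<beta> - p + 1))) \<partial>lborel)"
      unfolding L(2) using H le by (intro integral_mono int) (auto simp: has_bochner_integral_iff)
    then show ?thesis using H by (simp add: has_bochner_integral_iff)
  qed
  have neg_int: "integrable D (\<lambda>\<eta>. neg_part \<eta> powr \<alpha>)" and neg_le: "(\<integral>\<eta>. neg_part \<eta> powr \<alpha> \<partial>D) \<le> max 0 B"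
  proof -
    show i: "integrable D (\<lambda>\<eta>. neg_part \<eta> powr \<alpha>)"
      by (rule integrableI_nonneg) (use neg in \<open>auto intro: le_less_trans\<close>)
    have "(\<integral>\<^sup>+\<eta>. ennreal (neg_part \<eta> powr \<alpha>) \<partial>D) \<le> ennreal (max 0 B)"
      by (rule order_trans[OF neg ennreal_leI]) simp
    then have "ennreal (\<integral>\<eta>. neg_part \<eta> powr \<alpha> \<partial>D) \<le> ennreal (max 0 B)"
      using nn_integral_eq_integral[OF i] by simp
    then show "(\<integral>\<eta>. neg_part \<eta> powr \<alpha> \<partial>D) \<le> max 0 B" by (subst (asm) ennreal_le_iff) auto
  qed
  have bound: "\<bar>\<eta>\<bar> powr p \<le> 2 + ?\<Phi> \<eta> + neg_part \<eta> powr \<alpha>" for \<eta>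
  proof (cases "\<eta> \<ge> 0")
    case True
    have "0 \<le> neg_part \<eta> powr \<alpha>" by simp
    moreover have "\<bar>\<eta>\<bar> powr p - 1 \<le> ?\<Phi> \<eta>" using True by simp
    ultimately show ?thesis by linarith
  next
    case False
    have "\<bar>\<eta>\<bar> powr p \<le> 1 + \<bar>\<eta>\<bar> powr \<alpha>"
    proof (cases "\<bar>\<eta>\<bar> \<le> 1")
      case True
      then have "\<bar>\<eta>\<bar> powr p \<le> 1" using p by (intro powr_le1) auto
      then show ?thesis by (simp add: add_increasing2)
    next
      case False
      then have "\<bar>\<eta>\<bar> powr p \<le> \<bar>\<eta>\<bar> powr \<alpha>" using p \<alpha> by (intro powr_mono) auto
      then show ?thesis by simp
    qed
    then show ?thesis using False by (simp add: neg_part_def)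
  qed
  have int_b: "integrable D (\<lambda>\<eta>. 2 + ?\<Phi> \<eta> + neg_part \<eta> powr \<alpha>)" using L(1) neg_int by simp
  have i: "integrable D (\<lambda>\<eta>. \<bar>\<eta>\<bar> powr p)"
    by (rule Bochner_Integration.integrable_bound[OF int_b]) (use bound in \<open>auto intro!: AE_I2 order_trans[OF _ abs_ge_self]\<close>)
  have "(\<integral>\<eta>. \<bar>\<eta>\<bar> powr p \<partial>D) \<le> (\<integral>\<eta>. 2 + ?\<Phi> \<eta> + neg_part \<eta> powr \<alpha> \<partial>D)"
    by (intro integral_mono i int_b bound)
  also have "\<dots> = 2 + (\<integral>\<eta>. ?\<Phi> \<eta> \<partial>D) + (\<integral>\<eta>. neg_part \<eta> powr \<alpha> \<partial>D)"
    using L(1) neg_int by (simp add: prob_space)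
  finally show ?thesis using i \<Phi>_le neg_le by simp
qed

section \<open>Increments measured towards the origin\<close>

locale inward_chain = markov_chain_on X K \<Omega> \<xi>
  for X K \<Omega> and \<xi> :: "nat \<Rightarrow> 'w \<Rightarrow> real" +
  fixes \<alpha> \<beta> c x0 \<gamma> b :: real
  assumes T: "cond_T_in X \<Omega> \<xi> \<alpha> \<beta> c x0" and D: "cond_D' X \<Omega> \<xi> \<gamma> b"
begin

lemma \<beta>: "1 < \<beta>" "\<beta> < 2" and \<alpha>: "\<beta> < \<alpha>" and c: "c > 0" and x0: "x0 \<ge> 0" and \<gamma>: "\<gamma> \<ge> 0"
  using T D by (auto simp: cond_T_in_def cond_D'_def)

text \<open>The displacement towards the origin, positive for inward moves. It merges the two
  half-lines: the new distance is the absolute value of |x| minus this quantity, with overshooting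
  included.\<close>

definition inward :: "real \<Rightarrow> real \<Rightarrow> real" where
  "inward x y = \<bar>x\<bar> - sgn x * y"

definition inward_law :: "real \<Rightarrow> real measure" where
  "inward_law x = distr (K x) borel (inward x)"

lemma inward_measurable [measurable]: "inward x \<in> borel_measurable borel"
  unfolding inward_def[abs_def] by measurable

lemma sets_inward_law [simp, measurable_cong]: "sets (inward_law x) = sets borel"
  by (simp add: inward_law_def)

lemma prob_space_inward_law: "prob_space (inward_law x)"
  unfolding inward_law_def by (rule prob_space.prob_space_distr[OF prob_space_K]) measurable

lemma abs_eq_inward: "x \<noteq> 0 \<Longrightarrow> \<bar>y\<bar> = \<bar>\<bar>x\<bar> - inward x y\<bar>"
  by (auto simp: inward_def abs_mult sgn_if)

lemma inward_sub: "x > 0 \<Longrightarrow> inward x y = - (y - x)" "x < 0 \<Longrightarrow> inward x y = y - x"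
  by (auto simp: inward_def)

lemma abs_inward: "x \<noteq> 0 \<Longrightarrow> \<bar>inward x y\<bar> = \<bar>y - x\<bar>"
  by (cases "x > 0") (auto simp: inward_sub)

lemma part_measurable [measurable]: "pos_part \<in> borel_measurable borel" "neg_part \<in> borel_measurable borel"
  unfolding pos_part_def[abs_def] neg_part_def[abs_def] by measurable

lemma inward_tail:
  assumes e: "e > 0"
  shows "\<exists>Y. \<forall>y\<ge>Y. \<forall>x\<in>{x\<in>X. \<bar>x\<bar> \<ge> max x0 1}. \<bar>y powr \<beta> * measure (inward_law x) {y<..} - c\<bar> \<le> e"
proof -
  obtain Y1 where Y1: "\<And>y x. y \<ge> Y1 \<Longrightarrow> x \<in> X \<Longrightarrow> x \<ge> x0 \<Longrightarrow>
      \<bar>y powr \<beta> * measure (\<Omega> x) {\<omega> \<in> space (\<Omega> x). neg_part (increment \<xi> \<omega>) > y} - c\<bar> \<le> e"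
    using T e unfolding cond_T_in_def by meson
  obtain Y2 where Y2: "\<And>y x. y \<ge> Y2 \<Longrightarrow> x \<in> X \<Longrightarrow> x \<le> - x0 \<Longrightarrow>
      \<bar>y powr \<beta> * measure (\<Omega> x) {\<omega> \<in> space (\<Omega> x). pos_part (increment \<xi> \<omega>) > y} - c\<bar> \<le> e"
    using T e unfolding cond_T_in_def by meson
  have "\<bar>y powr \<beta> * measure (inward_law x) {y<..} - c\<bar> \<le> e"
    \<comment> \<open>For y \<ge> 0, exceeding y is the same event for the signed inward
      displacement and for the positive or negative part of the increment.\<close>
    if y: "y \<ge> max 0 (max Y1 Y2)" and x: "x \<in> X" "\<bar>x\<bar> \<ge> max x0 1" for x y
  proof -
    have m: "measure (inward_law x) {y<..} = measure (K x) {z. inward x z > y}"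
      unfolding inward_law_def by (subst measure_distr) (auto intro!: arg_cong[where f="measure (K x)"])
    show ?thesis
    proof (cases "x > 0")
      case True
      have "{z. inward x z > y} = {z. neg_part (z - x) > y}"
        using y True by (auto simp: inward_sub neg_part_def)
      then have "measure (inward_law x) {y<..} = measure (\<Omega> x) {\<omega> \<in> space (\<Omega> x). neg_part (increment \<xi> \<omega>) > y}"
        unfolding m by (subst measure_increment[OF x(1)]) auto
      then show ?thesis using Y1[of y x] y x True by simp
    next
      case False
      then have x': "x < 0" using x by auto
      have "{z. inward x z > y} = {z. pos_part (z - x) > y}"
        using y x' by (auto simp: inward_sub pos_part_def)
      then have "measure (inward_law x) {y<..} = measure (\<Omega> x) {\<omega> \<in> space (\<Omega> x). pos_part (increment \<xi> \<omega>) > y}"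
        unfolding m by (subst measure_increment[OF x(1)]) auto
      then show ?thesis using Y2[of y x] y x x' by simp
    qed
  qed
  then show ?thesis by blast
qed

lemma outward_moment:
  "\<exists>B. \<forall>x\<in>{x\<in>X. \<bar>x\<bar> \<ge> max x0 1}. (\<integral>\<^sup>+\<eta>. ennreal (neg_part \<eta> powr \<alpha>) \<partial>inward_law x) \<le> ennreal B"
proof -
  obtain B1 where B1: "\<And>x. x \<in> X \<Longrightarrow> x \<ge> x0 \<Longrightarrow> (\<integral>\<^sup>+\<omega>. ennreal (pos_part (increment \<xi> \<omega>) powr \<alpha>) \<partial>\<Omega> x) \<le> ennreal B1"
    using T unfolding cond_T_in_def by meson
  obtain B2 where B2: "\<And>x. x \<in> X \<Longrightarrow> x \<le> - x0 \<Longrightarrow> (\<integral>\<^sup>+\<omega>. ennreal (neg_part (increment \<xi> \<omega>) powr \<alpha>) \<partial>\<Omega> x) \<le> ennreal B2"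
    using T unfolding cond_T_in_def by meson
  have "(\<integral>\<^sup>+\<eta>. ennreal (neg_part \<eta> powr \<alpha>) \<partial>inward_law x) \<le> ennreal (max B1 B2)"
    if x: "x \<in> X" "\<bar>x\<bar> \<ge> max x0 1" for x
  proof -
    have m: "(\<integral>\<^sup>+\<eta>. ennreal (neg_part \<eta> powr \<alpha>) \<partial>inward_law x) = (\<integral>\<^sup>+y. ennreal (neg_part (inward x y) powr \<alpha>) \<partial>K x)"
      unfolding inward_law_def by (subst nn_integral_distr) auto
    show ?thesis
    proof (cases "x > 0")
      case True
      have "neg_part (inward x y) = pos_part (y - x)" for y
        using True by (auto simp: inward_sub neg_part_def pos_part_def)
      then have "(\<integral>\<^sup>+\<eta>. ennreal (neg_part \<eta> powr \<alpha>) \<partial>inward_law x) = (\<integral>\<^sup>+\<omega>. ennreal (pos_part (increment \<xi> \<omega>) powr \<alpha>) \<partial>\<Omega> x)"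
        unfolding m using nn_integral_increment[OF x(1), of "\<lambda>t. ennreal (pos_part t powr \<alpha>)"] by simp
      also have "\<dots> \<le> ennreal B1" using x True by (intro B1) auto
      also have "\<dots> \<le> ennreal (max B1 B2)" by (intro ennreal_leI) simp
      finally show ?thesis .
    next
      case False
      then have x': "x < 0" using x by auto
      have "(\<integral>\<^sup>+\<eta>. ennreal (neg_part \<eta> powr \<alpha>) \<partial>inward_law x) = (\<integral>\<^sup>+\<omega>. ennreal (neg_part (increment \<xi> \<omega>) powr \<alpha>) \<partial>\<Omega> x)"
        unfolding m using nn_integral_increment[OF x(1), of "\<lambda>t. ennreal (neg_part t powr \<alpha>)"] x' by (simp add: inward_sub)
      also have "\<dots> \<le> ennreal B2" using x x' by (intro B2) auto
      also have "\<dots> \<le> ennreal (max B1 B2)" by (intro ennreal_leI) simp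
      finally show ?thesis .
    qed
  qed
  then show ?thesis by blast
qed

lemma inward_drift:
  assumes e: "e > 0"
  shows "\<exists>R. \<forall>x\<in>X. \<bar>x\<bar> \<ge> R \<longrightarrow> \<bar>\<bar>x\<bar> powr \<gamma> * - (\<integral>\<eta>. \<eta> \<partial>inward_law x) - b\<bar> \<le> e"
proof -
  obtain M1 where M1: "\<And>x. x \<in> X \<Longrightarrow> x \<ge> M1 \<Longrightarrow> \<bar>x powr \<gamma> * drift \<Omega> \<xi> x - b\<bar> \<le> e"
    using D e unfolding cond_D'_def by meson
  obtain M2 where M2: "\<And>x. x \<in> X \<Longrightarrow> x \<le> - M2 \<Longrightarrow> \<bar>- (\<bar>x\<bar> powr \<gamma> * drift \<Omega> \<xi> x) - b\<bar> \<le> e"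
    using D e unfolding cond_D'_def by meson
  have "\<bar>\<bar>x\<bar> powr \<gamma> * - (\<integral>\<eta>. \<eta> \<partial>inward_law x) - b\<bar> \<le> e"
    if x: "x \<in> X" "\<bar>x\<bar> \<ge> max 1 (max M1 M2)" for x
  proof -
    have m: "(\<integral>\<eta>. \<eta> \<partial>inward_law x) = (\<integral>y. inward x y \<partial>K x)"
      unfolding inward_law_def by (subst integral_distr) auto
    show ?thesis
    proof (cases "x > 0")
      case True
      have "(\<integral>\<eta>. \<eta> \<partial>inward_law x) = - drift \<Omega> \<xi> x"
        unfolding m drift_eq[OF x(1)] Bochner_Integration.integral_minus[symmetric] using True
        by (intro Bochner_Integration.integral_cong) (auto simp: inward_sub)
      then show ?thesis using M1[of x] x True by simp
    next
      case False
      then have x': "x < 0" using x by auto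
      have "(\<integral>\<eta>. \<eta> \<partial>inward_law x) = drift \<Omega> \<xi> x"
        unfolding m drift_eq[OF x(1)] using x'
        by (intro Bochner_Integration.integral_cong) (auto simp: inward_sub)
      then show ?thesis using M2[of x] x x' by simp
    qed
  qed
  then show ?thesis by blast
qed

lemma inward_tail_bound: "\<exists>C\<ge>0. \<forall>x\<in>{x\<in>X. \<bar>x\<bar> \<ge> max x0 1}. \<forall>y>0. measure (inward_law x) {y<..} \<le> C * y powr (-\<beta>)"
  using \<beta> inward_tail prob_space.prob_le_1[OF prob_space_inward_law]
  by (intro tail_bound_of_limit) auto

lemma increment_moment:
  assumes p: "1 \<le> p" "p < \<beta>"
  shows "\<exists>M\<ge>0. \<forall>x\<in>X. \<bar>x\<bar> \<ge> max x0 1 \<longrightarrow>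
    integrable (inward_law x) (\<lambda>\<eta>. \<bar>\<eta>\<bar> powr p) \<and> (\<integral>\<eta>. \<bar>\<eta>\<bar> powr p \<partial>inward_law x) \<le> M"
proof -
  obtain C where C: "C \<ge> 0" "\<And>x y. x \<in> X \<Longrightarrow> \<bar>x\<bar> \<ge> max x0 1 \<Longrightarrow> y > 0 \<Longrightarrow> measure (inward_law x) {y<..} \<le> C * y powr (-\<beta>)"
    using inward_tail_bound by auto
  obtain B where B: "\<And>x. x \<in> X \<Longrightarrow> \<bar>x\<bar> \<ge> max x0 1 \<Longrightarrow> (\<integral>\<^sup>+\<eta>. ennreal (neg_part \<eta> powr \<alpha>) \<partial>inward_law x) \<le> ennreal B"
    using outward_moment by auto
  have "\<forall>x\<in>X. \<bar>x\<bar> \<ge> max x0 1 \<longrightarrow>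
    integrable (inward_law x) (\<lambda>\<eta>. \<bar>\<eta>\<bar> powr p) \<and> (\<integral>\<eta>. \<bar>\<eta>\<bar> powr p \<partial>inward_law x) \<le> 2 + C * p / (\<beta> - p) + max 0 B"
    using tail_moment_bound[OF prob_space_inward_law sets_inward_law p \<alpha> C(1) C(2) B] by blast
  moreover have "2 + C * p / (\<beta> - p) + max 0 B \<ge> 0" using C(1) p by simp
  ultimately show ?thesis by blast
qed

lemma integrable_inward: "x \<in> X \<Longrightarrow> \<bar>x\<bar> \<ge> max x0 1 \<Longrightarrow> integrable (inward_law x) (\<lambda>\<eta>. \<eta>)"
proof -
  assume x: "x \<in> X" "\<bar>x\<bar> \<ge> max x0 1"
  then have "integrable (inward_law x) (\<lambda>\<eta>. \<bar>\<eta>\<bar> powr 1)"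
    using increment_moment[of 1] \<beta> by auto
  then show ?thesis by (rule Bochner_Integration.integrable_bound) auto
qed

text \<open>An exact identity: with v = inward displacement / |x|, the new power is |x|^s * (1 - s *
  v + \<open>jump_gain s v\<close>). The linear part becomes the drift.\<close>

lemma powr_increment_eq:
  assumes x: "x \<in> X" "\<bar>x\<bar> \<ge> max x0 1" and s: "0 < s" "s < \<beta>"
  shows "integrable (K x) (\<lambda>y. \<bar>y\<bar> powr s)"
    and "(\<integral>y. \<bar>y\<bar> powr s \<partial>K x) = \<bar>x\<bar> powr s * (\<integral>\<eta>. jump_gain s (\<eta> / \<bar>x\<bar>) \<partial>inward_law x)
      + \<bar>x\<bar> powr s + s * \<bar>x\<bar> powr (s - 1) * - (\<integral>\<eta>. \<eta> \<partial>inward_law x)"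
proof -
  have "1 \<le> \<bar>x\<bar>" using x by simp
  then have x_pos: "\<bar>x\<bar> > 0" by linarith
  obtain B where B: "\<And>x. x \<in> X \<Longrightarrow> \<bar>x\<bar> \<ge> max x0 1 \<Longrightarrow> (\<integral>\<^sup>+\<eta>. ennreal (neg_part \<eta> powr \<alpha>) \<partial>inward_law x) \<le> ennreal B"
    using outward_moment by auto
  \<comment> \<open>Only integrability at the one scale |x| is wanted; the constant sequence of laws
    is paired with a divergent sequence of scales whose term at 0 is |x|.\<close>
  have lim: "filterlim (\<lambda>n. \<bar>x\<bar> + real n) at_top sequentially" by real_asymp
  have tl: "\<exists>Y. \<forall>y\<ge>Y. \<forall>n::nat. \<bar>y powr \<beta> * measure (inward_law x) {y<..} - c\<bar> \<le> e" if "e > 0" for e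
    using inward_tail[OF that] x by auto
  have jg: "integrable (inward_law x) (\<lambda>\<eta>. jump_gain s (\<eta> / \<bar>x\<bar>))"
    using jump_gain_limit(1)[of "\<lambda>_. inward_law x", OF prob_space_inward_law sets_inward_law _ lim \<beta> s \<alpha> tl B[OF x], of 0]
      x_pos by simp
  have i: "integrable (inward_law x) (\<lambda>\<eta>. \<eta>)" using x by (rule integrable_inward)
  have eq: "\<bar>y\<bar> powr s = \<bar>x\<bar> powr s * jump_gain s (inward x y / \<bar>x\<bar>) + \<bar>x\<bar> powr s - s * \<bar>x\<bar> powr (s - 1) * inward x y" for y
  proof -
    have "\<bar>y\<bar> = \<bar>x\<bar> * \<bar>1 - inward x y / \<bar>x\<bar>\<bar>"
    proof -
      have "\<bar>x\<bar> - inward x y = \<bar>x\<bar> * (1 - inward x y / \<bar>x\<bar>)"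
        using x_pos by (simp add: right_diff_distrib)
      then have "\<bar>\<bar>x\<bar> - inward x y\<bar> = \<bar>x\<bar> * \<bar>1 - inward x y / \<bar>x\<bar>\<bar>"
        by (simp only: abs_mult abs_idempotent)
      then show ?thesis using x_pos abs_eq_inward[of x y] by simp
    qed
    then have "\<bar>y\<bar> powr s = \<bar>x\<bar> powr s * \<bar>1 - inward x y / \<bar>x\<bar>\<bar> powr s"
      by (metis abs_ge_zero powr_mult)
    moreover have "\<bar>x\<bar> powr s = \<bar>x\<bar> * \<bar>x\<bar> powr (s - 1)"
      using x_pos powr_add[of "\<bar>x\<bar>" 1 "s - 1"] by simp
    ultimately show ?thesis using x_pos by (simp add: jump_gain_def field_simps)
  qed
  note eq' = ext[OF eq]
  have jgK: "integrable (K x) (\<lambda>y. jump_gain s (inward x y / \<bar>x\<bar>))"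
    using jg unfolding inward_law_def by (subst (asm) integrable_distr_eq) auto
  have iK: "integrable (K x) (inward x)"
    using i unfolding inward_law_def by (subst (asm) integrable_distr_eq) auto
  show "integrable (K x) (\<lambda>y. \<bar>y\<bar> powr s)"
    unfolding eq' using jgK iK by simp
  have "(\<integral>y. \<bar>y\<bar> powr s \<partial>K x) = \<bar>x\<bar> powr s * (\<integral>y. jump_gain s (inward x y / \<bar>x\<bar>) \<partial>K x)
      + \<bar>x\<bar> powr s - s * \<bar>x\<bar> powr (s - 1) * (\<integral>y. inward x y \<partial>K x)"
    unfolding eq' using jgK iK by simp
  also have "(\<integral>y. jump_gain s (inward x y / \<bar>x\<bar>) \<partial>K x) = (\<integral>\<eta>. jump_gain s (\<eta> / \<bar>x\<bar>) \<partial>inward_law x)"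
    unfolding inward_law_def by (subst integral_distr) auto
  also have "(\<integral>y. inward x y \<partial>K x) = (\<integral>\<eta>. \<eta> \<partial>inward_law x)"
    unfolding inward_law_def by (subst integral_distr) auto
  finally show "(\<integral>y. \<bar>y\<bar> powr s \<partial>K x) = \<bar>x\<bar> powr s * (\<integral>\<eta>. jump_gain s (\<eta> / \<bar>x\<bar>) \<partial>inward_law x)
      + \<bar>x\<bar> powr s + s * \<bar>x\<bar> powr (s - 1) * - (\<integral>\<eta>. \<eta> \<partial>inward_law x)" by simp
qed

text \<open>The compensated jumps change |x|^s by order |x|^(s - \<beta>) and the mean drift by
  order |x|^(s - \<gamma> - 1). These orders agree at \<gamma> = \<beta> - 1; for smaller \<gamma>
  the jumps are negligible, hence the case distinction.\<close>

definition drift_coeff :: "real \<Rightarrow> real" where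
  "drift_coeff s = s * (b - (if \<gamma> = \<beta> - 1 then c * critical_ratio \<beta> s else 0))"

text \<open>A failure of uniformity would give states of arbitrarily large modulus, on either side
  of the origin, that violate the bound; the sequential limit applied to their inward laws excludes
  this.\<close>

lemma powr_drift_limit:
  assumes \<gamma>\<beta>: "\<gamma> \<le> \<beta> - 1" and s: "0 < s" "s < \<beta>" and e: "e > 0"
  shows "\<exists>R. \<forall>x\<in>X. \<bar>x\<bar> \<ge> R \<longrightarrow>
    \<bar>\<bar>x\<bar> powr (\<gamma> + 1 - s) * ((\<integral>y. \<bar>y\<bar> powr s \<partial>K x) - \<bar>x\<bar> powr s) - drift_coeff s\<bar> \<le> e"
proof (rule ccontr)
  let ?L = "\<lambda>x. \<bar>x\<bar> powr (\<gamma> + 1 - s) * ((\<integral>y. \<bar>y\<bar> powr s \<partial>K x) - \<bar>x\<bar> powr s)"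
  assume "\<not> ?thesis"
  then have "\<exists>x. x \<in> X \<and> \<bar>x\<bar> \<ge> max (real n) (max x0 1) \<and> \<bar>?L x - drift_coeff s\<bar> > e" for n
    by (meson not_le)
  then obtain z where z: "\<And>n. z n \<in> X" "\<And>n. \<bar>z n\<bar> \<ge> max (real n) (max x0 1)" "\<And>n. \<bar>?L (z n) - drift_coeff s\<bar> > e"
    by metis
  define r where "r n = \<bar>z n\<bar>" for n
  have r1: "r n \<ge> 1" and r0: "r n > 0" and rn: "r n \<ge> real n" and zx: "\<bar>z n\<bar> \<ge> max x0 1" for n
    using z(2)[of n] by (auto simp: r_def)
  have r_lim: "filterlim r at_top sequentially"
    by (rule filterlim_at_top_mono[OF filterlim_real_sequentially]) (use rn in auto)
  obtain B where B: "\<And>x. x \<in> X \<Longrightarrow> \<bar>x\<bar> \<ge> max x0 1 \<Longrightarrow> (\<integral>\<^sup>+\<eta>. ennreal (neg_part \<eta> powr \<alpha>) \<partial>inward_law x) \<le> ennreal B"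
    using outward_moment by auto
  have tl: "\<exists>Y. \<forall>y\<ge>Y. \<forall>n. \<bar>y powr \<beta> * measure (inward_law (z n)) {y<..} - c\<bar> \<le> e" if "e > 0" for e
    using inward_tail[OF that] z(1) zx by blast
  have J: "(\<lambda>n. r n powr \<beta> * (\<integral>\<eta>. jump_gain s (\<eta> / r n) \<partial>inward_law (z n))) \<longlonglongrightarrow> - (c * s * critical_ratio \<beta> s)"
    using jump_gain_limit(2)[of "\<lambda>n. inward_law (z n)", OF prob_space_inward_law sets_inward_law r0 r_lim \<beta> s \<alpha> tl B[OF z(1) zx]] by simp
  \<comment> \<open>The weight of the jump term relative to the drift normalisation.\<close>
  have R: "(\<lambda>n. r n powr (\<gamma> + 1 - \<beta>)) \<longlonglongrightarrow> (if \<gamma> = \<beta> - 1 then 1 else 0)"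
  proof (cases "\<gamma> = \<beta> - 1")
    case True
    then show ?thesis using r0 by (simp add: less_imp_neq[symmetric])
  next
    case False
    have "((\<lambda>x. x powr (\<gamma> + 1 - \<beta>)) \<longlongrightarrow> (0::real)) at_top" using False \<gamma>\<beta> by real_asymp
    from filterlim_compose[OF this r_lim] show ?thesis using False by simp
  qed
  have M: "(\<lambda>n. r n powr \<gamma> * - (\<integral>\<eta>. \<eta> \<partial>inward_law (z n))) \<longlonglongrightarrow> b"
  proof (rule tendstoI)
    fix e :: real assume e: "e > 0"
    then obtain R where R: "\<And>x. x \<in> X \<Longrightarrow> \<bar>x\<bar> \<ge> R \<Longrightarrow> \<bar>\<bar>x\<bar> powr \<gamma> * - (\<integral>\<eta>. \<eta> \<partial>inward_law x) - b\<bar> \<le> e / 2"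
      using inward_drift[of "e / 2"] by auto
    have "\<forall>\<^sub>F n in sequentially. r n \<ge> R" using r_lim unfolding filterlim_at_top by blast
    then show "\<forall>\<^sub>F n in sequentially. dist (r n powr \<gamma> * - (\<integral>\<eta>. \<eta> \<partial>inward_law (z n))) b < e"
    proof eventually_elim
      case (elim n)
      then show ?case using R[OF z(1), of n] e unfolding dist_real_def r_def by linarith
    qed
  qed
  have "?L (z n) = r n powr (\<gamma> + 1 - \<beta>) * (r n powr \<beta> * (\<integral>\<eta>. jump_gain s (\<eta> / r n) \<partial>inward_law (z n)))
      + s * (r n powr \<gamma> * - (\<integral>\<eta>. \<eta> \<partial>inward_law (z n)))" for n
  proof -
    have 1: "r n powr (\<gamma> + 1 - s) * r n powr s = r n powr (\<gamma> + 1 - \<beta>) * r n powr \<beta>"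
      by (simp add: powr_add[symmetric])
    have 2: "r n powr (\<gamma> + 1 - s) * r n powr (s - 1) = r n powr \<gamma>"
      by (simp add: powr_add[symmetric])
    have "?L (z n) = (r n powr (\<gamma> + 1 - s) * r n powr s) * (\<integral>\<eta>. jump_gain s (\<eta> / r n) \<partial>inward_law (z n))
      + s * ((r n powr (\<gamma> + 1 - s) * r n powr (s - 1)) * - (\<integral>\<eta>. \<eta> \<partial>inward_law (z n)))"
      unfolding powr_increment_eq(2)[OF z(1) zx s] r_def by (simp add: algebra_simps)
    then show ?thesis unfolding 1 2 by simp
  qed
  moreover have "(\<lambda>n. r n powr (\<gamma> + 1 - \<beta>) * (r n powr \<beta> * (\<integral>\<eta>. jump_gain s (\<eta> / r n) \<partial>inward_law (z n)))
      + s * (r n powr \<gamma> * - (\<integral>\<eta>. \<eta> \<partial>inward_law (z n)))) \<longlonglongrightarrow>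
      (if \<gamma> = \<beta> - 1 then 1 else 0) * - (c * s * critical_ratio \<beta> s) + s * b"
    by (intro tendsto_add tendsto_mult R J M tendsto_const)
  moreover have "(if \<gamma> = \<beta> - 1 then 1 else 0) * - (c * s * critical_ratio \<beta> s) + s * b = drift_coeff s"
    by (simp add: drift_coeff_def algebra_simps)
  ultimately have "(\<lambda>n. ?L (z n)) \<longlonglongrightarrow> drift_coeff s" by simp
  then have "\<forall>\<^sub>F n in sequentially. dist (?L (z n)) (drift_coeff s) < e" using e by (rule tendstoD)
  then obtain n where "dist (?L (z n)) (drift_coeff s) < e" by (auto simp: eventually_sequentially)
  then show False using z(3)[of n] by (simp add: dist_real_def)
qed

lemma powr_drift_bounds:
  assumes \<gamma>\<beta>: "\<gamma> \<le> \<beta> - 1" and s: "0 < s" "s < \<beta>" and l: "l < drift_coeff s" and u: "drift_coeff s < u"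
  shows "\<exists>R. \<forall>x\<in>X. \<bar>x\<bar> > R \<longrightarrow> integrable (K x) (\<lambda>y. \<bar>y\<bar> powr s) \<and>
    \<bar>x\<bar> powr s + l * \<bar>x\<bar> powr (s - (\<gamma> + 1)) \<le> (\<integral>y. \<bar>y\<bar> powr s \<partial>K x) \<and>
    (\<integral>y. \<bar>y\<bar> powr s \<partial>K x) \<le> \<bar>x\<bar> powr s + u * \<bar>x\<bar> powr (s - (\<gamma> + 1))"
proof -
  define e where "e = min (u - drift_coeff s) (drift_coeff s - l)"
  have e: "e > 0" using l u by (simp add: e_def)
  obtain R where R: "\<And>x. x \<in> X \<Longrightarrow> \<bar>x\<bar> \<ge> R \<Longrightarrow>
    \<bar>\<bar>x\<bar> powr (\<gamma> + 1 - s) * ((\<integral>y. \<bar>y\<bar> powr s \<partial>K x) - \<bar>x\<bar> powr s) - drift_coeff s\<bar> \<le> e"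
    using powr_drift_limit[OF \<gamma>\<beta> s e] by auto
  show ?thesis
  proof (intro exI[of _ "max R (max x0 1)"] ballI impI)
    fix x assume x: "x \<in> X" "\<bar>x\<bar> > max R (max x0 1)"
    then have x': "\<bar>x\<bar> \<ge> max x0 1" "\<bar>x\<bar> \<ge> R" and "\<bar>x\<bar> > 1" by auto
    then have pos: "\<bar>x\<bar> > 0" by linarith
    let ?d = "(\<integral>y. \<bar>y\<bar> powr s \<partial>K x) - \<bar>x\<bar> powr s"
    have *: "l \<le> \<bar>x\<bar> powr (\<gamma> + 1 - s) * ?d" "\<bar>x\<bar> powr (\<gamma> + 1 - s) * ?d \<le> u"
      using R[OF x(1) x'(2)] by (auto simp: e_def abs_le_iff)
    have inv: "\<bar>x\<bar> powr (s - (\<gamma> + 1)) * (\<bar>x\<bar> powr (\<gamma> + 1 - s) * ?d) = ?d"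
      using pos by (simp add: mult.assoc[symmetric] powr_add[symmetric])
    show "integrable (K x) (\<lambda>y. \<bar>y\<bar> powr s) \<and>
      \<bar>x\<bar> powr s + l * \<bar>x\<bar> powr (s - (\<gamma> + 1)) \<le> (\<integral>y. \<bar>y\<bar> powr s \<partial>K x) \<and>
      (\<integral>y. \<bar>y\<bar> powr s \<partial>K x) \<le> \<bar>x\<bar> powr s + u * \<bar>x\<bar> powr (s - (\<gamma> + 1))"
      using powr_increment_eq(1)[OF x(1) x'(1) s]
        mult_left_mono[OF *(1), of "\<bar>x\<bar> powr (s - (\<gamma> + 1))"] mult_left_mono[OF *(2), of "\<bar>x\<bar> powr (s - (\<gamma> + 1))"]
      unfolding inv by (simp add: mult.commute)
  qed
qed

text \<open>p < \<beta> provides uniformly bounded moments of order p, and p \<le> \<gamma> + 1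
  makes |x|^(p - 1) times the drift bounded.\<close>

lemma escape_bound:
  assumes p: "1 \<le> p" "p < \<beta>" "p \<le> \<gamma> + 1"
  shows "\<exists>a0. \<forall>a\<ge>a0. \<exists>\<delta>>0. \<forall>R>0. R \<ge> a \<longrightarrow> (\<forall>n. real n \<le> \<delta> * R powr p \<longrightarrow>
    (\<forall>x\<in>X. \<bar>x\<bar> \<ge> 3 * R \<longrightarrow> surv a n x \<ge> 1 / 2))"
proof -
  obtain M where M: "M \<ge> 0" "\<And>x. x \<in> X \<Longrightarrow> \<bar>x\<bar> \<ge> max x0 1 \<Longrightarrow>
      integrable (inward_law x) (\<lambda>\<eta>. \<bar>\<eta>\<bar> powr p) \<and> (\<integral>\<eta>. \<bar>\<eta>\<bar> powr p \<partial>inward_law x) \<le> M"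
    using increment_moment[OF p(1,2)] by auto
  obtain R where R: "\<And>x. x \<in> X \<Longrightarrow> \<bar>x\<bar> \<ge> R \<Longrightarrow> \<bar>\<bar>x\<bar> powr \<gamma> * - (\<integral>\<eta>. \<eta> \<partial>inward_law x) - b\<bar> \<le> 1"
    using inward_drift[of 1] by auto
  show ?thesis
  proof (rule exI[of _ "max R (max x0 1)"], intro allI impI, rule surv_lower_escape[where M="max M (\<bar>b\<bar> + 1)"])
    fix a assume "max R (max x0 1) \<le> a"
    then have a: "a \<ge> 1" "a \<ge> x0" "a \<ge> R" by auto
    then show "0 \<le> a" by simp
    show "1 \<le> p" "p \<le> 2" using p \<beta> by auto
    show "0 \<le> max M (\<bar>b\<bar> + 1)" by simp
    fix x assume x: "x \<in> X" "\<bar>x\<bar> > a"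
    then have x': "\<bar>x\<bar> \<ge> max x0 1" "\<bar>x\<bar> \<ge> R" and x1: "\<bar>x\<bar> > 1" and xn: "x \<noteq> 0" using a by auto
    have i: "integrable (inward_law x) (\<lambda>\<eta>. \<bar>\<eta>\<bar> powr p)" using M(2)[OF x(1) x'(1)] ..
    show "integrable (K x) (\<lambda>y. \<bar>y - x\<bar> powr p)"
      using i unfolding inward_law_def by (subst (asm) integrable_distr_eq) (auto simp: abs_inward[OF xn])
    have m: "(\<integral>\<eta>. \<bar>\<eta>\<bar> powr p \<partial>inward_law x) = (\<integral>y. \<bar>y - x\<bar> powr p \<partial>K x)"
      unfolding inward_law_def by (subst integral_distr) (auto simp: abs_inward[OF xn])
    have "(\<integral>y. \<bar>y - x\<bar> powr p \<partial>K x) \<le> M"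
      using M(2)[OF x(1) x'(1)] unfolding m by blast
    then show "(\<integral>y. \<bar>y - x\<bar> powr p \<partial>K x) \<le> max M (\<bar>b\<bar> + 1)"
      by (rule max.coboundedI1)
    have iK: "integrable (K x) (inward x)"
      using integrable_inward[OF x(1) x'(1)] unfolding inward_law_def by (subst (asm) integrable_distr_eq) auto
    have mK: "(\<integral>\<eta>. \<eta> \<partial>inward_law x) = (\<integral>y. inward x y \<partial>K x)"
      unfolding inward_law_def by (subst integral_distr) auto
    have "(\<lambda>y. y - x) = (\<lambda>y. - sgn x * inward x y)"
      using xn by (auto simp: fun_eq_iff inward_def sgn_if)
    then show "integrable (K x) (\<lambda>y. y - x)" using iK by simp
    have "(\<integral>y. y - x \<partial>K x) = - sgn x * (\<integral>\<eta>. \<eta> \<partial>inward_law x)"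
      unfolding mK \<open>(\<lambda>y. y - x) = (\<lambda>y. - sgn x * inward x y)\<close> by simp
    then have abs: "\<bar>\<integral>y. y - x \<partial>K x\<bar> = \<bar>\<integral>\<eta>. \<eta> \<partial>inward_law x\<bar>"
      using xn by (simp add: abs_mult abs_sgn_eq)
    have "\<bar>x\<bar> powr (p - 1) * \<bar>\<integral>y. y - x \<partial>K x\<bar> \<le> \<bar>x\<bar> powr \<gamma> * \<bar>\<integral>\<eta>. \<eta> \<partial>inward_law x\<bar>"
      unfolding abs using x1 p by (intro mult_right_mono powr_mono) auto
    also have "\<dots> = \<bar>\<bar>x\<bar> powr \<gamma> * - (\<integral>\<eta>. \<eta> \<partial>inward_law x)\<bar>" by (simp add: abs_mult)
    also have "\<dots> \<le> \<bar>b\<bar> + 1" using R[OF x(1) x'(2)] by linarith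
    finally show "\<bar>x\<bar> powr (p - 1) * \<bar>\<integral>y. y - x \<partial>K x\<bar> \<le> max M (\<bar>b\<bar> + 1)" by simp
  qed
qed

section \<open>Moments of the hitting time\<close>

lemma hit_moment_finite_subcritical:
  assumes \<gamma>\<beta>: "\<gamma> \<le> \<beta> - 1" and \<nu>: "0 < \<nu>" "\<nu> < \<gamma> + 1" and neg: "drift_coeff \<nu> < 0"
    and q: "0 < q" "q < \<nu> / (\<gamma> + 1)"
  shows "\<exists>a0. \<forall>a\<ge>a0. \<forall>x\<in>X. hit_moment \<Omega> \<xi> a q x < \<infinity>"
proof -
  have "\<nu> < \<beta>" using \<nu> \<gamma>\<beta> by simp
  then obtain R where R: "\<And>x. x \<in> X \<Longrightarrow> \<bar>x\<bar> > R \<Longrightarrow> integrable (K x) (\<lambda>y. \<bar>y\<bar> powr \<nu>) \<and>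
      (\<integral>y. \<bar>y\<bar> powr \<nu> \<partial>K x) \<le> \<bar>x\<bar> powr \<nu> + drift_coeff \<nu> / 2 * \<bar>x\<bar> powr (\<nu> - (\<gamma> + 1))"
    using powr_drift_bounds[OF \<gamma>\<beta> \<nu>(1), of "drift_coeff \<nu> - 1" "drift_coeff \<nu> / 2"] neg by auto
  show ?thesis
  proof (intro exI[of _ "max 0 R"] allI impI ballI)
    fix a x assume "max 0 R \<le> a" and x: "x \<in> X"
    then have a: "0 \<le> a" "R \<le> a" by auto
    obtain C where C: "\<And>n x. n \<ge> 1 \<Longrightarrow> x \<in> X \<Longrightarrow> surv a n x \<le> C * \<bar>x\<bar> powr \<nu> * real n powr (- \<nu> / (\<gamma> + 1))"
      using surv_upper_subcritical[OF a(1) \<nu>, of "- drift_coeff \<nu> / 2"] neg R a by fastforce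
    show "hit_moment \<Omega> \<xi> a q x < \<infinity>"
    proof (rule hit_moment_finite[OF x q])
      fix n :: nat assume n: "n \<ge> 1"
      have "surv a (2 * n) x \<le> surv a n x" by (rule surv_antimono) simp
      also have "\<dots> \<le> C * \<bar>x\<bar> powr \<nu> * real n powr (- (\<nu> / (\<gamma> + 1)))" using C[OF n x] by simp
      finally show "surv a (2 * n) x \<le> C * \<bar>x\<bar> powr \<nu> * real n powr (- (\<nu> / (\<gamma> + 1)))" .
    qed
  qed
qed

text \<open>The threshold \<beta> / (\<gamma> + 1) exceeds 1, so exponents \<nu> between \<gamma> +
  1 and \<beta> are required. As b dominates the jumps, all powers below \<beta> have negative drift
  coefficient.\<close>

lemma hit_moment_finite_supercritical:
  assumes \<gamma>\<beta>: "\<gamma> < \<beta> - 1" and b: "b < 0" and q: "0 < q" "q < \<beta> / (\<gamma> + 1)"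
  shows "\<exists>a0. \<forall>a\<ge>a0. \<forall>x\<in>X. hit_moment \<Omega> \<xi> a q x < \<infinity>"
proof -
  have "max (\<gamma> + 1) (q * (\<gamma> + 1)) < \<beta>" using \<gamma>\<beta> q \<gamma> by (simp add: less_divide_eq)
  then obtain \<nu> where "max (\<gamma> + 1) (q * (\<gamma> + 1)) < \<nu>" "\<nu> < \<beta>" using dense by blast
  then have \<nu>: "\<gamma> + 1 < \<nu>" "q * (\<gamma> + 1) < \<nu>" "\<nu> < \<beta>" by auto
  \<comment> \<open>From \<nu> < \<beta> < 2 and \<gamma> \<ge> 0: a single further round of the
    survival bound is enough.\<close>
  have \<nu>2: "\<nu> < 2 * (\<gamma> + 1)" using \<nu> \<beta> \<gamma> by simp
  have neg: "drift_coeff s < 0" if "s > 0" for s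
    using that b \<gamma>\<beta> by (simp add: drift_coeff_def mult_pos_neg)
  have bounds: "\<exists>R. \<forall>x\<in>X. \<bar>x\<bar> > R \<longrightarrow> integrable (K x) (\<lambda>y. \<bar>y\<bar> powr s) \<and>
      (\<integral>y. \<bar>y\<bar> powr s \<partial>K x) \<le> \<bar>x\<bar> powr s + drift_coeff s / 2 * \<bar>x\<bar> powr (s - (\<gamma> + 1))"
    if "0 < s" "s < \<beta>" for s
    using powr_drift_bounds[OF _ that, of "drift_coeff s - 1" "drift_coeff s / 2"] neg[OF that(1)] \<gamma>\<beta> by fastforce
  obtain R1 where R1: "\<And>x. x \<in> X \<Longrightarrow> \<bar>x\<bar> > R1 \<Longrightarrow> integrable (K x) (\<lambda>y. \<bar>y\<bar> powr \<nu>) \<and>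
      (\<integral>y. \<bar>y\<bar> powr \<nu> \<partial>K x) \<le> \<bar>x\<bar> powr \<nu> + drift_coeff \<nu> / 2 * \<bar>x\<bar> powr (\<nu> - (\<gamma> + 1))"
    using bounds[of \<nu>] \<nu> \<gamma> by auto
  define \<nu>' where "\<nu>' = \<nu> - (\<gamma> + 1)"
  have \<nu>': "0 < \<nu>'" "\<nu>' < \<beta>" using \<nu> \<gamma> by (auto simp: \<nu>'_def)
  obtain R2 where R2: "\<And>x. x \<in> X \<Longrightarrow> \<bar>x\<bar> > R2 \<Longrightarrow> integrable (K x) (\<lambda>y. \<bar>y\<bar> powr \<nu>') \<and>
      (\<integral>y. \<bar>y\<bar> powr \<nu>' \<partial>K x) \<le> \<bar>x\<bar> powr \<nu>' + drift_coeff \<nu>' / 2 * \<bar>x\<bar> powr (\<nu>' - (\<gamma> + 1))"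
    using bounds[OF \<nu>'] by auto
  define e where "e = min (- drift_coeff \<nu> / 2) (- drift_coeff \<nu>' / 2)"
  have e: "e > 0" "drift_coeff \<nu> / 2 \<le> - e" "drift_coeff \<nu>' / 2 \<le> - e"
    using neg[of \<nu>] neg[of \<nu>'] \<nu> \<nu>' \<gamma> by (auto simp: e_def)
  show ?thesis
  proof (intro exI[of _ "max 0 (max R1 R2)"] allI impI ballI)
    fix a x assume "max 0 (max R1 R2) \<le> a" and x: "x \<in> X"
    then have a: "0 \<le> a" "R1 \<le> a" "R2 \<le> a" by auto
    have "integrable (K x) (\<lambda>y. \<bar>y\<bar> powr s) \<and> (\<integral>y. \<bar>y\<bar> powr s \<partial>K x) \<le> \<bar>x\<bar> powr s - e * \<bar>x\<bar> powr (s - (\<gamma> + 1))"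
      if "x \<in> X" "\<bar>x\<bar> > a" "s \<in> {\<nu> - (\<gamma> + 1), \<nu>}" for x s
    proof -
      have "integrable (K x) (\<lambda>y. \<bar>y\<bar> powr s) \<and>
          (\<integral>y. \<bar>y\<bar> powr s \<partial>K x) \<le> \<bar>x\<bar> powr s + drift_coeff s / 2 * \<bar>x\<bar> powr (s - (\<gamma> + 1)) \<and> drift_coeff s / 2 \<le> - e"
        using that R1[of x] R2[of x] a e unfolding \<nu>'_def by auto
      moreover have "drift_coeff s / 2 * \<bar>x\<bar> powr (s - (\<gamma> + 1)) \<le> - e * \<bar>x\<bar> powr (s - (\<gamma> + 1))"
        using calculation by (intro mult_right_mono) auto
      ultimately show ?thesis by linarith
    qed
    then obtain C where C: "\<And>n x. n \<ge> 1 \<Longrightarrow> x \<in> X \<Longrightarrow> surv a (2 * n) x \<le> C * \<bar>x\<bar> powr \<nu> * real n powr (- \<nu> / (\<gamma> + 1))"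
      using surv_upper_supercritical[OF a(1) \<nu>(1) \<nu>2 e(1)] by meson
    show "hit_moment \<Omega> \<xi> a q x < \<infinity>"
    proof (rule hit_moment_finite[OF x q(1)])
      show "q < \<nu> / (\<gamma> + 1)" using \<nu>(2) \<gamma> by (simp add: less_divide_eq)
      show "surv a (2 * n) x \<le> C * \<bar>x\<bar> powr \<nu> * real n powr (- (\<nu> / (\<gamma> + 1)))" if "n \<ge> 1" for n
        using C[OF that x] by simp
    qed
  qed
qed

text \<open>The escape time scale is R^p with p < \<beta> only, so the rate obtained is n^(-\<nu> /
  p); the strict inequality in \<open>q\<close> leaves room for p close to \<beta>.\<close>

lemma hit_moment_infinite_submartingale:
  assumes \<gamma>\<beta>: "\<gamma> = \<beta> - 1" and \<nu>: "0 < \<nu>" "\<nu> < \<beta>" and pos: "drift_coeff \<nu> > 0" and q: "\<nu> / \<beta> < q"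
  shows "\<exists>a0. \<forall>a\<ge>a0. \<forall>x\<in>X. \<bar>x\<bar> > a \<longrightarrow> hit_moment \<Omega> \<xi> a q x = \<infinity>"
proof -
  have q0: "q > 0" using q \<nu> by (meson divide_pos_pos less_trans)
  have "max 1 (\<nu> / q) < \<beta>" using q q0 \<nu> \<beta> by (simp add: divide_less_eq mult.commute)
  then obtain p where "max 1 (\<nu> / q) < p" "p < \<beta>" using dense by blast
  then have p: "1 \<le> p" "\<nu> / q < p" "p < \<beta>" by auto
  have qp: "\<nu> / p < q" using p q0 by (simp add: divide_less_eq mult.commute)
  obtain s where s: "\<nu> < s" "s < \<beta>" using dense \<nu> by blast
  define e where "e = drift_coeff \<nu> / 2"
  \<comment> \<open>The auxiliary exponent s may have a drift of any sign; only an upper bound of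
    order |x|^(s - \<beta>) is used, and \<open>C \<ge> e\<close> keeps the ratio
    \<open>e / C\<close> at most 1.\<close>
  define C where "C = max e (drift_coeff s + 1)"
  have e: "e > 0" and C: "C \<ge> e" "drift_coeff s < C" using pos by (auto simp: e_def C_def)
  obtain R1 where R1: "\<And>x. x \<in> X \<Longrightarrow> \<bar>x\<bar> > R1 \<Longrightarrow> integrable (K x) (\<lambda>y. \<bar>y\<bar> powr \<nu>) \<and>
      \<bar>x\<bar> powr \<nu> + e * \<bar>x\<bar> powr (\<nu> - (\<gamma> + 1)) \<le> (\<integral>y. \<bar>y\<bar> powr \<nu> \<partial>K x)"
    using powr_drift_bounds[OF _ \<nu>, of e "drift_coeff \<nu> + 1"] pos \<gamma>\<beta> by (fastforce simp: e_def)
  obtain R2 where R2: "\<And>x. x \<in> X \<Longrightarrow> \<bar>x\<bar> > R2 \<Longrightarrow> integrable (K x) (\<lambda>y. \<bar>y\<bar> powr s) \<and>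
      (\<integral>y. \<bar>y\<bar> powr s \<partial>K x) \<le> \<bar>x\<bar> powr s + C * \<bar>x\<bar> powr (s - (\<gamma> + 1))"
    using powr_drift_bounds[of s "drift_coeff s - 1" C] C s \<nu> \<gamma>\<beta> by fastforce
  obtain a1 where a1: "\<And>a. a \<ge> a1 \<Longrightarrow> \<exists>\<delta>>0. \<forall>R>0. R \<ge> a \<longrightarrow> (\<forall>n. real n \<le> \<delta> * R powr p \<longrightarrow>
    (\<forall>x\<in>X. \<bar>x\<bar> \<ge> 3 * R \<longrightarrow> surv a n x \<ge> 1 / 2))"
    using escape_bound[of p] p \<gamma>\<beta> by auto
  show ?thesis
  proof (intro exI[of _ "max (max 0 a1) (max R1 R2)"] allI impI ballI)
    fix a x assume "max (max 0 a1) (max R1 R2) \<le> a" and x: "x \<in> X" "\<bar>x\<bar> > a"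
    then have a: "0 \<le> a" "a1 \<le> a" "R1 \<le> a" "R2 \<le> a" by auto
    obtain \<delta> where \<delta>: "\<delta> > 0" "\<And>R n x. R > 0 \<Longrightarrow> R \<ge> a \<Longrightarrow> real n \<le> \<delta> * R powr p \<Longrightarrow> x \<in> X \<Longrightarrow> \<bar>x\<bar> \<ge> 3 * R \<Longrightarrow> surv a n x \<ge> 1 / 2"
      using a1[OF a(2)] by blast
    have "\<exists>d>0. \<forall>\<^sub>F n in sequentially. surv a n x \<ge> d * real n powr (- \<nu> / p)"
    proof (rule surv_lower_submartingale[where \<kappa>="\<gamma> + 1" and C=C and s=s and e=e])
      show "0 \<le> a" "0 < \<nu>" "\<nu> < s" "0 < e" "e \<le> C" "0 < \<delta>" "x \<in> X" "a < \<bar>x\<bar>" "0 < p"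
        using a \<nu> s e C \<delta> x p by auto
      show "integrable (K x) (\<lambda>y. \<bar>y\<bar> powr r)" if "x \<in> X" "a < \<bar>x\<bar>" "r \<in> {\<nu>, s}" for x r
        using that R1[of x] R2[of x] a by auto
      show "\<bar>x\<bar> powr \<nu> + e * \<bar>x\<bar> powr (\<nu> - (\<gamma> + 1)) \<le> (\<integral>y. \<bar>y\<bar> powr \<nu> \<partial>K x)" if "x \<in> X" "a < \<bar>x\<bar>" for x
        using that R1[of x] a by auto
      show "(\<integral>y. \<bar>y\<bar> powr s \<partial>K x) \<le> \<bar>x\<bar> powr s + C * \<bar>x\<bar> powr (s - (\<gamma> + 1))" if "x \<in> X" "a < \<bar>x\<bar>" for x
        using that R2[of x] a by auto
    qed (rule \<delta>(2))
    then obtain d where d: "d > 0" "\<forall>\<^sub>F n in sequentially. surv a n x \<ge> d * real n powr (- \<nu> / p)" by auto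
    show "hit_moment \<Omega> \<xi> a q x = \<infinity>"
    proof (rule hit_moment_infinite[OF x(1) q0 d(1)])
      show "\<forall>\<^sub>F n in sequentially. surv a n x \<ge> d * real n powr (- q)"
        using d(2) eventually_ge_at_top[of 1]
      proof eventually_elim
        case (elim n)
        have "d * real n powr (- q) \<le> d * real n powr (- \<nu> / p)"
          using d qp elim by (intro mult_left_mono powr_mono) auto
        then show ?case using elim by linarith
      qed
    qed
  qed
qed

text \<open>Here p = \<gamma> + 1 is itself below \<beta>, so the escape time is of the exact order
  R^(\<gamma> + 1). A single overshooting first jump of order R has probability of order
  R^(-\<beta>), and no exponent is lost.\<close>

lemma hit_moment_infinite_one_jump:
  assumes \<gamma>\<beta>: "\<gamma> < \<beta> - 1" and q: "\<beta> / (\<gamma> + 1) \<le> q"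
  shows "\<exists>a0. \<forall>a\<ge>a0. \<forall>x\<in>X. \<bar>x\<bar> > a \<longrightarrow> hit_moment \<Omega> \<xi> a q x = \<infinity>"
proof -
  define p where "p = \<gamma> + 1"
  have p: "1 \<le> p" "p < \<beta>" "p \<le> \<gamma> + 1" using \<gamma> \<gamma>\<beta> by (auto simp: p_def)
  have q0: "q > 0" using q \<gamma> \<beta> by (meson add_nonneg_pos divide_pos_pos less_le_trans less_trans zero_less_one)
  obtain a1 where a1: "\<And>a. a \<ge> a1 \<Longrightarrow> \<exists>\<delta>>0. \<forall>R>0. R \<ge> a \<longrightarrow> (\<forall>n. real n \<le> \<delta> * R powr p \<longrightarrow>
    (\<forall>x\<in>X. \<bar>x\<bar> \<ge> 3 * R \<longrightarrow> surv a n x \<ge> 1 / 2))"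
    using escape_bound[of p] p by auto
  obtain Y where Y: "\<And>y x. y \<ge> Y \<Longrightarrow> x \<in> X \<Longrightarrow> \<bar>x\<bar> \<ge> max x0 1 \<Longrightarrow> \<bar>y powr \<beta> * measure (inward_law x) {y<..} - c\<bar> \<le> c / 2"
    using inward_tail[of "c / 2"] c by auto
  show ?thesis
  proof (intro exI[of _ "max (max x0 1) a1"] allI impI ballI)
    fix a x assume "max (max x0 1) a1 \<le> a" and x: "x \<in> X" "\<bar>x\<bar> > a"
    then have a: "1 \<le> a" "x0 \<le> a" "a1 \<le> a" and x': "\<bar>x\<bar> \<ge> max x0 1" by auto
    obtain \<delta> where \<delta>: "\<delta> > 0" "\<And>R n x. R > 0 \<Longrightarrow> R \<ge> a \<Longrightarrow> real n \<le> \<delta> * R powr p \<Longrightarrow> x \<in> X \<Longrightarrow> \<bar>x\<bar> \<ge> 3 * R \<Longrightarrow> surv a n x \<ge> 1 / 2"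
      using a1[OF a(3)] by blast
    define R where "R n = (real n / \<delta>) powr (1 / p)" for n :: nat
    have R_lim: "filterlim R at_top sequentially"
      unfolding R_def using \<delta>(1) p by real_asymp
    \<comment> \<open>The tail is at least half its limit and the escape probability at least 1/2,
      which gives \<open>c / 4\<close>; the rest comes from writing the jump size 4R in terms of
      n.\<close>
    define d where "d = c / 4 * 4 powr (-\<beta>) * \<delta> powr (\<beta> / p)"
    have d: "d > 0" using c \<delta> by (simp add: d_def)
    have "\<forall>\<^sub>F n in sequentially. R n > max (max a \<bar>x\<bar>) \<bar>Y\<bar>"
      using R_lim unfolding filterlim_at_top_dense by blast
    with eventually_gt_at_top[of 0] have ev: "\<forall>\<^sub>F n in sequentially. surv a n x \<ge> d * real n powr (- q)"
    proof eventually_elim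
      case (elim n)
      then have n: "n > 0" and Ra: "R n > a" and Rx: "R n > \<bar>x\<bar>" and RY: "R n > \<bar>Y\<bar>" by auto
      have Rpos: "R n > 0" using Ra a by simp
      \<comment> \<open>Since |x| < R, such a jump crosses the origin and lands farther than 3R on
        the other side, inside the escape region.\<close>
      define S where "S = {y. inward x y > 4 * R n}"
      have [measurable]: "S \<in> sets borel" unfolding S_def by measurable
      have Rp: "\<delta> * R n powr p = real n" using n p \<delta>(1) by (simp add: R_def powr_powr)
      have ind: "1 / 2 * indicator S y \<le> surv a n y" if "y \<in> X" for y
      proof (cases "y \<in> S")
        case True
        have xn: "x \<noteq> 0" using x a by auto
        have "3 * R n \<le> \<bar>y\<bar>"
          using True Rx abs_eq_inward[OF xn, of y] by (simp add: S_def)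
        then have "surv a n y \<ge> 1 / 2" using \<delta>(2)[of "R n" n y] Rpos Ra Rp that by simp
        then show ?thesis using True by simp
      qed simp
      interpret Kx: prob_space "K x" by (rule prob_space_K)
      have "measure (inward_law x) {4 * R n<..} = measure (K x) S"
        unfolding inward_law_def S_def by (subst measure_distr) (auto intro!: arg_cong[where f="measure (K x)"])
      moreover have "c / 2 \<le> (4 * R n) powr \<beta> * measure (inward_law x) {4 * R n<..}"
      proof -
        have "Y \<le> 4 * R n" using RY Rpos by linarith
        from Y[OF this x(1) x'] show ?thesis by linarith
      qed
      ultimately have "c / 2 * (4 * R n) powr (-\<beta>) \<le> measure (K x) S"
        using Rpos by (simp add: powr_minus_divide field_simps)
      then have "c / 4 * (4 * R n) powr (-\<beta>) \<le> (\<integral>y. 1 / 2 * indicator S y \<partial>K x)" by simp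
      also have "\<dots> \<le> surv a (Suc n) x"
      proof (rule surv_Suc_mono'[OF x _ ind])
        show "integrable (K x) (\<lambda>y. 1 / 2 * indicator S y :: real)"
          by (rule Kx.integrable_const_bound[where B=1]) (auto simp: indicator_def)
      qed
      also have "\<dots> \<le> surv a n x" by (rule surv_Suc_le)
      also have "c / 4 * (4 * R n) powr (-\<beta>) = d * real n powr (- \<beta> / p)"
      proof -
        have "R n powr (-\<beta>) = (real n / \<delta>) powr (- \<beta> / p)" by (simp add: R_def powr_powr)
        also have "\<dots> = real n powr (- \<beta> / p) * \<delta> powr (\<beta> / p)"
          using \<delta>(1) by (simp add: powr_divide powr_minus_divide)
        finally show ?thesis using Rpos by (simp add: powr_mult d_def)
      qed
      finally have "d * real n powr (- \<beta> / p) \<le> surv a n x" .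
      moreover have "d * real n powr (- q) \<le> d * real n powr (- \<beta> / p)"
        using d q n by (intro mult_left_mono powr_mono) (auto simp: p_def)
      ultimately show ?case by linarith
    qed
    show "hit_moment \<Omega> \<xi> a q x = \<infinity>"
      by (rule hit_moment_infinite[OF x(1) q0 d ev])
  qed
qed

text \<open>By strict monotonicity of the ratio, the drift coefficient is negative just below \<nu>
  and positive just above. Finiteness uses an exponent between q * \<beta> and \<nu>, divergence one
  between \<nu> and the minimum of q * \<beta> and \<beta>.\<close>

lemma moments_critical:
  assumes \<gamma>\<beta>: "\<gamma> = \<beta> - 1" and \<nu>: "0 < \<nu>" "\<nu> < \<beta>" "b / c = critical_ratio \<beta> \<nu>" and q: "q > 0"
  shows "\<exists>a0. \<forall>a\<ge>a0. \<forall>x\<in>X. \<bar>x\<bar> > a \<longrightarrow>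
    (q < \<nu> / \<beta> \<longrightarrow> hit_moment \<Omega> \<xi> a q x < \<infinity>) \<and> (q > \<nu> / \<beta> \<longrightarrow> hit_moment \<Omega> \<xi> a q x = \<infinity>)"
proof -
  have b: "b = c * critical_ratio \<beta> \<nu>" using \<nu>(3) c by (simp add: field_simps)
  have coeff: "drift_coeff s = s * (c * (critical_ratio \<beta> \<nu> - critical_ratio \<beta> s))" for s
  proof -
    have "drift_coeff s = s * (b - c * critical_ratio \<beta> s)"
      unfolding drift_coeff_def using \<gamma>\<beta> by simp
    also have "\<dots> = s * (c * critical_ratio \<beta> \<nu> - c * critical_ratio \<beta> s)" using b by simp
    finally show ?thesis by (simp only: right_diff_distrib)
  qed
  consider "q < \<nu> / \<beta>" | "q > \<nu> / \<beta>" | "q = \<nu> / \<beta>" by linarith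
  then show ?thesis
  proof cases
    case 1
    then have "q * \<beta> < \<nu>" using \<beta> by (simp add: less_divide_eq)
    then obtain s where s: "q * \<beta> < s" "s < \<nu>" using dense by blast
    have "0 < q * \<beta>" using q \<beta> by simp
    then have s0: "0 < s" using s by linarith
    have "critical_ratio \<beta> \<nu> < critical_ratio \<beta> s"
      using s s0 \<nu> by (intro critical_ratio_strict_antimono \<beta>) auto
    then have "drift_coeff s < 0"
      using s0 c unfolding coeff by (simp add: mult_pos_neg)
    moreover have "q < s / (\<gamma> + 1)" using s \<beta> by (simp add: \<gamma>\<beta> less_divide_eq)
    ultimately have "\<exists>a0. \<forall>a\<ge>a0. \<forall>x\<in>X. hit_moment \<Omega> \<xi> a q x < \<infinity>"
      using s s0 \<nu> q \<gamma>\<beta> by (intro hit_moment_finite_subcritical) auto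
    then show ?thesis using 1 by (meson less_asym)
  next
    case 2
    then have "\<nu> < q * \<beta>" using \<beta> by (simp add: divide_less_eq)
    then obtain s where "\<nu> < s" "s < min (q * \<beta>) \<beta>" using dense[of \<nu> "min (q * \<beta>) \<beta>"] \<nu> by auto
    then have s: "\<nu> < s" "s < q * \<beta>" "s < \<beta>" by auto
    have s0: "0 < s" using s \<nu> by simp
    have "critical_ratio \<beta> s < critical_ratio \<beta> \<nu>"
      using s \<nu> by (intro critical_ratio_strict_antimono \<beta>) auto
    then have "drift_coeff s > 0"
      using s0 c unfolding coeff by simp
    moreover have "s / \<beta> < q" using s \<beta> by (simp add: divide_less_eq)
    ultimately have "\<exists>a0. \<forall>a\<ge>a0. \<forall>x\<in>X. \<bar>x\<bar> > a \<longrightarrow> hit_moment \<Omega> \<xi> a q x = \<infinity>"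
      using s s0 \<gamma>\<beta> by (intro hit_moment_infinite_submartingale) auto
    then show ?thesis using 2 by (meson less_asym)
  qed simp
qed

lemma moments_strong_drift:
  assumes \<gamma>\<beta>: "\<gamma> < \<beta> - 1" and b: "b < 0" and q: "q > 0"
  shows "\<exists>a0. \<forall>a\<ge>a0. \<forall>x\<in>X. \<bar>x\<bar> > a \<longrightarrow>
    (q < \<beta> / (\<gamma> + 1) \<longrightarrow> hit_moment \<Omega> \<xi> a q x < \<infinity>) \<and> (q \<ge> \<beta> / (\<gamma> + 1) \<longrightarrow> hit_moment \<Omega> \<xi> a q x = \<infinity>)"
  using hit_moment_finite_supercritical[OF \<gamma>\<beta> b q] hit_moment_infinite_one_jump[OF \<gamma>\<beta>, of q]
  by (cases "q < \<beta> / (\<gamma> + 1)") (meson not_less)+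

end

text \<open>Lowering the exponent multiplies a bounded quantity by a negative power of |x|, so the
  limit becomes 0.\<close>

lemma cond_D'_weaken:
  assumes D: "cond_D' X \<Omega> \<xi> \<gamma> b" and \<gamma>': "0 \<le> \<gamma>'" "\<gamma>' < \<gamma>"
  shows "cond_D' X \<Omega> \<xi> \<gamma>' 0"
proof -
  \<comment> \<open>The predicate \<open>P\<close> selects a half-line and \<open>f\<close> carries
    the sign, so both ends are served at once.\<close>
  have key: "\<exists>M. \<forall>x\<in>X. M \<le> \<bar>x\<bar> \<longrightarrow> P x \<longrightarrow> \<bar>\<bar>x\<bar> powr \<gamma>' * f x\<bar> \<le> e"
    if e: "e > 0" and M: "\<exists>M. \<forall>x\<in>X. M \<le> \<bar>x\<bar> \<longrightarrow> P x \<longrightarrow> \<bar>\<bar>x\<bar> powr \<gamma> * f x - b\<bar> \<le> 1"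
    for e and P and f :: "real \<Rightarrow> real"
  proof -
    obtain M where M: "\<And>x. x \<in> X \<Longrightarrow> M \<le> \<bar>x\<bar> \<Longrightarrow> P x \<Longrightarrow> \<bar>\<bar>x\<bar> powr \<gamma> * f x - b\<bar> \<le> 1"
      using M by auto
    have "((\<lambda>r. (\<bar>b\<bar> + 1) * r powr (\<gamma>' - \<gamma>)) \<longlongrightarrow> (\<bar>b\<bar> + 1) * 0) at_top"
      using \<gamma>' by (intro tendsto_intros) real_asymp
    then have "\<forall>\<^sub>F r in at_top. (\<bar>b\<bar> + 1) * r powr (\<gamma>' - \<gamma>) < e"
      using e by (intro order_tendstoD(2)) auto
    then obtain R where R: "\<And>r. r \<ge> R \<Longrightarrow> (\<bar>b\<bar> + 1) * r powr (\<gamma>' - \<gamma>) < e"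
      by (auto simp: eventually_at_top_linorder)
    have "\<bar>\<bar>x\<bar> powr \<gamma>' * f x\<bar> \<le> e" if x: "x \<in> X" "max M (max R 1) \<le> \<bar>x\<bar>" "P x" for x
    proof -
      have "\<bar>x\<bar> powr \<gamma>' * f x = \<bar>x\<bar> powr (\<gamma>' - \<gamma>) * (\<bar>x\<bar> powr \<gamma> * f x)"
        by (simp add: mult.assoc[symmetric] powr_add[symmetric])
      then have "\<bar>\<bar>x\<bar> powr \<gamma>' * f x\<bar> = \<bar>x\<bar> powr (\<gamma>' - \<gamma>) * \<bar>\<bar>x\<bar> powr \<gamma> * f x\<bar>"
        by (simp add: abs_mult)
      also have "\<dots> \<le> \<bar>x\<bar> powr (\<gamma>' - \<gamma>) * (\<bar>b\<bar> + 1)"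
      proof (rule mult_left_mono)
        show "\<bar>\<bar>x\<bar> powr \<gamma> * f x\<bar> \<le> \<bar>b\<bar> + 1" using M[of x] x by auto
      qed simp
      also have "\<dots> \<le> e" using R[of "\<bar>x\<bar>"] x by (simp add: mult.commute)
      finally show ?thesis .
    qed
    then show ?thesis by blast
  qed
  have "\<exists>M. \<forall>x\<in>X. x \<ge> M \<longrightarrow> \<bar>x powr \<gamma>' * drift \<Omega> \<xi> x - 0\<bar> \<le> e" if e: "e > 0" for e
  proof -
    obtain M where M: "\<forall>x\<in>X. x \<ge> M \<longrightarrow> \<bar>x powr \<gamma> * drift \<Omega> \<xi> x - b\<bar> \<le> 1"
      using D unfolding cond_D'_def by (meson zero_less_one)
    have "\<exists>M. \<forall>x\<in>X. M \<le> \<bar>x\<bar> \<longrightarrow> 0 < x \<longrightarrow> \<bar>\<bar>x\<bar> powr \<gamma> * drift \<Omega> \<xi> x - b\<bar> \<le> 1"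
      using M by (intro exI[of _ M]) auto
    from key[OF e this] obtain M' where "\<forall>x\<in>X. M' \<le> \<bar>x\<bar> \<longrightarrow> 0 < x \<longrightarrow> \<bar>\<bar>x\<bar> powr \<gamma>' * drift \<Omega> \<xi> x\<bar> \<le> e" by blast
    then show ?thesis by (intro exI[of _ "max M' 1"]) auto
  qed
  moreover have "\<exists>M. \<forall>x\<in>X. x \<le> - M \<longrightarrow> \<bar>- (\<bar>x\<bar> powr \<gamma>' * drift \<Omega> \<xi> x) - 0\<bar> \<le> e" if e: "e > 0" for e
  proof -
    obtain M where M: "\<forall>x\<in>X. x \<le> - M \<longrightarrow> \<bar>- (\<bar>x\<bar> powr \<gamma> * drift \<Omega> \<xi> x) - b\<bar> \<le> 1"
      using D unfolding cond_D'_def by (meson zero_less_one)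
    have "\<exists>M. \<forall>x\<in>X. M \<le> \<bar>x\<bar> \<longrightarrow> x < 0 \<longrightarrow> \<bar>\<bar>x\<bar> powr \<gamma> * - drift \<Omega> \<xi> x - b\<bar> \<le> 1"
      using M by (intro exI[of _ M]) auto
    from key[OF e this] obtain M' where "\<forall>x\<in>X. M' \<le> \<bar>x\<bar> \<longrightarrow> x < 0 \<longrightarrow> \<bar>\<bar>x\<bar> powr \<gamma>' * - drift \<Omega> \<xi> x\<bar> \<le> e" by blast
    then show ?thesis by (intro exI[of _ "max M' 1"]) auto
  qed
  ultimately show ?thesis using \<gamma>' unfolding cond_D'_def by blast
qed

theorem theorem2p6:
  fixes X :: "real set" and K :: "real \<Rightarrow> real measure" and \<Omega> :: "real \<Rightarrow> 'w measure"
    and \<xi> :: "nat \<Rightarrow> 'w \<Rightarrow> real" and \<alpha> \<beta> c x0 \<gamma> b q :: real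
  assumes MC: "is_markov_chain X K \<Omega> \<xi>"
    and T: "cond_T_in X \<Omega> \<xi> \<alpha> \<beta> c x0"
    and D: "cond_D' X \<Omega> \<xi> \<gamma> b"
    and q: "q > 0"
  shows
    "(\<gamma> > \<beta> - 1 \<and> \<beta> - 1 > 1/2 \<longrightarrow>
       (\<exists>a0. \<forall>a\<ge>a0. \<forall>x\<in>X. \<bar>x\<bar> > a \<longrightarrow>
          (q < (2*\<beta> - 3) / \<beta> \<longrightarrow> hit_moment \<Omega> \<xi> a q x < \<infinity>) \<and>
          (q > (2*\<beta> - 3) / \<beta> \<longrightarrow> hit_moment \<Omega> \<xi> a q x = \<infinity>)))
   \<and> (\<gamma> = \<beta> - 1 \<and> b + c * pi * cot (pi * \<beta>) < 0 \<longrightarrow>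
       (\<exists>!\<nu>. 0 < \<nu> \<and> \<nu> < \<beta> \<and>
          b / c = Gamma \<nu> * ((1 - \<beta> + \<nu>) * Gamma (1 - \<beta>) / Gamma (2 - \<beta> + \<nu>)
                             - Gamma (\<beta> - \<nu>) / Gamma \<beta>)) \<and>
       (\<forall>\<nu>. 0 < \<nu> \<and> \<nu> < \<beta> \<and>
          b / c = Gamma \<nu> * ((1 - \<beta> + \<nu>) * Gamma (1 - \<beta>) / Gamma (2 - \<beta> + \<nu>)
                             - Gamma (\<beta> - \<nu>) / Gamma \<beta>) \<longrightarrow>
        (\<exists>a0. \<forall>a\<ge>a0. \<forall>x\<in>X. \<bar>x\<bar> > a \<longrightarrow>
          (q < \<nu> / \<beta> \<longrightarrow> hit_moment \<Omega> \<xi> a q x < \<infinity>) \<and>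
          (q > \<nu> / \<beta> \<longrightarrow> hit_moment \<Omega> \<xi> a q x = \<infinity>))))
   \<and> (\<gamma> < \<beta> - 1 \<and> b < 0 \<longrightarrow>
       (\<exists>a0. \<forall>a\<ge>a0. \<forall>x\<in>X. \<bar>x\<bar> > a \<longrightarrow>
          (q < \<beta> / (\<gamma> + 1) \<longrightarrow> hit_moment \<Omega> \<xi> a q x < \<infinity>) \<and>
          (q \<ge> \<beta> / (\<gamma> + 1) \<longrightarrow> hit_moment \<Omega> \<xi> a q x = \<infinity>)))"
proof -
  interpret inward_chain X K \<Omega> \<xi> \<alpha> \<beta> c x0 \<gamma> b
    using MC T D by (simp add: inward_chain_def inward_chain_axioms_def markov_chain_on_def)
  show ?thesis
  proof (intro conjI impI allI; (elim conjE)?)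
    assume \<gamma>': "\<gamma> > \<beta> - 1" and \<beta>': "\<beta> - 1 > 1 / 2"
    \<comment> \<open>With b = 0 the critical exponent is the zero 2 * \<beta> - 3 of the ratio; it
      is positive because \<beta> - 1 > 1 / 2, and below \<beta> because \<beta> < 2.\<close>
    interpret driftless: inward_chain X K \<Omega> \<xi> \<alpha> \<beta> c x0 "\<beta> - 1" 0
      using MC T cond_D'_weaken[OF D, of "\<beta> - 1"] \<gamma>' \<beta>
      by (simp add: inward_chain_def inward_chain_axioms_def markov_chain_on_def)
    show "\<exists>a0. \<forall>a\<ge>a0. \<forall>x\<in>X. \<bar>x\<bar> > a \<longrightarrow>
          (q < (2*\<beta> - 3) / \<beta> \<longrightarrow> hit_moment \<Omega> \<xi> a q x < \<infinity>) \<and>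
          (q > (2*\<beta> - 3) / \<beta> \<longrightarrow> hit_moment \<Omega> \<xi> a q x = \<infinity>)"
      using \<beta> \<beta>' critical_ratio_driftless[of \<beta>] by (intro driftless.moments_critical q) auto
  next
    \<comment> \<open>Divided by c > 0, the condition says that b / c lies below the limit of the
      ratio at 0.\<close>
    assume "b + c * pi * cot (pi * \<beta>) < 0"
    then have "b < (- pi * cot (pi * \<beta>)) * c" by (simp add: mult_ac)
    then have "b / c < - pi * cot (pi * \<beta>)" using c by (simp only: divide_less_eq if_True)
    from critical_ratio_eq_iff[OF \<beta> this]
    show "\<exists>!\<nu>. 0 < \<nu> \<and> \<nu> < \<beta> \<and>
          b / c = Gamma \<nu> * ((1 - \<beta> + \<nu>) * Gamma (1 - \<beta>) / Gamma (2 - \<beta> + \<nu>)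
                             - Gamma (\<beta> - \<nu>) / Gamma \<beta>)"
      by (simp only: critical_ratio_def)
  next
    fix \<nu>
    assume "\<gamma> = \<beta> - 1" "0 < \<nu>" "\<nu> < \<beta>"
      and "b / c = Gamma \<nu> * ((1 - \<beta> + \<nu>) * Gamma (1 - \<beta>) / Gamma (2 - \<beta> + \<nu>)
                             - Gamma (\<beta> - \<nu>) / Gamma \<beta>)"
    then show "\<exists>a0. \<forall>a\<ge>a0. \<forall>x\<in>X. \<bar>x\<bar> > a \<longrightarrow>
          (q < \<nu> / \<beta> \<longrightarrow> hit_moment \<Omega> \<xi> a q x < \<infinity>) \<and>
          (q > \<nu> / \<beta> \<longrightarrow> hit_moment \<Omega> \<xi> a q x = \<infinity>)"
      by (intro moments_critical q) (simp_all only: critical_ratio_def)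
  next
    assume "\<gamma> < \<beta> - 1" "b < 0"
    then show "\<exists>a0. \<forall>a\<ge>a0. \<forall>x\<in>X. \<bar>x\<bar> > a \<longrightarrow>
          (q < \<beta> / (\<gamma> + 1) \<longrightarrow> hit_moment \<Omega> \<xi> a q x < \<infinity>) \<and>
          (q \<ge> \<beta> / (\<gamma> + 1) \<longrightarrow> hit_moment \<Omega> \<xi> a q x = \<infinity>)"
      by (intro moments_strong_drift q)
  qed
qed

end
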